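(* Let $M$ be a complete complex hyperbolic $n$--manifold, i.e. $M=\mathbf{H}^n_{\mathbb C}/\Gamma$ for a discrete torsion-free $\Gamma<\operatorname{Isom}(\mathbf{H}^n_{\mathbb C})$. If $\delta(M)<2k$ for some positive integer $k\leq n$, then $M$ contains no compact complex $k$--dimensional subvarieties.
   Context: Complex hyperbolic $n$--space $\mathbf{H}^n_{\mathbb C}$ is normalized to have holomorphic sectional curvature $-4$, i.e. sectional curvatures in $[-4,-1]$. $\delta(M)=\delta(\Gamma)=\inf\{s:\sum_{\gamma\in\Gamma}e^{-s\,d(p,\gamma p)}<\infty\}$ is the critical exponent, for any $p\in\mathbf{H}^n_{\mathbb C}$. *)

theory Defs
  imports "HOL-Analysis.Analysis"
begin

definition herm :: "complex^'n \<Rightarrow> complex^'n \<Rightarrow> complex" where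
  "herm z w = (\<Sum>i\<in>UNIV. z $ i * cnj (w $ i))"

definition CHball :: "(complex^'n) set" where
  "CHball = {z. norm z < 1}"

text \<open>Bergman distance normalised so that holomorphic sectional curvature is -4:
  cosh d(z,w) = |1 - <z,w>| / sqrt((1-|z|^2)(1-|w|^2)).\<close>
definition chdist :: "complex^'n \<Rightarrow> complex^'n \<Rightarrow> real" where
  "chdist z w = arcosh (cmod (1 - herm z w) / sqrt ((1 - (norm z)^2) * (1 - (norm w)^2)))"

definition ch_isom :: "(complex^'n \<Rightarrow> complex^'n) \<Rightarrow> bool" where
  "ch_isom f \<longleftrightarrow> bij_betw f CHball CHball
     \<and> (\<forall>z\<in>CHball. \<forall>w\<in>CHball. chdist (f z) (f w) = chdist z w)
     \<and> (\<forall>z. z \<notin> CHball \<longrightarrow> f z = z)"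

definition isom_subgroup :: "(complex^'n \<Rightarrow> complex^'n) set \<Rightarrow> bool" where
  "isom_subgroup G \<longleftrightarrow> (\<forall>g\<in>G. ch_isom g) \<and> id \<in> G
     \<and> (\<forall>g\<in>G. \<forall>h\<in>G. g \<circ> h \<in> G)
     \<and> (\<forall>g\<in>G. \<exists>h\<in>G. g \<circ> h = id \<and> h \<circ> g = id)"

text \<open>Discreteness in the compact-open topology (= topology of uniform convergence on compacta).\<close>
definition discrete_isom_group :: "(complex^'n \<Rightarrow> complex^'n) set \<Rightarrow> bool" where
  "discrete_isom_group G \<longleftrightarrow> (\<forall>g\<in>G. \<exists>K e. compact K \<and> K \<subseteq> CHball \<and> e > 0 \<and>
      (\<forall>h\<in>G. (\<forall>z\<in>K. chdist (g z) (h z) < e) \<longrightarrow> h = g))"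

definition torsion_free :: "(complex^'n \<Rightarrow> complex^'n) set \<Rightarrow> bool" where
  "torsion_free G \<longleftrightarrow> (\<forall>g\<in>G. \<forall>m::nat. m > 0 \<and> (g ^^ m) = id \<longrightarrow> g = id)"

definition crit_exp :: "(complex^'n \<Rightarrow> complex^'n) set \<Rightarrow> complex^'n \<Rightarrow> ereal" where
  "crit_exp G p = Inf {ereal s | s. (\<lambda>g. exp (- s * chdist p (g p))) summable_on G}"

definition holo_on :: "(complex^'n) set \<Rightarrow> (complex^'n \<Rightarrow> complex) \<Rightarrow> bool" where
  "holo_on U f \<longleftrightarrow> (\<forall>z\<in>U. \<exists>a::complex^'n. (f has_derivative (\<lambda>v. \<Sum>i\<in>UNIV. a $ i * v $ i)) (at z))"

definition analytic_subset :: "(complex^'n) set \<Rightarrow> (complex^'n) set \<Rightarrow> bool" where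
  "analytic_subset U V \<longleftrightarrow> V \<subseteq> U \<and> (\<forall>z\<in>U. \<exists>W F. open W \<and> z \<in> W \<and> W \<subseteq> U \<and> finite F \<and>
      (\<forall>f\<in>F. holo_on W f) \<and> V \<inter> W = {w\<in>W. \<forall>f\<in>F. f w = 0})"

definition manifold_point :: "(complex^'n) set \<Rightarrow> nat \<Rightarrow> complex^'n \<Rightarrow> bool" where
  "manifold_point V k z \<longleftrightarrow> z \<in> V \<and> k \<le> CARD('n) \<and>
     (\<exists>W f a. open W \<and> z \<in> W \<and>
        (\<forall>j<CARD('n) - k. \<forall>w\<in>W. ((f j) has_derivative (\<lambda>v. \<Sum>i\<in>UNIV. a j w $ i * v $ i)) (at w)) \<and>
        (\<forall>w\<in>W. \<forall>c::nat \<Rightarrow> complex. (\<Sum>j<CARD('n) - k. c j *s a j w) = 0 \<longrightarrow> (\<forall>j<CARD('n) - k. c j = 0)) \<and>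
        V \<inter> W = {w\<in>W. \<forall>j<CARD('n) - k. f j w = (0::complex)})"

definition analytic_dim :: "(complex^'n) set \<Rightarrow> nat \<Rightarrow> bool" where
  "analytic_dim V k \<longleftrightarrow> (\<exists>z\<in>V. manifold_point V k z) \<and>
     (\<forall>z\<in>V. \<forall>j. manifold_point V j z \<longrightarrow> j \<le> k)"

text \<open>A compact complex k-dimensional subvariety of M = CHball/G, described by its lift:
  a G-invariant analytic subset of the ball of dimension k whose image in the quotient
  is compact (i.e. contained in the G-orbit of a compact set).\<close>
definition compact_subvariety_quot ::
  "(complex^'n \<Rightarrow> complex^'n) set \<Rightarrow> nat \<Rightarrow> (complex^'n) set \<Rightarrow> bool" where
  "compact_subvariety_quot G k V \<longleftrightarrow> analytic_subset CHball V \<and> analytic_dim V k \<and>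
     (\<forall>g\<in>G. g ` V \<subseteq> V) \<and>
     (\<exists>K. compact K \<and> K \<subseteq> CHball \<and> V \<subseteq> (\<Union>g\<in>G. g ` K))"

end

theory Submission
  imports Defs "HOL-Complex_Analysis.Complex_Analysis"
begin

text \<open>
  Let \<open>rho a z\<close> be \<open>cosh d(a,z)\<close> to the power \<open>-2\<close>. Since the critical exponent is below \<open>2k\<close>, the sum
  \<open>P(z)\<close> of \<open>rho (g p) z ^ k\<close> over the group converges to a continuous invariant function. Up to the squared
  modulus of a holomorphic function, \<open>rho a\<close> is \<open>rho x\<close> for any base point \<open>x\<close>; hence the trace of the
  complex Hessian of \<open>- rho a ^ k\<close> over any \<open>k\<close>-dimensional complex subspace, with respect to the Bergman
  metric, is positive, and \<open>- P\<close> has no local maximum on a complex manifold of dimension at least \<open>k\<close>.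

  On the \<open>k\<close>-dimensional part of a subvariety with compact quotient \<open>- P\<close> attains a maximum, possibly at a
  singular point. The maximum principle is insensitive to adding the real part of a holomorphic function and to
  subtracting a small multiple of \<open>|z|\<^sup>2\<close>. Adding \<open>\<delta> log |h|\<close>, with \<open>h\<close> holomorphic, pushes the maximum off the
  zero set of \<open>h\<close>. Choosing among all such perturbed maxima one at which the variety lies in a complex
  submanifold of the least dimension forces it to coincide with that submanifold there, which is a contradiction.
\<close>

section \<open>Holomorphic functions of several variables\<close>

text \<open>The exponent \<open>2 * k\<close> comes from one computation. In a direction
  \<open>e\<close> the second-order term of the circle means of \<open>rho a ^ k\<close> at
  \<open>x\<close> is \<open>rho a x ^ k\<close> times
  \<open>k^2 * |herm e (grad a x)|^2 - k * bergman x e\<close>. Over a Bergman-orthonormal real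
  basis with \<open>m >= 2 * k\<close> members the squared derivatives add up to at most
  \<open>2 * (1 - rho a x)\<close>, so the total is at most
  \<open>2 * k^2 * (1 - rho a x) - k * m <= - k * m * rho a x\<close>. This margin fades as
  \<open>a\<close> tends to the boundary, but the term of a single orbit point leaves a definite
  surplus of size \<open>rho ^ Suc k\<close>; it pays for the perturbation by \<open>|z|^2\<close>.
  The series is never differentiated. Four-point means replace Laplacians, and the estimate for one
  term holds at a radius common to all \<open>a\<close>, with an error proportional to
  \<open>rho a x ^ k\<close>; so it can be summed. At a singular maximum only the local equations of
  the variety and the accumulation of pieces are at hand. The perturbed heights form a class that is
  stable under change of chart, which is why the dimension of the chart can be lowered
  repeatedly.\<close>

lemma norm_smult_vec: "norm (c *s v) = cmod c * norm (v :: complex^'n)"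
  by (simp add: norm_vec_def L2_set_def norm_mult power_mult_distrib real_sqrt_mult
      flip: sum_distrib_left)

lemma bounded_linear_smult_left: "bounded_linear (\<lambda>\<zeta>. \<zeta> *s (v :: complex^'n))"
  by (rule bounded_linear_intro[where K = "norm v"])
     (auto simp: vec_eq_iff algebra_simps norm_smult_vec)

lemmas continuous_on_smult_vec [continuous_intros] =
  bounded_linear.continuous_on[OF bounded_linear_smult_left]

lemma complex_linear_expand:
  fixes D :: "complex^'n \<Rightarrow> complex"
  assumes "linear D" and "\<And>c v. D (c *s v) = c * D v"
  shows "D v = (\<Sum>i\<in>UNIV. D (axis i 1) * v $ i)"
proof -
  have "D v = D (\<Sum>i\<in>UNIV. v $ i *s axis i 1)"
    by (simp add: basis_expansion)
  also have "\<dots> = (\<Sum>i\<in>UNIV. D (axis i 1) * v $ i)"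
    by (simp add: linear_sum[OF assms(1)] assms(2) mult.commute)
  finally show ?thesis .
qed

lemma holo_on_iff:
  "holo_on U f \<longleftrightarrow> (\<forall>z\<in>U. \<exists>D. (f has_derivative D) (at z) \<and> (\<forall>c v. D (c *s v) = c * D v))"
proof
  assume "holo_on U f"
  show "\<forall>z\<in>U. \<exists>D. (f has_derivative D) (at z) \<and> (\<forall>c v. D (c *s v) = c * D v)"
  proof
    fix z assume "z \<in> U"
    with \<open>holo_on U f\<close> obtain a :: "complex^'a"
      where "(f has_derivative (\<lambda>v. \<Sum>i\<in>UNIV. a $ i * v $ i)) (at z)"
      unfolding holo_on_def by blast
    then show "\<exists>D. (f has_derivative D) (at z) \<and> (\<forall>c v. D (c *s v) = c * D v)"
      by (intro exI conjI) (auto simp: sum_distrib_left mult.left_commute)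
  qed
next
  assume R: "\<forall>z\<in>U. \<exists>D. (f has_derivative D) (at z) \<and> (\<forall>c v. D (c *s v) = c * D v)"
  show "holo_on U f"
    unfolding holo_on_def
  proof
    fix z assume "z \<in> U"
    with R obtain D where D: "(f has_derivative D) (at z)" "\<And>c v. D (c *s v) = c * D v"
      by blast
    have eq: "D = (\<lambda>v. \<Sum>i\<in>UNIV. (\<chi> i. D (axis i 1)) $ i * v $ i)"
      using D by (intro ext, subst complex_linear_expand[of D])
         (simp_all add: has_derivative_linear)
    show "\<exists>a. (f has_derivative (\<lambda>v. \<Sum>i\<in>UNIV. a $ i * v $ i)) (at z)"
      by (rule exI, rule has_derivative_eq_rhs[OF D(1) eq])
  qed
qed

section \<open>Directional derivatives and the Cauchy integral formula\<close>

definition dirderiv :: "(complex^'n \<Rightarrow> complex) \<Rightarrow> complex^'n \<Rightarrow> complex^'n \<Rightarrow> complex" where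
  "dirderiv f v z = deriv (\<lambda>\<zeta>. f (z + \<zeta> *s v)) 0"

lemma has_derivative_line:
  "((\<lambda>\<zeta>. z + \<zeta> *s v) has_derivative (\<lambda>\<zeta>. \<zeta> *s (v :: complex^'n))) F"
  using has_derivative_add[OF has_derivative_const
      bounded_linear.has_derivative[OF bounded_linear_smult_left[of v] has_derivative_ident]]
  by simp

lemma has_field_derivative_line:
  fixes f :: "complex^'n \<Rightarrow> complex"
  assumes "(f has_derivative D) (at (z + \<zeta> *s v))" and "\<And>c v. D (c *s v) = c * D v"
  shows "((\<lambda>\<zeta>. f (z + \<zeta> *s v)) has_field_derivative D v) (at \<zeta>)"
  using has_derivative_compose[of "\<lambda>\<zeta>. z + \<zeta> *s v" _ \<zeta> UNIV f D,
      OF has_derivative_line assms(1)] assms(2)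
  by (simp add: has_field_derivative_def mult_commute_abs)

lemma dirderiv_unique:
  fixes f :: "complex^'n \<Rightarrow> complex"
  assumes "(f has_derivative D) (at z)" and "\<And>c v. D (c *s v) = c * D v"
  shows "dirderiv f v z = D v"
  unfolding dirderiv_def
  by (rule DERIV_imp_deriv, rule has_field_derivative_line) (use assms in auto)

lemma holo_has_dirderiv:
  assumes "holo_on U f" "z \<in> U"
  shows holo_has_derivative_dirderiv: "(f has_derivative (\<lambda>v. dirderiv f v z)) (at z)"
    and dirderiv_smult: "dirderiv f (c *s v) z = c * dirderiv f v z"
proof -
  obtain D where D: "(f has_derivative D) (at z)" "\<And>c v. D (c *s v) = c * D v"
    using assms unfolding holo_on_iff by blast
  have "dirderiv f v z = D v" for v
    using dirderiv_unique[OF D] .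
  with D show "(f has_derivative (\<lambda>v. dirderiv f v z)) (at z)" "dirderiv f (c *s v) z = c * dirderiv f v z"
    by simp_all
qed

lemma dirderiv_line:
  assumes "holo_on U f" "z + \<zeta> *s v \<in> U"
  shows "((\<lambda>\<zeta>. f (z + \<zeta> *s v)) has_field_derivative dirderiv f v (z + \<zeta> *s v)) (at \<zeta>)"
  by (rule has_field_derivative_line[OF holo_has_derivative_dirderiv])
     (use assms dirderiv_smult in auto)

lemma holo_line:
  assumes "holo_on U f" "\<And>\<zeta>. \<zeta> \<in> A \<Longrightarrow> z + \<zeta> *s v \<in> U"
  shows "(\<lambda>\<zeta>. f (z + \<zeta> *s v)) holomorphic_on A"
  unfolding holomorphic_on_def field_differentiable_def
  using dirderiv_line[OF assms(1) assms(2)] has_field_derivative_at_within by blast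

lemma holo_on_continuous: "holo_on U f \<Longrightarrow> continuous_on U f"
  unfolding holo_on_def
  by (meson continuous_at_imp_continuous_on has_derivative_continuous)

lemma holo_on_subset: "holo_on U f \<Longrightarrow> T \<subseteq> U \<Longrightarrow> holo_on T f"
  unfolding holo_on_def by blast

text \<open>Cauchy's formula on a circle in the direction \<open>v\<close>. The radius depends on
  \<open>d\<close> and \<open>v\<close> only, so the same path and kernel serve every base point in
  \<open>ball z0 d\<close>: a derivative of \<open>f\<close> becomes an integral of translates of
  \<open>f\<close>.\<close>

lemma dirderiv_integral:
  fixes f :: "complex^'n \<Rightarrow> complex"
  assumes f: "holo_on U f" and d: "cball z0 (2 * d) \<subseteq> U" "0 < d"
  obtains \<gamma> :: "real \<Rightarrow> complex^'n" and \<kappa> :: "real \<Rightarrow> complex"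
  where "continuous_on {0..1} \<gamma>" "continuous_on {0..1} \<kappa>"
    "\<And>z t. z \<in> ball z0 d \<Longrightarrow> t \<in> {0..1} \<Longrightarrow> z + \<gamma> t \<in> U"
    "\<And>z. z \<in> ball z0 d \<Longrightarrow> dirderiv f v z = integral {0..1} (\<lambda>t. f (z + \<gamma> t) * \<kappa> t)"
proof -
  define r where "r = d / (norm v + 1)"
  have r: "r > 0" using d by (simp add: r_def add_nonneg_pos)
  have rv: "r * norm v \<le> d"
    using d mult_left_mono[of "norm v" "norm v + 1" d]
    by (simp add: r_def pos_divide_le_eq add_nonneg_pos)
  have inU: "z + \<zeta> *s v \<in> U" if "z \<in> ball z0 d" "cmod \<zeta> \<le> r" for z \<zeta>
  proof -
    have "norm (\<zeta> *s v) \<le> r * norm v"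
      using that by (simp add: norm_smult_vec mult_right_mono)
    with rv have "norm (\<zeta> *s v) \<le> d" by simp
    moreover have "dist z0 (z + \<zeta> *s v) \<le> dist z0 z + norm (\<zeta> *s v)"
      by (metis dist_triangle dist_add_cancel add.right_neutral dist_0_norm)
    ultimately show ?thesis
      using that d by (auto intro!: subsetD[OF d(1)])
  qed
  define c where "c = circlepath 0 r"
  define \<kappa> where "\<kappa> t = 1 / (2 * pi * \<i>) * (1 / c t ^ 2 * vector_derivative c (at t))" for t
  have c_norm: "cmod (c t) = r" for t
    using r by (simp add: c_def circlepath norm_mult exp_eq_polar)
  have c_cont: "continuous_on A c" for A
    unfolding c_def circlepath by (intro continuous_intros)
  show ?thesis
  proof
    show "continuous_on {0..1} (\<lambda>t. c t *s v)"
      by (intro continuous_intros c_cont)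
    have "c t \<noteq> 0" for t
      using c_norm[of t] r by auto
    then show "continuous_on {0..1} \<kappa>"
      unfolding \<kappa>_def using c_cont
      by (auto simp: c_def vector_derivative_circlepath intro!: continuous_intros)
    show "z + c t *s v \<in> U" if "z \<in> ball z0 d" "t \<in> {0..1}" for z t
      using inU that c_norm by simp
    show "dirderiv f v z = integral {0..1} (\<lambda>t. f (z + c t *s v) * \<kappa> t)" if "z \<in> ball z0 d" for z
    proof -
      let ?g = "\<lambda>\<zeta>. f (z + \<zeta> *s v)"
      have hol: "?g holomorphic_on cball 0 r"
        using inU[OF that] by (intro holo_line[OF f]) auto
      have "(?g has_field_derivative 1 / (2 * pi * \<i>) *
               contour_integral c (\<lambda>u. ?g u / (u - 0)^2)) (at 0)"
        unfolding c_def of_real_mult of_real_numeral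
        by (rule Cauchy_derivative_integral_circlepath)
          (use r hol in \<open>auto intro: holomorphic_on_imp_continuous_on holomorphic_on_subset\<close>)
      then have "dirderiv f v z = 1 / (2 * pi * \<i>) * contour_integral c (\<lambda>u. ?g u / (u - 0)^2)"
        unfolding dirderiv_def by (rule DERIV_imp_deriv)
      also have "\<dots> = integral {0..1} (\<lambda>t. f (z + c t *s v) * \<kappa> t)"
        unfolding contour_integral_integral \<kappa>_def integral_mult_right[symmetric]
        by (rule integral_cong) (simp add: mult_ac)
      finally show ?thesis .
    qed
  qed
qed

lemma continuous_on_dirderiv:
  fixes f :: "complex^'n \<Rightarrow> complex"
  assumes f: "holo_on U f" and "open U"
  shows "continuous_on U (dirderiv f v)"
  unfolding continuous_on_eq_continuous_at[OF assms(2)]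
proof
  fix z0 assume "z0 \<in> U"
  then obtain e where "e > 0" "cball z0 e \<subseteq> U"
    using assms(2) open_contains_cball by blast
  then have d: "cball z0 (2 * (e/2)) \<subseteq> U" "0 < e/2" by auto
  obtain \<gamma> :: "real \<Rightarrow> complex^'n" and \<kappa> where g: "continuous_on {0..1} \<gamma>" "continuous_on {0..1} \<kappa>"
    "\<And>z t. z \<in> ball z0 (e/2) \<Longrightarrow> t \<in> {0..1} \<Longrightarrow> z + \<gamma> t \<in> U"
    "\<And>z. z \<in> ball z0 (e/2) \<Longrightarrow> dirderiv f v z = integral {0..1} (\<lambda>t. f (z + \<gamma> t) * \<kappa> t)"
    using dirderiv_integral[OF f d] by blast
  have "continuous_on (ball z0 (e/2)) (\<lambda>z. integral (cbox 0 1) (\<lambda>t. f (z + \<gamma> t) * \<kappa> t))"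
  proof (rule integral_continuous_on_param)
    have 1: "continuous_on (ball z0 (e/2) \<times> cbox 0 1) (\<lambda>p. \<gamma> (snd p))"
      and 2: "continuous_on (ball z0 (e/2) \<times> cbox 0 1) (\<lambda>p. \<kappa> (snd p))"
      using g(1,2) by (auto intro!: continuous_on_compose2[OF _ continuous_on_snd[OF continuous_on_id]])
    show "continuous_on (ball z0 (e/2) \<times> cbox 0 1) (\<lambda>(z, t). f (z + \<gamma> t) * \<kappa> t)"
      unfolding case_prod_unfold
      using g(3) by (intro continuous_intros continuous_on_compose2[OF holo_on_continuous[OF f]] 1 2) auto
  qed
  then have "continuous_on (ball z0 (e/2)) (dirderiv f v)"
    by (rule continuous_on_cong[THEN iffD1, rotated 2]) (use g(4) in auto)
  then show "isCont (dirderiv f v) z0"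
    by (rule continuous_on_interior) (use d in simp)
qed

text \<open>\<open>holo_on\<close> grants only pointwise differentiability. Differentiating the
  Cauchy integral under the integral sign produces the second derivative, whose complex linearity is
  inherited from the integrand.\<close>

lemma holo_on_dirderiv:
  fixes f :: "complex^'n \<Rightarrow> complex"
  assumes f: "holo_on U f" and "open U"
  shows "holo_on U (dirderiv f v)"
  unfolding holo_on_iff
proof
  fix z0 assume "z0 \<in> U"
  then obtain e where "e > 0" "cball z0 e \<subseteq> U"
    using assms(2) open_contains_cball by blast
  then have d: "cball z0 (2 * (e/2)) \<subseteq> U" "0 < e/2" by auto
  let ?B = "ball z0 (e/2)"
  obtain \<gamma> :: "real \<Rightarrow> complex^'n" and \<kappa> where g: "continuous_on {0..1} \<gamma>" "continuous_on {0..1} \<kappa>"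
    "\<And>z t. z \<in> ?B \<Longrightarrow> t \<in> {0..1} \<Longrightarrow> z + \<gamma> t \<in> U"
    "\<And>z. z \<in> ?B \<Longrightarrow> dirderiv f v z = integral {0..1} (\<lambda>t. f (z + \<gamma> t) * \<kappa> t)"
    using dirderiv_integral[OF f d] by blast
  define fx where "fx z t = Blinfun (\<lambda>w. dirderiv f w (z + \<gamma> t) * \<kappa> t)" for z t
  have bl: "bounded_linear (\<lambda>w. dirderiv f w (z + \<gamma> t) * \<kappa> t)" if "z \<in> ?B" "t \<in> {0..1}" for z t
    using has_derivative_bounded_linear[OF holo_has_derivative_dirderiv[OF f g(3)[OF that]]]
    by (rule bounded_linear_mult_const)
  have fx: "blinfun_apply (fx z t) w = dirderiv f w (z + \<gamma> t) * \<kappa> t" if "z \<in> ?B" "t \<in> {0..1}" for z t w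
    unfolding fx_def by (subst bounded_linear_Blinfun_apply[OF bl[OF that]]) simp
  have 1: "continuous_on (?B \<times> cbox 0 1) (\<lambda>p. \<gamma> (snd p))"
    and 2: "continuous_on (?B \<times> cbox 0 1) (\<lambda>p. \<kappa> (snd p))"
    using g(1,2) by (auto intro!: continuous_on_compose2[OF _ continuous_on_snd[OF continuous_on_id]])
  have cfx: "continuous_on (?B \<times> cbox 0 1) (\<lambda>(z, t). fx z t)"
  proof (rule continuous_on_blinfun_componentwise)
    fix w :: "complex^'n"
    have "continuous_on (?B \<times> cbox 0 1) (\<lambda>p. dirderiv f w (fst p + \<gamma> (snd p)) * \<kappa> (snd p))"
      using g(3) by (intro continuous_intros continuous_on_compose2[OF continuous_on_dirderiv[OF f assms(2)]] 1 2) auto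
    then show "continuous_on (?B \<times> cbox 0 1) (\<lambda>p. blinfun_apply (case p of (z, t) \<Rightarrow> fx z t) w)"
      by (rule continuous_on_cong[THEN iffD1, rotated 2]) (auto simp: fx)
  qed
  have cf: "continuous_on (cbox 0 1) (\<lambda>t. f (z + \<gamma> t) * \<kappa> t)" if "z \<in> ?B" for z
    using g(1-3) that by (intro continuous_intros continuous_on_compose2[OF holo_on_continuous[OF f]]) auto
  have "((\<lambda>z. integral (cbox 0 1) (\<lambda>t. f (z + \<gamma> t) * \<kappa> t)) has_derivative
      integral (cbox 0 1) (fx z0)) (at z0 within ?B)"
  proof (rule leibniz_rule[OF _ _ cfx])
    fix z and t :: real assume zt: "z \<in> ?B" "t \<in> cbox 0 1"
    have "((\<lambda>z. z + \<gamma> t) has_derivative (\<lambda>w. w)) (at z within ?B)"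
      by (auto intro!: derivative_eq_intros)
    from has_derivative_compose[OF this holo_has_derivative_dirderiv[OF f g(3)]] zt
    have "((\<lambda>z. f (z + \<gamma> t)) has_derivative (\<lambda>w. dirderiv f w (z + \<gamma> t))) (at z within ?B)"
      by simp
    then have "((\<lambda>z. f (z + \<gamma> t) * \<kappa> t) has_derivative (\<lambda>w. dirderiv f w (z + \<gamma> t) * \<kappa> t)) (at z within ?B)"
      by (rule has_derivative_mult_left)
    then show "((\<lambda>z. f (z + \<gamma> t) * \<kappa> t) has_derivative blinfun_apply (fx z t)) (at z within ?B)"
      using fx zt by (auto elim!: has_derivative_eq_rhs)
  next
    show "(\<lambda>t. f (z + \<gamma> t) * \<kappa> t) integrable_on cbox 0 1" if "z \<in> ?B" for z
      by (rule integrable_continuous[OF cf[OF that]])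
  qed (use d in auto)
  then have "((\<lambda>z. integral {0..1} (\<lambda>t. f (z + \<gamma> t) * \<kappa> t)) has_derivative
      integral (cbox 0 1) (fx z0)) (at z0)"
    using d at_within_open[of z0 ?B] by simp
  then have der: "(dirderiv f v has_derivative integral (cbox 0 1) (fx z0)) (at z0)"
    by (rule has_derivative_transform_within_open[of _ _ _ _ ?B]) (use d g(4) in auto)
  have z0: "z0 \<in> ?B" using d by simp
  have "continuous_on (cbox 0 1) (\<lambda>t. case (z0, t) of (z, t) \<Rightarrow> fx z t)"
    by (rule continuous_on_compose2[OF cfx]) (use z0 in \<open>auto intro!: continuous_intros\<close>)
  then have "continuous_on (cbox 0 1) (fx z0)"
    by simp
  then have int: "fx z0 integrable_on cbox 0 1"
    by (rule integrable_continuous)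
  have app: "blinfun_apply (integral (cbox 0 1) (fx z0)) w
      = integral (cbox 0 1) (\<lambda>t. dirderiv f w (z0 + \<gamma> t) * \<kappa> t)" for w
    by (subst blinfun_apply_integral[OF int]) (rule integral_cong, use fx z0 in auto)
  have "blinfun_apply (integral (cbox 0 1) (fx z0)) (c *s w)
      = c * blinfun_apply (integral (cbox 0 1) (fx z0)) w" for c w
    unfolding app integral_mult_right[symmetric]
    by (rule integral_cong) (use dirderiv_smult[OF f g(3)[OF z0]] in simp)
  with der show "\<exists>D. (dirderiv f v has_derivative D) (at z0) \<and> (\<forall>c v. D (c *s v) = c * D v)"
    by blast
qed

section \<open>Holomorphic maps and their local inverses\<close>

definition hmap :: "(complex^'n) set \<Rightarrow> (complex^'n \<Rightarrow> complex^'m) \<Rightarrow> bool" where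
  "hmap U f \<longleftrightarrow> (\<forall>z\<in>U. \<exists>D. (f has_derivative D) (at z) \<and> (\<forall>c v. D (c *s v) = c *s D v))"

lemma holo_compose:
  assumes "holo_on U f" "hmap N \<psi>" "\<psi> ` N \<subseteq> U"
  shows "holo_on N (\<lambda>y. f (\<psi> y))"
  unfolding holo_on_iff
proof
  fix y assume y: "y \<in> N"
  obtain D where D: "(\<psi> has_derivative D) (at y)" "\<And>c v. D (c *s v) = c *s D v"
    using assms(2) y unfolding hmap_def by blast
  obtain D' where D': "(f has_derivative D') (at (\<psi> y))" "\<And>c v. D' (c *s v) = c * D' v"
    using assms(1,3) y unfolding holo_on_iff by blast
  show "\<exists>D. ((\<lambda>y. f (\<psi> y)) has_derivative D) (at y) \<and> (\<forall>c v. D (c *s v) = c * D v)"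
    using has_derivative_compose[OF D(1) D'(1)] D(2) D'(2) by (intro exI conjI) auto
qed

lemma hmap_compose:
  assumes "hmap U f" "hmap N \<psi>" "\<psi> ` N \<subseteq> U"
  shows "hmap N (\<lambda>y. f (\<psi> y))"
  unfolding hmap_def
proof
  fix y assume y: "y \<in> N"
  obtain D where D: "(\<psi> has_derivative D) (at y)" "\<And>c v. D (c *s v) = c *s D v"
    using assms(2) y unfolding hmap_def by blast
  obtain D' where D': "(f has_derivative D') (at (\<psi> y))" "\<And>c v. D' (c *s v) = c *s D' v"
    using assms(1,3) y unfolding hmap_def by blast
  show "\<exists>D. ((\<lambda>y. f (\<psi> y)) has_derivative D) (at y) \<and> (\<forall>c v. D (c *s v) = c *s D v)"
    using has_derivative_compose[OF D(1) D'(1)] D(2) D'(2) by (intro exI conjI) auto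
qed

lemma hmap_translation: "hmap U (\<lambda>y. c + (y :: complex^'n))"
  unfolding hmap_def by (auto intro!: exI[of _ "\<lambda>v. v"] derivative_eq_intros)

lemma hmap_continuous: "hmap U f \<Longrightarrow> continuous_on U f"
  unfolding hmap_def
  by (meson continuous_at_imp_continuous_on has_derivative_continuous)

lemma hmap_subset: "hmap U f \<Longrightarrow> T \<subseteq> U \<Longrightarrow> hmap T f"
  unfolding hmap_def by blast

lemma holo_on_linear:
  assumes "bounded_linear L" "\<And>c v. L (c *s v) = c * L v"
  shows "holo_on U L"
  unfolding holo_on_iff using assms bounded_linear_imp_has_derivative by blast

lemma holo_on_const: "holo_on U (\<lambda>z. c)"
  unfolding holo_on_iff by (auto intro!: exI[of _ "\<lambda>v. 0"])

lemma holo_on_add: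
  assumes "holo_on U f" "holo_on U g"
  shows "holo_on U (\<lambda>z. f z + g z)"
  unfolding holo_on_iff
proof
  fix z assume "z \<in> U"
  with assms obtain D D' where "(f has_derivative D) (at z)" "\<And>c v. D (c *s v) = c * D v"
    "(g has_derivative D') (at z)" "\<And>c v. D' (c *s v) = c * D' v"
    unfolding holo_on_iff by meson
  then show "\<exists>D. ((\<lambda>z. f z + g z) has_derivative D) (at z) \<and> (\<forall>c v. D (c *s v) = c * D v)"
    by (intro exI[of _ "\<lambda>v. D v + D' v"]) (auto intro: has_derivative_add simp: distrib_left)
qed

lemma holo_on_compose_field:
  assumes "holo_on U f" "\<And>z. z \<in> U \<Longrightarrow> (g has_field_derivative g' z) (at (f z))"
  shows "holo_on U (\<lambda>z. g (f z))"
  unfolding holo_on_iff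
proof
  fix z assume z: "z \<in> U"
  with assms(1) obtain D where D: "(f has_derivative D) (at z)" "\<And>c v. D (c *s v) = c * D v"
    unfolding holo_on_iff by meson
  have "((\<lambda>z. g (f z)) has_derivative (\<lambda>v. g' z * D v)) (at z)"
    using has_derivative_compose[OF D(1) assms(2)[OF z, unfolded has_field_derivative_def]] .
  then show "\<exists>D. ((\<lambda>z. g (f z)) has_derivative D) (at z) \<and> (\<forall>c v. D (c *s v) = c * D v)"
    by (intro exI[of _ "\<lambda>v. g' z * D v"]) (auto simp: D(2))
qed

lemma holo_on_cmult: "holo_on U f \<Longrightarrow> holo_on U (\<lambda>z. c * f z)"
  by (rule holo_on_compose_field[where g' = "\<lambda>_. c" and g = "\<lambda>w. c * w"])
     (auto intro!: derivative_eq_intros)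

lemma local_inverse:
  fixes f :: "'a :: euclidean_space \<Rightarrow> 'a"
  assumes "open U" "z0 \<in> U"
    and der: "\<And>y. y \<in> U \<Longrightarrow> (f has_derivative D y) (at y)"
    and cont: "\<And>v. continuous_on U (\<lambda>y. D y v)"
    and inj: "inj (D z0)"
  obtains U' V g where "open U'" "U' \<subseteq> U" "z0 \<in> U'" "open V" "homeomorphism U' V f g"
    "\<And>y. y \<in> V \<Longrightarrow> (g has_derivative inv (D (g y))) (at y)"
    "\<And>y. y \<in> V \<Longrightarrow> bij (D (g y))"
proof -
  define f' where "f' y = Blinfun (D y)" for y
  have app: "blinfun_apply (f' y) = D y" if "y \<in> U" for y
    unfolding f'_def using has_derivative_bounded_linear[OF der[OF that]]
    by (simp add: bounded_linear_Blinfun_apply)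
  have lin: "linear (D z0)"
    using der[OF assms(2)] has_derivative_linear by blast
  obtain h where h: "linear h" "h \<circ> D z0 = id"
    using linear_injective_left_inverse[OF lin inj] by blast
  have "bounded_linear h"
    using h(1) linear_conv_bounded_linear by blast
  then have "Blinfun h o\<^sub>L f' z0 = id_blinfun"
    using h(2) by (intro blinfun_eqI)
      (simp add: bounded_linear_Blinfun_apply app[OF assms(2)] pointfree_idE)
  moreover have "continuous_on U f'"
  proof (rule continuous_on_blinfun_componentwise)
    fix i :: 'a
    show "continuous_on U (\<lambda>y. blinfun_apply (f' y) i)"
      by (rule continuous_on_cong[THEN iffD1, OF refl _ cont[of i]]) (simp add: app)
  qed
  moreover have "\<And>y. y \<in> U \<Longrightarrow> (f has_derivative blinfun_apply (f' y)) (at y)"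
    using der app by simp
  ultimately obtain U' V g g' where *: "open U'" "U' \<subseteq> U" "z0 \<in> U'" "open V"
    "homeomorphism U' V f g" "\<And>y. y \<in> V \<Longrightarrow> (g has_derivative (g' y)) (at y)"
    "\<And>y. y \<in> V \<Longrightarrow> g' y = inv (blinfun_apply (f'(g y)))"
    "\<And>y. y \<in> V \<Longrightarrow> bij (blinfun_apply (f'(g y)))"
    using inverse_function_theorem[of U f f' z0 "Blinfun h"] assms(1,2) by metis
  have "g y \<in> U" if "y \<in> V" for y
    using *(2,5) that by (auto simp: homeomorphism_def)
  with * app show ?thesis
    by (intro that[of U' V g]) metis+
qed

text \<open>The inverse of a complex linear bijection is complex linear, so the real inverse
  function theorem already gives a holomorphic inverse.\<close>

lemma hmap_local_inverse:
  fixes f :: "complex^'n \<Rightarrow> complex^'n"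
  assumes "open U" "z0 \<in> U"
    and "\<And>y. y \<in> U \<Longrightarrow> (f has_derivative D y) (at y)"
    and "\<And>v. continuous_on U (\<lambda>y. D y v)"
    and "inj (D z0)"
    and cl: "\<And>y c v. y \<in> U \<Longrightarrow> D y (c *s v) = c *s D y v"
  obtains U' V g where "open U'" "U' \<subseteq> U" "z0 \<in> U'" "open V" "homeomorphism U' V f g" "hmap V g"
proof -
  obtain U' V g where *: "open U'" "U' \<subseteq> U" "z0 \<in> U'" "open V" "homeomorphism U' V f g"
    "\<And>y. y \<in> V \<Longrightarrow> (g has_derivative inv (D (g y))) (at y)"
    "\<And>y. y \<in> V \<Longrightarrow> bij (D (g y))"
    using local_inverse[OF assms(1-5)] by blast
  have "inv (D (g y)) (c *s v) = c *s inv (D (g y)) v" if "y \<in> V" for y c v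
  proof -
    have "g y \<in> U"
      using *(2,5) that by (auto simp: homeomorphism_def)
    then have "D (g y) (c *s inv (D (g y)) v) = c *s v"
      by (simp add: cl surj_f_inv_f[OF bij_is_surj[OF *(7)[OF that]]])
    then show ?thesis
      using *(7)[OF that] by (metis bij_inv_eq_iff)
  qed
  with *(6) have "hmap V g"
    unfolding hmap_def by blast
  with * that show ?thesis by blast
qed

section \<open>Four-point means\<close>

text \<open>A discrete circle mean, exact enough to detect the Laplacian: the powers \<open>\<zeta>, \<zeta>\<^sup>2, \<zeta>\<^sup>3\<close> all sum to zero.\<close>

definition cross_sum :: "(complex \<Rightarrow> real) \<Rightarrow> complex \<Rightarrow> real" where
  "cross_sum t \<zeta> = t \<zeta> + t (\<i> * \<zeta>) + t (- \<zeta>) + t (- (\<i> * \<zeta>))"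

lemma cross_sum_cmult: "cross_sum (\<lambda>\<zeta>. c * t \<zeta>) \<zeta> = c * cross_sum t \<zeta>"
  and cross_sum_const: "cross_sum (\<lambda>\<zeta>. c) \<zeta> = 4 * c"
  by (simp_all add: cross_sum_def algebra_simps)

lemma cross_sum_mono:
  assumes "\<And>w. cmod w = cmod \<zeta> \<Longrightarrow> s w \<le> t w"
  shows "cross_sum s \<zeta> \<le> cross_sum t \<zeta>"
  unfolding cross_sum_def by (intro add_mono assms) (auto simp: norm_mult)

lemma cross_sum_diff_bound:
  assumes "\<And>w. cmod w = cmod \<zeta> \<Longrightarrow> \<bar>s w - t w\<bar> \<le> B"
  shows "\<bar>cross_sum s \<zeta> - cross_sum t \<zeta>\<bar> \<le> 4 * B"
proof -
  have "\<bar>s \<zeta> - t \<zeta>\<bar> \<le> B" "\<bar>s (\<i> * \<zeta>) - t (\<i> * \<zeta>)\<bar> \<le> B"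
    "\<bar>s (-\<zeta>) - t (-\<zeta>)\<bar> \<le> B" "\<bar>s (-(\<i> * \<zeta>)) - t (-(\<i> * \<zeta>))\<bar> \<le> B"
    by (rule assms; simp add: norm_mult)+
  then show ?thesis
    unfolding cross_sum_def by linarith
qed

text \<open>The constant combines Cauchy's estimate \<open>3! * C / (R/4)^3\<close> for the third
  derivative, on discs of radius \<open>R/4\<close> about points of \<open>cball 0 (R/2)\<close>,
  with the \<open>2!\<close> in the denominator of \<open>complex_Taylor\<close>.\<close>

lemma taylor2_bound:
  assumes R: "0 < R" and f: "f holomorphic_on ball 0 R"
    and C: "\<And>z. z \<in> ball 0 R \<Longrightarrow> cmod (f z) \<le> C" and \<zeta>: "cmod \<zeta> \<le> R / 2"
  shows "cmod (f \<zeta> - (f 0 + deriv f 0 * \<zeta> + (deriv ^^ 2) f 0 / 2 * \<zeta>\<^sup>2)) \<le> 3 * C / (R/4)^3 * cmod \<zeta> ^ 3"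
proof -
  have inb: "cball w (R/4) \<subseteq> ball 0 R" if "w \<in> cball 0 (R/2)" for w
  proof
    fix u assume "u \<in> cball w (R/4)"
    with that have "dist 0 u \<le> R/2 + R/4"
      using dist_triangle[of 0 u w] by simp
    with R show "u \<in> ball 0 R" by simp
  qed
  have sub: "cball 0 (R/2) \<subseteq> ball (0::complex) R"
    using R by auto
  have "cmod (f \<zeta> - (\<Sum>i\<le>2. (deriv ^^ i) f 0 * (\<zeta> - 0) ^ i / fact i))
      \<le> (fact 3 * C / (R/4)^3) * cmod (\<zeta> - 0) ^ Suc 2 / fact 2"
  proof (rule complex_Taylor[where S = "cball 0 (R/2)" and f = "\<lambda>i. (deriv ^^ i) f", simplified funpow.simps id_apply])
    fix i x assume "x \<in> cball (0::complex) (R/2)" "i \<le> (2::nat)"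
    then have "x \<in> ball 0 R" using sub by blast
    then show "((deriv ^^ i) f has_field_derivative (deriv \<circ> deriv ^^ i) f x) (at x within cball 0 (R/2))"
      using holomorphic_higher_deriv[OF f open_ball, of i]
      by (auto intro: has_field_derivative_at_within holomorphic_derivI)
  next
    fix x assume x: "x \<in> cball (0::complex) (R/2)"
    have "norm ((deriv ^^ 3) f x) \<le> fact 3 * C / (R/4)^3"
    proof (rule Cauchy_inequality)
      show "f holomorphic_on ball x (R/4)"
        using f inb[OF x] ball_subset_cball by (meson holomorphic_on_subset order_trans)
      show "continuous_on (cball x (R/4)) f"
        using f inb[OF x] by (meson continuous_on_subset holomorphic_on_imp_continuous_on)
      show "norm (f u) \<le> C" if "norm (x - u) = R/4" for u
        using that inb[OF x] by (intro C) (auto simp: dist_norm)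
    qed (use R in auto)
    then show "cmod ((deriv \<circ> deriv ^^ 2) f x) \<le> fact 3 * C / (R/4)^3"
      by (simp add: numeral_3_eq_3 numeral_2_eq_2)
  qed (use \<zeta> R in \<open>auto\<close>)
  moreover have "(\<Sum>i\<le>2. (deriv ^^ i) f 0 * (\<zeta> - 0) ^ i / fact i)
      = f 0 + deriv f 0 * \<zeta> + (deriv ^^ 2) f 0 / 2 * \<zeta>\<^sup>2"
    by (simp add: numeral_2_eq_2)
  ultimately show ?thesis
    by (simp add: fact_numeral numeral_3_eq_3 numeral_2_eq_2)
qed

lemma cross_sum_Re_quadratic:
  "cross_sum (\<lambda>w. Re (a + b * w + c * w\<^sup>2)) \<zeta> = 4 * Re a"
  by (simp add: cross_sum_def algebra_simps power2_eq_square)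

text \<open>The parallelogram law is applied to the two pairs of opposite points, whose midpoint
  values are \<open>a + c * \<zeta>\<^sup>2\<close> and \<open>a - c * \<zeta>\<^sup>2\<close>, and
  once more to these two values.\<close>

lemma cross_sum_norm_quadratic:
  "cross_sum (\<lambda>w. (cmod (a + b * w + c * w\<^sup>2))\<^sup>2) \<zeta>
    = 4 * (cmod a)\<^sup>2 + 4 * (cmod b)\<^sup>2 * (cmod \<zeta>)\<^sup>2 + 4 * (cmod c)\<^sup>2 * (cmod \<zeta>) ^ 4"
proof -
  have par: "(cmod (u + v))\<^sup>2 + (cmod (u - v))\<^sup>2 = 2 * (cmod u)\<^sup>2 + 2 * (cmod v)\<^sup>2" for u v
    unfolding cmod_power2 by (simp add: power2_eq_square algebra_simps)
  have "cross_sum (\<lambda>w. (cmod (a + b * w + c * w\<^sup>2))\<^sup>2) \<zeta>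
    = ((cmod (a + c * \<zeta>\<^sup>2 + b * \<zeta>))\<^sup>2 + (cmod (a + c * \<zeta>\<^sup>2 - b * \<zeta>))\<^sup>2)
      + ((cmod (a - c * \<zeta>\<^sup>2 + b * (\<i> * \<zeta>)))\<^sup>2 + (cmod (a - c * \<zeta>\<^sup>2 - b * (\<i> * \<zeta>)))\<^sup>2)"
    by (simp add: cross_sum_def power_mult_distrib algebra_simps)
  also have "\<dots> = 2 * ((cmod (a + c * \<zeta>\<^sup>2))\<^sup>2 + (cmod (a - c * \<zeta>\<^sup>2))\<^sup>2)
      + 4 * (cmod (b * \<zeta>))\<^sup>2"
    unfolding par[of _ "b * \<zeta>"] par[of _ "b * (\<i> * \<zeta>)"] by (simp add: norm_mult)
  also have "\<dots> = 4 * (cmod a)\<^sup>2 + 4 * (cmod (c * \<zeta>\<^sup>2))\<^sup>2 + 4 * (cmod (b * \<zeta>))\<^sup>2"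
    unfolding par by simp
  finally show ?thesis
    by (simp add: norm_mult norm_power power_mult_distrib flip: power_mult)
qed

text \<open>Real parts of holomorphic functions are harmonic, so their means have no second-order
  term.\<close>

lemma cross_sum_Re:
  assumes "0 < R" "f holomorphic_on ball 0 R" "\<And>z. z \<in> ball 0 R \<Longrightarrow> cmod (f z) \<le> C" "cmod \<zeta> \<le> R / 2"
  shows "\<bar>cross_sum (\<lambda>w. Re (f w)) \<zeta> - 4 * Re (f 0)\<bar> \<le> 4 * (3 * C / (R/4)^3 * cmod \<zeta> ^ 3)"
proof -
  have "\<bar>Re (f w) - Re (f 0 + deriv f 0 * w + (deriv ^^ 2) f 0 / 2 * w\<^sup>2)\<bar>
      \<le> 3 * C / (R/4)^3 * cmod \<zeta> ^ 3" if "cmod w = cmod \<zeta>" for w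
    unfolding minus_complex.simps(1)[symmetric]
    by (rule order_trans[OF abs_Re_le_cmod]) (use taylor2_bound[OF assms(1-3), of w] that assms(4) in simp)
  then show ?thesis
    unfolding cross_sum_Re_quadratic[symmetric, of "f 0" "deriv f 0" "(deriv ^^ 2) f 0 / 2" \<zeta>]
    by (rule cross_sum_diff_bound)
qed

text \<open>\<open>K\<close> is fixed before \<open>f\<close> and depends on \<open>R\<close> and
  \<open>C\<close> alone. This uniformity later gives one estimate for a whole family of
  multipliers.\<close>

lemma cross_sum_norm_sq:
  assumes R: "0 < R"
  obtains K where "\<And>f \<zeta>. f holomorphic_on ball 0 R \<Longrightarrow> (\<And>z. z \<in> ball 0 R \<Longrightarrow> cmod (f z) \<le> C) \<Longrightarrow>
    cmod \<zeta> \<le> R / 2 \<Longrightarrow>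
    \<bar>cross_sum (\<lambda>w. (cmod (f w))\<^sup>2) \<zeta> - (4 * (cmod (f 0))\<^sup>2 + 4 * (cmod (deriv f 0))\<^sup>2 * (cmod \<zeta>)\<^sup>2)\<bar>
      \<le> K * cmod \<zeta> ^ 3"
proof
  define L where "L = 3 * C / (R/4)^3"
  define M where "M = 4 * (L * (2 * C + L * R^3)) + 4 * (C / (R/2)^2)\<^sup>2 * R"
  fix f \<zeta>
  assume f: "f holomorphic_on ball 0 R" and C: "\<And>z. z \<in> ball 0 R \<Longrightarrow> cmod (f z) \<le> C"
    and \<zeta>: "cmod \<zeta> \<le> R / 2"
  have C0: "0 \<le> C" using C[of 0] R norm_ge_zero order_trans by (metis centre_in_ball)
  have L0: "0 \<le> L" using C0 R by (simp add: L_def)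
  let ?c = "(deriv ^^ 2) f 0 / 2"
  let ?P = "\<lambda>w. f 0 + deriv f 0 * w + ?c * w\<^sup>2"
  have "cmod ((deriv ^^ 2) f 0) \<le> fact 2 * C / (R/2)^2"
  proof (rule Cauchy_inequality)
    show "f holomorphic_on ball 0 (R/2)" "continuous_on (cball 0 (R/2)) f"
      using R f by (auto intro: holomorphic_on_subset continuous_on_subset[OF holomorphic_on_imp_continuous_on])
    show "cmod (f x) \<le> C" if "cmod (0 - x) = R/2" for x
      using that R by (intro C) auto
  qed (use R in auto)
  then have c: "cmod ?c \<le> C / (R/2)^2"
    by (simp add: fact_numeral norm_divide mult.commute)
  have diff: "\<bar>(cmod (f w))\<^sup>2 - (cmod (?P w))\<^sup>2\<bar> \<le> L * (2 * C + L * R^3) * cmod \<zeta> ^ 3"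
    if w: "cmod w = cmod \<zeta>" for w
  proof -
    have d: "cmod (f w - ?P w) \<le> L * cmod \<zeta> ^ 3"
      using taylor2_bound[OF R f C, of w] w \<zeta> unfolding L_def by simp
    have fw: "cmod (f w) \<le> C"
      using w \<zeta> R by (intro C) auto
    have "cmod \<zeta> ^ 3 \<le> R ^ 3"
      using \<zeta> R by (intro power_mono) auto
    then have "cmod (?P w) \<le> C + L * R ^ 3"
      using norm_triangle_ineq4[of "f w" "f w - ?P w"] d fw mult_left_mono[OF _ L0]
      by (smt (verit) add_diff_cancel_left' diff_diff_eq2 diff_add_cancel)
    then have s: "cmod (f w) + cmod (?P w) \<le> 2 * C + L * R^3"
      using fw by simp
    have "\<bar>(cmod (f w))\<^sup>2 - (cmod (?P w))\<^sup>2\<bar> = \<bar>cmod (f w) - cmod (?P w)\<bar> * (cmod (f w) + cmod (?P w))"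
      by (simp add: power2_eq_square square_diff_square_factored abs_mult mult.commute)
    also have "\<dots> \<le> (L * cmod \<zeta> ^ 3) * (2 * C + L * R^3)"
      by (rule mult_mono) (use d s norm_triangle_ineq3[of "f w" "?P w"] L0 in auto)
    finally show ?thesis by (simp add: mult_ac)
  qed
  have "4 * (cmod ?c)\<^sup>2 * cmod \<zeta> ^ 4 \<le> 4 * (C / (R/2)^2)\<^sup>2 * (R * cmod \<zeta> ^ 3)"
  proof (rule mult_mono)
    show "4 * (cmod ?c)\<^sup>2 \<le> 4 * (C / (R/2)^2)\<^sup>2"
      using c by (intro mult_left_mono power_mono) auto
    have "cmod \<zeta> * cmod \<zeta> ^ 3 \<le> R * cmod \<zeta> ^ 3"
      using \<zeta> R by (intro mult_right_mono) auto
    then show "cmod \<zeta> ^ 4 \<le> R * cmod \<zeta> ^ 3"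
      by (simp add: power_numeral_reduce)
  qed auto
  moreover have "\<bar>cross_sum (\<lambda>w. (cmod (f w))\<^sup>2) \<zeta> - cross_sum (\<lambda>w. (cmod (?P w))\<^sup>2) \<zeta>\<bar>
      \<le> 4 * (L * (2 * C + L * R^3) * cmod \<zeta> ^ 3)"
    by (rule cross_sum_diff_bound[OF diff])
  moreover have "0 \<le> 4 * (cmod ?c)\<^sup>2 * cmod \<zeta> ^ 4"
    by (intro mult_nonneg_nonneg) auto
  moreover have "M * cmod \<zeta> ^ 3 = 4 * (L * (2 * C + L * R^3) * cmod \<zeta> ^ 3)
      + 4 * (C / (R/2)^2)\<^sup>2 * (R * cmod \<zeta> ^ 3)"
    by (simp only: M_def distrib_right mult.assoc)
  ultimately show "\<bar>cross_sum (\<lambda>w. (cmod (f w))\<^sup>2) \<zeta> -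
      (4 * (cmod (f 0))\<^sup>2 + 4 * (cmod (deriv f 0))\<^sup>2 * (cmod \<zeta>)\<^sup>2)\<bar> \<le> M * cmod \<zeta> ^ 3"
    unfolding cross_sum_norm_quadratic by linarith
qed

section \<open>The Bergman metric on the ball\<close>

lemma herm_add_left: "herm (u + v) w = herm u w + herm v w"
  and herm_diff_left: "herm (u - v) w = herm u w - herm v w"
  and herm_diff_right: "herm w (u - v) = herm w u - herm w v"
  and herm_smult_left: "herm (c *s u) w = c * herm u w"
  and herm_smult_right: "herm w (c *s u) = cnj c * herm w u"
  and herm_scaleR_left: "herm (r *\<^sub>R u) w = r *\<^sub>R herm u w"
  by (simp_all add: herm_def algebra_simps sum.distrib sum_subtractf sum_distrib_left scaleR_sum_right)

lemma cnj_herm: "cnj (herm z w) = herm w z"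
  by (simp add: herm_def mult.commute)

lemma Re_herm: "Re (herm z w) = inner z w"
  by (simp add: herm_def inner_vec_def inner_complex_def)

lemma herm_self: "herm z z = of_real ((norm z)\<^sup>2)"
proof -
  have "Im (herm z z) = 0" by (simp add: herm_def mult.commute)
  moreover have "Re (herm z z) = (norm z)\<^sup>2" by (simp add: Re_herm power2_norm_eq_inner)
  ultimately show ?thesis by (simp add: complex_eq_iff)
qed

lemma herm_Cauchy_Schwarz: "cmod (herm z w) \<le> norm z * norm w"
proof -
  define c where "c = cnj (sgn (herm z w))"
  have "c * herm z w = of_real (cmod (herm z w))"
    by (cases "herm z w = 0")
       (simp_all add: c_def sgn_div_norm scaleR_conv_of_real complex_norm_square[symmetric] power2_eq_square
         field_simps mult.commute[of "cnj _"])
  then have "cmod (herm z w) = inner (c *s z) w"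
    by (simp flip: Re_herm add: herm_smult_left)
  also have "\<dots> \<le> norm (c *s z) * norm w" by (rule norm_cauchy_schwarz)
  also have "\<dots> \<le> norm z * norm w"
    by (intro mult_right_mono) (auto simp: norm_smult_vec c_def norm_sgn mult_left_le_one_le)
  finally show ?thesis .
qed

lemma bounded_linear_herm: "bounded_linear (\<lambda>z. herm z w)"
  by (rule bounded_linear_intro[where K = "norm w"])
     (simp_all add: herm_add_left herm_scaleR_left herm_Cauchy_Schwarz)

lemmas continuous_on_herm [continuous_intros] = bounded_linear.continuous_on[OF bounded_linear_herm]

lemma holo_on_herm: "holo_on U (\<lambda>z. herm z w)"
  by (rule holo_on_linear[OF bounded_linear_herm herm_smult_left])

lemma norm_diff_smult:
  "(norm (u - c *s x))\<^sup>2 = (norm u)\<^sup>2 - 2 * Re (cnj c * herm u x) + (cmod c)\<^sup>2 * (norm x)\<^sup>2"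
proof -
  have "(norm (u - c *s x))\<^sup>2 = Re (herm (u - c *s x) (u - c *s x))"
    by (simp add: herm_self)
  also have "\<dots> = Re (herm u u) - Re (cnj c * herm u x) - Re (c * herm x u) + Re (c * cnj c * herm x x)"
    by (simp add: herm_diff_left herm_diff_right herm_smult_left herm_smult_right algebra_simps)
  also have "Re (c * herm x u) = Re (cnj c * herm u x)"
    by (metis cnj_herm complex_cnj_cnj complex_cnj_mult cnj.simps(1))
  finally show ?thesis
    by (simp add: herm_self complex_norm_square[symmetric] mult.assoc flip: of_real_mult)
qed

text \<open>\<open>rho a z\<close> is \<open>cosh d(a,z)\<close> to the power \<open>-2\<close> on the ball.\<close>

definition rho :: "complex^'n \<Rightarrow> complex^'n \<Rightarrow> real" where
  "rho a z = (1 - (norm a)\<^sup>2) * (1 - (norm z)\<^sup>2) / (cmod (1 - herm z a))\<^sup>2"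

lemma CHball_pos: "z \<in> CHball \<Longrightarrow> 0 < 1 - (norm z)\<^sup>2"
  by (simp add: CHball_def power_less_one_iff)

lemma herm_ball_bound: "a \<in> CHball \<Longrightarrow> 1 - norm z \<le> cmod (1 - herm z a)"
proof -
  assume "a \<in> CHball"
  then have "norm z * norm a \<le> norm z * 1"
    unfolding CHball_def by (intro mult_left_mono) auto
  then have "cmod (herm z a) \<le> norm z"
    using herm_Cauchy_Schwarz[of z a] by simp
  then show ?thesis
    using norm_triangle_ineq2[of 1 "herm z a"] by simp
qed

lemma herm_ne_one: "a \<in> CHball \<Longrightarrow> z \<in> CHball \<Longrightarrow> herm z a \<noteq> 1"
  using herm_ball_bound[of a z] by (auto simp: CHball_def)

lemma rho_pos: "a \<in> CHball \<Longrightarrow> z \<in> CHball \<Longrightarrow> 0 < rho a z"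
  unfolding rho_def using CHball_pos herm_ne_one[of a z] by (intro divide_pos_pos mult_pos_pos) auto

lemma cmod_one_minus_sq:
  "(cmod (1 - h))\<^sup>2 = 1 - 2 * Re h + (cmod h)\<^sup>2"
  unfolding cmod_power2 by (simp add: power2_eq_square algebra_simps)

text \<open>The numerator is visibly nonnegative, which yields \<open>rho <= 1\<close>. It is also
  homogeneous of degree two in \<open>z - x\<close>, which yields the second-order behaviour at
  \<open>x\<close> and a bound on the Euclidean distance.\<close>

lemma one_minus_rho:
  assumes "x \<in> CHball" "z \<in> CHball"
  shows "1 - rho x z = ((1 - (norm x)\<^sup>2) * (norm (z - x))\<^sup>2 + (cmod (herm (z - x) x))\<^sup>2) / (cmod (1 - herm z x))\<^sup>2"
proof -
  have 1: "(norm (z - x))\<^sup>2 = (norm z)\<^sup>2 - 2 * Re (herm z x) + (norm x)\<^sup>2"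
    using norm_diff_smult[of z 1 x] by simp
  have eq: "herm (z - x) x = herm z x - of_real ((norm x)\<^sup>2)"
    by (simp add: herm_diff_left herm_self)
  have "(cmod (h - of_real n))\<^sup>2 = (cmod h)\<^sup>2 - 2 * n * Re h + n\<^sup>2" for h n
    unfolding cmod_power2 by (simp add: power2_eq_square algebra_simps)
  then have 2: "(cmod (herm (z - x) x))\<^sup>2 = (cmod (herm z x))\<^sup>2 - 2 * (norm x)\<^sup>2 * Re (herm z x) + ((norm x)\<^sup>2)\<^sup>2"
    unfolding eq .
  have "(cmod (1 - herm z x))\<^sup>2 - (1 - (norm x)\<^sup>2) * (1 - (norm z)\<^sup>2)
      = (1 - (norm x)\<^sup>2) * (norm (z - x))\<^sup>2 + (cmod (herm (z - x) x))\<^sup>2"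
    unfolding 1 2 cmod_one_minus_sq by (simp add: algebra_simps power2_eq_square)
  moreover have "(cmod (1 - herm z x))\<^sup>2 \<noteq> 0"
    using herm_ne_one[OF assms] by simp
  ultimately show ?thesis
    unfolding rho_def by (simp add: field_simps)
qed

lemma rho_le_1: "x \<in> CHball \<Longrightarrow> z \<in> CHball \<Longrightarrow> rho x z \<le> 1"
  using one_minus_rho[of x z] CHball_pos[of x]
  by (smt (verit) divide_nonneg_nonneg mult_nonneg_nonneg zero_le_power2)

lemma rho_commute: "rho a z = rho z a"
  unfolding rho_def by (metis cnj_herm complex_cnj_diff complex_cnj_one complex_mod_cnj mult.commute)

lemma rho_self: "x \<in> CHball \<Longrightarrow> rho x x = 1"
  using one_minus_rho[of x x] by (simp add: herm_def)

text \<open>\<open>cosh (arcosh q) = q\<close> requires \<open>q >= 1\<close>; this is where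
  \<open>rho <= 1\<close> enters.\<close>

lemma cosh_chdist:
  assumes "z \<in> CHball" "w \<in> CHball"
  shows "(cosh (chdist z w))\<^sup>2 = 1 / rho w z" "0 \<le> chdist z w"
proof -
  let ?q = "cmod (1 - herm z w) / sqrt ((1 - (norm z)\<^sup>2) * (1 - (norm w)\<^sup>2))"
  have p: "0 \<le> (1 - (norm z)\<^sup>2) * (1 - (norm w)\<^sup>2)"
    using CHball_pos[OF assms(1)] CHball_pos[OF assms(2)] by simp
  have q: "?q\<^sup>2 = 1 / rho w z"
    unfolding power_divide real_sqrt_pow2[OF p] rho_def by (simp add: mult.commute)
  have "1 \<le> ?q\<^sup>2"
    unfolding q using rho_pos[OF assms(2,1)] rho_le_1[OF assms(2,1)] by simp
  moreover have "0 \<le> ?q" using p by simp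
  ultimately have "1 \<le> ?q"
    by (smt (verit) power_less_one_iff zero_less_numeral)
  then show "(cosh (chdist z w))\<^sup>2 = 1 / rho w z" "0 \<le> chdist z w"
    unfolding q[symmetric] chdist_def by (simp_all add: cosh_arcosh_real arcosh_nonneg_real)
qed

lemma rho_eq_chdist: "z \<in> CHball \<Longrightarrow> w \<in> CHball \<Longrightarrow> rho w z = 1 / (cosh (chdist z w))\<^sup>2"
  by (simp add: cosh_chdist)

text \<open>Because \<open>cosh d >= exp d / 2\<close>, the sum of the \<open>rho ^ k\<close> is
  dominated by the Poincare series with exponent \<open>2 * k\<close>.\<close>

lemma rho_power_le:
  assumes "z \<in> CHball" "w \<in> CHball"
  shows "rho w z ^ k \<le> 4 ^ k * exp (- (2 * real k) * chdist z w)"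
proof -
  let ?d = "chdist z w"
  have "exp ?d / 2 \<le> cosh ?d"
    by (simp add: cosh_def)
  then have "(exp ?d / 2)\<^sup>2 \<le> (cosh ?d)\<^sup>2"
    by (intro power_mono) auto
  then have "1 / (cosh ?d)\<^sup>2 \<le> 1 / (exp ?d / 2)\<^sup>2"
    by (intro divide_left_mono) auto
  then have "rho w z ^ k \<le> (1 / (exp ?d / 2)\<^sup>2) ^ k"
    unfolding rho_eq_chdist[OF assms] by (intro power_mono) auto
  also have "1 / (exp ?d / 2)\<^sup>2 = 4 * exp (- 2 * ?d)"
  proof -
    have "(exp ?d)\<^sup>2 * exp (- 2 * ?d) = 1"
      by (simp flip: exp_double exp_add)
    then show ?thesis
      by (simp add: power_divide field_simps)
  qed
  also have "(4 * exp (- 2 * ?d)) ^ k = 4 ^ k * exp (- (2 * real k) * ?d)"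
    unfolding power_mult_distrib exp_of_nat_mult[symmetric] by (simp add: mult_ac)
  finally show ?thesis .
qed

text \<open>The holomorphic factor that moves the base point of \<open>rho\<close> from \<open>a\<close> to \<open>x\<close>; it equals \<open>1\<close> at \<open>x\<close>.\<close>

definition multiplier :: "complex^'n \<Rightarrow> complex^'n \<Rightarrow> complex^'n \<Rightarrow> complex" where
  "multiplier a x z = (1 - herm z x) * (1 - herm x a) / (of_real (1 - (norm x)\<^sup>2) * (1 - herm z a))"

lemma rho_factor:
  assumes "a \<in> CHball" "x \<in> CHball" "z \<in> CHball"
  shows "rho a z = rho a x * (cmod (multiplier a x z))\<^sup>2 * rho x z"
proof -
  have *: "A * Z / u = (A * R / q) * (p * q / (R\<^sup>2 * u)) * (R * Z / p)"
    if "p \<noteq> 0" "q \<noteq> 0" "R \<noteq> 0" for A Z R p q u :: real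
    using that by (simp add: power2_eq_square)
  have "cmod (1 - herm z x) \<noteq> 0" "cmod (1 - herm x a) \<noteq> 0" "1 - (norm x)\<^sup>2 \<noteq> 0"
    using herm_ne_one assms CHball_pos[OF assms(2)] by auto
  then show ?thesis
    unfolding rho_def multiplier_def norm_mult norm_divide norm_of_real power_mult_distrib power_divide power2_abs
    by (intro *) auto
qed

text \<open>\<open>herm v (grad a x)\<close> is the derivative of \<open>multiplier a x\<close> at \<open>x\<close> in the direction \<open>v\<close>.\<close>

definition grad :: "complex^'n \<Rightarrow> complex^'n \<Rightarrow> complex^'n" where
  "grad a x = inverse (1 - herm a x) *s a - of_real (1 / (1 - (norm x)\<^sup>2)) *s x"

text \<open>The left-hand side is the squared norm of \<open>grad a x\<close> for the dual of the Bergman metric at \<open>x\<close>.\<close>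

lemma grad_norm:
  assumes "a \<in> CHball" "x \<in> CHball"
  shows "(1 - (norm x)\<^sup>2) * ((norm (grad a x))\<^sup>2 - (cmod (herm (grad a x) x))\<^sup>2) = 1 - rho a x"
proof -
  define r where "r = 1 - (norm x)\<^sup>2"
  define l where "l = 1 - herm a x"
  have r: "r \<noteq> 0" "(norm x)\<^sup>2 = 1 - r" using CHball_pos[OF assms(2)] by (auto simp: r_def)
  have l: "l \<noteq> 0" using herm_ne_one[OF assms(2,1)] by (simp add: l_def)
  have h: "herm (inverse l *s a) x = inverse l - 1"
    using l by (simp add: herm_smult_left l_def field_simps)
  have 1: "herm (grad a x) x = inverse l - of_real (1/r)"
    unfolding grad_def herm_diff_left l_def[symmetric] h herm_smult_left[of "of_real _"] herm_self r_def[symmetric] r(2)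
    using r(1) by (simp add: field_simps)
  have 2: "(norm (grad a x))\<^sup>2 = (norm a)\<^sup>2 * (cmod (inverse l))\<^sup>2 - 2 / r * (Re (inverse l) - 1) + (1 - r) / r\<^sup>2"
    unfolding grad_def norm_diff_smult l_def[symmetric] r_def[symmetric] h r(2)
    by (simp add: norm_smult_vec power_mult_distrib power_divide norm_divide)
  have 3: "(cmod (inverse l - of_real (1/r)))\<^sup>2 = (cmod (inverse l))\<^sup>2 - 2 / r * Re (inverse l) + 1 / r\<^sup>2"
    unfolding cmod_power2 by (simp add: power2_eq_square algebra_simps)
  have "rho a x = (1 - (norm a)\<^sup>2) * r * (cmod (inverse l))\<^sup>2"
    unfolding rho_commute[of a x] unfolding rho_def l_def[symmetric] r_def[symmetric]
    by (simp add: norm_inverse power_inverse divide_inverse)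
  moreover have "r * (N * I - 2 / r * (q - 1) + (1 - r) / r\<^sup>2 - (I - 2 / r * q + 1 / r\<^sup>2))
      = 1 - (1 - N) * r * I" for N I q
    using r(1) by (simp add: field_simps power2_eq_square)
  ultimately show ?thesis
    unfolding 1 2 3 r_def[symmetric] by (simp only:)
qed

text \<open>The leading coefficient of \<open>1 - rho x\<close> at \<open>x\<close>: the denominator
  in \<open>one_minus_rho\<close> tends to \<open>(1 - |x|^2)^2\<close>. Since
  \<open>1 / cosh^2 d = 1 - d^2 + ...\<close>, this is the squared length of \<open>e\<close> in the
  metric behind \<open>chdist\<close>.\<close>

definition bergman :: "complex^'n \<Rightarrow> complex^'n \<Rightarrow> real" where
  "bergman x e = (norm e)\<^sup>2 / (1 - (norm x)\<^sup>2) + (cmod (herm e x))\<^sup>2 / (1 - (norm x)\<^sup>2)\<^sup>2"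

lemma bessel:
  fixes c :: "'a :: real_inner"
  assumes "finite B" "pairwise orthogonal B" "\<And>b. b \<in> B \<Longrightarrow> norm b = 1"
  shows "(\<Sum>b\<in>B. (inner b c)\<^sup>2) \<le> (norm c)\<^sup>2"
proof -
  define s where "s = (\<Sum>b\<in>B. inner b c *\<^sub>R b)"
  have "inner b s = inner b c" if "b \<in> B" for b
  proof -
    have "inner b s = (\<Sum>b'\<in>B. inner b' c * inner b b')"
      by (simp add: s_def inner_sum_right)
    also have "\<dots> = (\<Sum>b'\<in>B. if b' = b then inner b c else 0)"
      using assms(2,3) that by (intro sum.cong) (auto simp: pairwise_def orthogonal_def norm_eq_1)
    finally show ?thesis using assms(1) that by simp
  qed
  then have ss: "inner s s = (\<Sum>b\<in>B. (inner b c)\<^sup>2)" and sc: "inner s c = (\<Sum>b\<in>B. (inner b c)\<^sup>2)"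
    by (subst (1) s_def, simp add: inner_sum_left power2_eq_square)+
  have "0 \<le> inner (c - s) (c - s)" by simp
  then show ?thesis
    using ss sc by (simp add: inner_diff_left inner_diff_right inner_commute power2_norm_eq_inner)
qed

lemma cmod_herm_sq: "(cmod (herm e c))\<^sup>2 = (inner e c)\<^sup>2 + (inner e (\<i> *s c))\<^sup>2"
  by (simp add: cmod_power2 herm_smult_right flip: Re_herm)

text \<open>The vectors are real-orthonormal for the Bergman metric at \<open>x\<close>; the map \<open>J\<close> below is the
  inverse square root of that metric.\<close>

lemma bergman_orthonormal:
  fixes x :: "complex^'n"
  assumes x: "x \<in> CHball" and F: "subspace F"
  obtains B where "finite B" "B \<subseteq> F" "card B = dim F"
    "\<And>e. e \<in> B \<Longrightarrow> bergman x e = 1" "\<And>e. e \<in> B \<Longrightarrow> norm e \<le> 1"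
    "\<And>a. a \<in> CHball \<Longrightarrow> (\<Sum>e\<in>B. (cmod (herm e (grad a x)))\<^sup>2) \<le> 2 * (1 - rho a x)"
proof -
  define r where "r = 1 - (norm x)\<^sup>2"
  have r: "0 < r" "r \<le> 1" using CHball_pos[OF x] by (auto simp: r_def)
  define s where "s = sqrt r"
  have s: "0 < s" "s\<^sup>2 = r" "(norm x)\<^sup>2 = 1 - s\<^sup>2" using r by (auto simp: s_def r_def)
  \<comment> \<open>\<open>J\<close> scales the complex line of \<open>x\<close> by
    \<open>s^2\<close> and its orthogonal complement by \<open>s\<close>, where the metric has the
    weights \<open>1 / s^4\<close> and \<open>1 / s^2\<close>. With \<open>1 + s\<close> in the
    denominator, and not \<open>|x|^2\<close>, the formula stays valid at
    \<open>x = 0\<close>.\<close>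
  define J where "J v = of_real s *s (v - (herm v x / of_real (1 + s)) *s x)" for v
  have herm_Jx: "herm (J v) x = of_real r * herm v x" for v
  proof -
    have "1 + of_real s \<noteq> (0::complex)" using s(1)
      by (metis add_pos_pos less_numeral_extra(3) of_real_1 of_real_add of_real_eq_0_iff zero_less_one)
    then have "herm (J v) x = of_real s * (herm v x - herm v x * (1 - of_real s))"
      unfolding J_def herm_smult_left herm_diff_left herm_self s(3)
      by (simp add: field_simps power2_eq_square)
    then show ?thesis
      by (simp add: algebra_simps power2_eq_square flip: s(2))
  qed
  have norm_J: "(norm (J v))\<^sup>2 = r * ((norm v)\<^sup>2 - (cmod (herm v x))\<^sup>2)" for v
  proof -
    have "cnj (herm v x / of_real (1 + s)) * herm v x = of_real ((cmod (herm v x))\<^sup>2 / (1 + s))"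
      using complex_norm_square[of "herm v x"] by (simp add: mult.commute)
    then have "(norm (J v))\<^sup>2 = r * ((norm v)\<^sup>2 - 2 * ((cmod (herm v x))\<^sup>2 / (1 + s))
        + (cmod (herm v x))\<^sup>2 / (1 + s)\<^sup>2 * (1 - s\<^sup>2))"
      unfolding J_def norm_smult_vec power_mult_distrib norm_diff_smult s(3)
      using s by (simp add: norm_divide power_divide norm_mult del: of_real_add)
    also have "(cmod (herm v x))\<^sup>2 / (1 + s)\<^sup>2 * (1 - s\<^sup>2) = (cmod (herm v x))\<^sup>2 * (1 - s) / (1 + s)"
      using s(1) by (simp add: divide_simps power2_eq_square) (simp add: algebra_simps)
    also have "\<dots> = 2 * ((cmod (herm v x))\<^sup>2 / (1 + s)) - (cmod (herm v x))\<^sup>2"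
      using s(1) by (simp add: field_simps)
    finally show ?thesis
      by simp
  qed
  have bergman_J: "bergman x (J v) = (norm v)\<^sup>2" for v
    unfolding bergman_def norm_J herm_Jx norm_mult power_mult_distrib r_def[symmetric]
    using r(1) by simp
  have linJ: "linear J"
    by (rule linearI)
       (auto simp: J_def vec_eq_iff herm_add_left herm_scaleR_left add_divide_distrib algebra_simps
         scaleR_conv_of_real[where 'a = complex])
  have adj: "herm (J v) c = herm v (J c)" for v c
    by (simp add: J_def herm_smult_left herm_smult_right herm_diff_left herm_diff_right
        cnj_herm algebra_simps)
  have injJ: "inj J"
  proof (rule linear_injective_0[OF linJ, THEN iffD2], intro allI impI)
    fix v assume "J v = 0"
    then show "v = 0" using bergman_J[of v] by (simp add: bergman_def herm_def)
  qed
  then have surjJ: "surj J" using linJ linear_injective_imp_surjective by blast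
  define E where "E = J -` F"
  have subE: "subspace E" unfolding E_def by (rule linear_subspace_vimage[OF linJ F])
  have JE: "J ` E = F" using surjJ by (simp add: E_def surj_image_vimage_eq)
  obtain B where B: "B \<subseteq> E" "pairwise orthogonal B" "\<And>b. b \<in> B \<Longrightarrow> norm b = 1" "independent B" "card B = dim E"
    using orthonormal_basis_subspace[OF subE] by metis
  have finB: "finite B" using B(4) independent_imp_finite by blast
  have inj: "inj_on J B" using injJ by (rule inj_on_subset) auto
  show ?thesis
  proof
    show "finite (J ` B)" "J ` B \<subseteq> F" using finB B(1) JE by auto
    show "card (J ` B) = dim F"
      using card_image[OF inj] B(5) JE dim_image_eq[OF linJ] injJ by (metis inj_on_subset subset_UNIV)
    show be: "bergman x e = 1" if "e \<in> J ` B" for e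
      using that B(3) bergman_J by auto
    show "norm e \<le> 1" if "e \<in> J ` B" for e
    proof -
      obtain b where b: "b \<in> B" "e = J b" using \<open>e \<in> J ` B\<close> by blast
      have "cmod (herm b x) \<le> 1"
        using herm_Cauchy_Schwarz[of b x] B(3)[OF b(1)] x by (simp add: CHball_def)
      then have "(cmod (herm b x))\<^sup>2 \<le> 1" by (simp add: power_le_one)
      then have "(norm e)\<^sup>2 \<le> 1 * 1"
        unfolding b(2) norm_J using r B(3)[OF b(1)] by (intro mult_mono) auto
      then show ?thesis by (simp add: power_le_one_iff)
    qed
    fix a :: "complex^'n" assume a: "a \<in> CHball"
    let ?c = "J (grad a x)"
    have "(\<Sum>e\<in>J ` B. (cmod (herm e (grad a x)))\<^sup>2) = (\<Sum>b\<in>B. (cmod (herm b ?c))\<^sup>2)"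
      by (subst sum.reindex[OF inj]) (simp add: adj)
    \<comment> \<open>The squared modulus splits into real squares for \<open>?c\<close> and
      \<open>\<i> *s ?c\<close>. Bessel bounds each sum by the squared norm of \<open>?c\<close>,
      which \<open>grad_norm\<close> evaluates; hence the factor 2.\<close>
    also have "\<dots> = (\<Sum>b\<in>B. (inner b ?c)\<^sup>2) + (\<Sum>b\<in>B. (inner b (\<i> *s ?c))\<^sup>2)"
      by (simp add: cmod_herm_sq sum.distrib)
    also have "\<dots> \<le> (norm ?c)\<^sup>2 + (norm (\<i> *s ?c))\<^sup>2"
      by (intro add_mono bessel finB B)
    also have "\<dots> = 2 * (1 - rho a x)"
      using grad_norm[OF a x] norm_J[of "grad a x"] by (simp add: norm_smult_vec flip: r_def)
    finally show "(\<Sum>e\<in>J ` B. (cmod (herm e (grad a x)))\<^sup>2) \<le> 2 * (1 - rho a x)" .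
  qed
qed

section \<open>Second-order expansion of the orbit terms along holomorphic discs\<close>

lemma rho_center_limit:
  fixes g :: "complex \<Rightarrow> complex^'n"
  assumes g: "(g has_derivative (\<lambda>\<zeta>. \<zeta> *s e)) (at 0)" and x: "g 0 = x" "x \<in> CHball"
  shows "((\<lambda>\<zeta>. (rho x (g \<zeta>) ^ k - 1) / (cmod \<zeta>)\<^sup>2) \<longlongrightarrow> - (real k * bergman x e)) (at 0)"
proof -
  define r where "r = 1 - (norm x)\<^sup>2"
  have r: "r > 0" using CHball_pos[OF x(2)] by (simp add: r_def)
  \<comment> \<open>The complex difference quotient of \<open>g\<close>. Homogeneity of the
    numerator in \<open>one_minus_rho\<close> gives
    \<open>1 - rho x (g \<zeta>) = \<kappa> \<zeta> * |\<zeta>|^2\<close>, and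
    \<open>\<kappa>\<close> tends to \<open>bergman x e\<close>.\<close>
  define q where "q \<zeta> = inverse \<zeta> *s (g \<zeta> - x)" for \<zeta>
  have gx: "(g \<longlongrightarrow> x) (at 0)"
    using has_derivative_continuous[OF g] x by (simp add: isCont_def)
  have "((\<lambda>\<zeta>. norm (g \<zeta> - x - \<zeta> *s e) / cmod \<zeta>) \<longlongrightarrow> 0) (at 0)"
    using g x unfolding has_derivative_at by simp
  then have "((\<lambda>\<zeta>. norm (q \<zeta> - e)) \<longlongrightarrow> 0) (at 0)"
  proof (rule Lim_transform_eventually)
    have "norm (g \<zeta> - x - \<zeta> *s e) / cmod \<zeta> = norm (q \<zeta> - e)" if "\<zeta> \<noteq> 0" for \<zeta>
    proof -
      have eq: "q \<zeta> - e = inverse \<zeta> *s (g \<zeta> - x - \<zeta> *s e)"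
        using that by (simp add: q_def vec_eq_iff field_simps)
      show ?thesis unfolding eq norm_smult_vec by (simp add: norm_inverse divide_inverse mult.commute)
    qed
    then show "\<forall>\<^sub>F \<zeta> in at 0. norm (g \<zeta> - x - \<zeta> *s e) / cmod \<zeta> = norm (q \<zeta> - e)"
      by (auto simp: eventually_at_filter)
  qed
  then have qe: "(q \<longlongrightarrow> e) (at 0)"
    by (rule LIM_zero_cancel[OF tendsto_norm_zero_cancel])
  have herm_lim: "((\<lambda>\<zeta>. herm (f \<zeta>) x) \<longlongrightarrow> herm l x) (at 0)" if "(f \<longlongrightarrow> l) (at 0)" for f l
    by (rule bounded_linear.tendsto[OF bounded_linear_herm that])
  define \<kappa> where "\<kappa> \<zeta> = (r * (norm (q \<zeta>))\<^sup>2 + (cmod (herm (q \<zeta>) x))\<^sup>2) / (cmod (1 - herm (g \<zeta>) x))\<^sup>2" for \<zeta>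
  have one: "1 - herm x x = of_real r"
    by (simp add: herm_self r_def)
  have "(\<kappa> \<longlongrightarrow> (r * (norm e)\<^sup>2 + (cmod (herm e x))\<^sup>2) / (cmod (1 - herm x x))\<^sup>2) (at 0)"
    unfolding \<kappa>_def by (intro tendsto_intros qe gx herm_lim) (use r one in auto)
  moreover have "(r * (norm e)\<^sup>2 + (cmod (herm e x))\<^sup>2) / (cmod (1 - herm x x))\<^sup>2 = bergman x e"
    using r unfolding one bergman_def r_def[symmetric] by (simp add: field_simps power2_eq_square)
  ultimately have \<kappa>: "(\<kappa> \<longlongrightarrow> bergman x e) (at 0)" by simp
  have inb: "\<forall>\<^sub>F \<zeta> in at 0. g \<zeta> \<in> CHball"
  proof -
    have "open (CHball :: (complex^'n) set)"
      unfolding CHball_def by (auto intro: open_Collect_less continuous_intros)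
    then show ?thesis using topological_tendstoD[OF gx] x(2) by blast
  qed
  have key: "\<forall>\<^sub>F \<zeta> in at 0. rho x (g \<zeta>) = 1 - \<kappa> \<zeta> * (cmod \<zeta>)\<^sup>2 \<and> \<zeta> \<noteq> 0"
    using inb eventually_neq_at_within[of 0 0 UNIV]
  proof (eventually_elim, intro conjI)
    case (elim \<zeta>)
    show "\<zeta> \<noteq> 0" by (rule elim)
    have "g \<zeta> - x = \<zeta> *s q \<zeta>"
      using \<open>\<zeta> \<noteq> 0\<close> by (simp add: q_def vec_eq_iff)
    then have "1 - rho x (g \<zeta>) = \<kappa> \<zeta> * (cmod \<zeta>)\<^sup>2"
      unfolding one_minus_rho[OF x(2) elim(1)] \<kappa>_def r_def[symmetric]
      by (simp add: norm_smult_vec herm_smult_left norm_mult power_mult_distrib algebra_simps)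
    then show "rho x (g \<zeta>) = 1 - \<kappa> \<zeta> * (cmod \<zeta>)\<^sup>2" by simp
  qed
  have "((\<lambda>\<zeta>. 1 - \<kappa> \<zeta> * (cmod \<zeta>)\<^sup>2) \<longlongrightarrow> 1 - bergman x e * (cmod 0)\<^sup>2) (at 0)"
    by (intro tendsto_intros \<kappa>)
  then have "((\<lambda>\<zeta>. - (\<kappa> \<zeta> * (\<Sum>i<k. (1 - \<kappa> \<zeta> * (cmod \<zeta>)\<^sup>2) ^ i))) \<longlongrightarrow> - (bergman x e * (\<Sum>i<k. 1 ^ i))) (at 0)"
    by (intro tendsto_intros \<kappa>) simp
  then have "((\<lambda>\<zeta>. - (\<kappa> \<zeta> * (\<Sum>i<k. (1 - \<kappa> \<zeta> * (cmod \<zeta>)\<^sup>2) ^ i))) \<longlongrightarrow> - (real k * bergman x e)) (at 0)"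
    by (simp add: mult.commute)
  then show ?thesis
  proof (rule Lim_transform_eventually)
    show "\<forall>\<^sub>F \<zeta> in at 0. - (\<kappa> \<zeta> * (\<Sum>i<k. (1 - \<kappa> \<zeta> * (cmod \<zeta>)\<^sup>2) ^ i)) = (rho x (g \<zeta>) ^ k - 1) / (cmod \<zeta>)\<^sup>2"
      using key
    proof eventually_elim
      case (elim \<zeta>)
      then have eq: "rho x (g \<zeta>) = 1 - \<kappa> \<zeta> * (cmod \<zeta>)\<^sup>2" and "\<zeta> \<noteq> 0" by auto
      then show ?case
        unfolding power_diff_1_eq eq by simp
    qed
  qed
qed

lemma herm_grad:
  "herm e (grad a x) = herm e a / (1 - herm x a) - herm e x / of_real (1 - (norm x)\<^sup>2)"
  unfolding grad_def herm_diff_right herm_smult_right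
  by (simp add: cnj_herm divide_inverse mult.commute)

text \<open>By \<open>rho_factor\<close> a term is a constant times the squared modulus of a
  holomorphic function times \<open>rho x ^ k\<close>. The mean of the modulus gains the squared
  derivative, while the last factor loses \<open>k * bergman\<close> to second order. The quantifier
  over \<open>a\<close> stands inside the filter: one radius serves every \<open>a\<close>, so the
  bound can be summed over an orbit.\<close>

lemma rho_cross_sum:
  fixes \<psi> :: "complex^'n \<Rightarrow> complex^'n"
  assumes N: "open N" "0 \<in> N" and \<psi>: "hmap N \<psi>" "\<psi> 0 = x" and x: "x \<in> CHball"
    and T: "(\<psi> has_derivative T) (at 0)" "\<And>c v. T (c *s v) = c *s T v" and \<eta>: "0 < \<eta>"
  shows "\<forall>\<^sub>F r in at_right 0. \<forall>a\<in>CHball. cross_sum (\<lambda>\<zeta>. rho a (\<psi> (\<zeta> *s v)) ^ k) (of_real r)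
    \<le> rho a x ^ k * (4 + 4 * r\<^sup>2 * ((real k)\<^sup>2 * (cmod (herm (T v) (grad a x)))\<^sup>2 - real k * bergman x (T v)) + \<eta> * r\<^sup>2)"
proof -
  define g where "g \<zeta> = \<psi> (\<zeta> *s v)" for \<zeta>
  define s where "s = 1 - (norm x)\<^sup>2"
  have s: "s > 0" using CHball_pos[OF x] by (simp add: s_def)
  have nx: "norm x < 1" using x by (simp add: CHball_def)
  have g0: "g 0 = x" by (simp add: g_def \<psi>(2))
  have "((\<lambda>\<zeta>. \<zeta> *s v) has_derivative (\<lambda>\<zeta>. \<zeta> *s v)) (at 0)"
    using has_derivative_line[of 0 v] by simp
  from has_derivative_compose[OF this, of \<psi> T] T
  have dg: "(g has_derivative (\<lambda>\<zeta>. \<zeta> *s T v)) (at 0)"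
    unfolding g_def by simp
  have cont: "((\<lambda>\<zeta>. \<zeta> *s v) \<longlongrightarrow> 0 *s v) (at 0)"
    by (rule bounded_linear.tendsto[OF bounded_linear_smult_left tendsto_ident_at])
  have "\<forall>\<^sub>F \<zeta> in nhds 0. \<zeta> *s v \<in> N \<and> dist (g \<zeta>) x < (1 - norm x) / 2"
  proof -
    have "\<forall>\<^sub>F \<zeta> in at 0. \<zeta> *s v \<in> N"
      using topological_tendstoD[OF cont N(1)] N(2) by simp
    moreover have "\<forall>\<^sub>F \<zeta> in at 0. dist (g \<zeta>) x < (1 - norm x) / 2"
      using tendstoD[of g "g 0" "at 0" "(1 - norm x) / 2"] has_derivative_continuous[OF dg] g0 nx
      by (simp add: isCont_def)
    ultimately show ?thesis
      using N(2) g0 nx by (auto simp: eventually_nhds_conv_at eventually_conj_iff)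
  qed
  then obtain R where R: "R > 0" "\<And>\<zeta>. \<zeta> \<in> ball 0 R \<Longrightarrow> \<zeta> *s v \<in> N"
    "\<And>\<zeta>. \<zeta> \<in> ball 0 R \<Longrightarrow> dist (g \<zeta>) x < (1 - norm x) / 2"
    unfolding eventually_nhds_metric by (auto simp: dist_commute)
  have ng: "norm (g \<zeta>) \<le> (1 + norm x) / 2" if "\<zeta> \<in> ball 0 R" for \<zeta>
    using R(3)[OF that] norm_triangle_sub[of "g \<zeta>" x] by (simp add: dist_norm field_simps)
  have gB: "g \<zeta> \<in> CHball" if "\<zeta> \<in> ball 0 R" for \<zeta>
    using ng[OF that] nx by (simp add: CHball_def)
  define Q where "Q a \<zeta> = multiplier a x (g \<zeta>) ^ k" for a \<zeta>
  \<comment> \<open>Each factor of the numerator has modulus at most 2, and the denominator is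
    bounded below by \<open>1 - |g \<zeta>| >= (1 - |x|) / 2\<close>; neither bound involves
    \<open>a\<close>.\<close>
  define C where "C = (2 * 2 / (s * ((1 - norm x) / 2))) ^ k"
  have hol_herm: "(\<lambda>\<zeta>. herm (g \<zeta>) a) holomorphic_on ball 0 R" for a
    using holo_line[OF holo_compose[OF holo_on_herm[of UNIV a] \<psi>(1)], of "ball 0 R" 0 v] R(2)
    unfolding g_def by auto
  have der_herm: "((\<lambda>\<zeta>. herm (g \<zeta>) a) has_field_derivative herm (T v) a) (at 0)" for a
    using bounded_linear.has_derivative[OF bounded_linear_herm dg, of a]
    unfolding has_field_derivative_def herm_smult_left by (simp add: mult_commute_abs)
  have Qhol: "Q a holomorphic_on ball 0 R" if "a \<in> CHball" for a
    unfolding Q_def multiplier_def using s herm_ne_one[OF that gB]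
    by (intro holomorphic_intros hol_herm) (auto simp: s_def)
  have lt2: "cmod (1 - herm z w) \<le> 2" if "z \<in> CHball" "w \<in> CHball" for z w :: "complex^'n"
    using norm_triangle_ineq4[of 1 "herm z w"] herm_Cauchy_Schwarz[of z w]
      mult_le_one[of "norm z" "norm w"] that by (simp add: CHball_def)
  have Qbd: "cmod (Q a \<zeta>) \<le> C" if "a \<in> CHball" "\<zeta> \<in> ball 0 R" for a \<zeta>
  proof -
    have "(1 - norm x) / 2 \<le> cmod (1 - herm (g \<zeta>) a)"
      using herm_ball_bound[OF that(1), of "g \<zeta>"] ng[OF that(2)] by (simp add: field_simps)
    then have "cmod (1 - herm (g \<zeta>) x) * cmod (1 - herm x a) / (s * cmod (1 - herm (g \<zeta>) a))
       \<le> 2 * 2 / (s * ((1 - norm x) / 2))"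
      using s nx lt2 x gB[OF that(2)] that(1) by (intro frac_le mult_mono mult_pos_pos) auto
    then show ?thesis
      using s unfolding Q_def C_def multiplier_def norm_power norm_divide norm_mult norm_of_real s_def[symmetric]
      by (intro power_mono) auto
  qed
  have Q0: "Q a 0 = 1" if "a \<in> CHball" for a
  proof -
    have "1 - herm x x = of_real s" by (simp add: herm_self s_def)
    then show ?thesis
      using herm_ne_one[OF that x] s by (simp add: Q_def multiplier_def g0 flip: s_def)
  qed
  have dQ: "deriv (Q a) 0 = of_nat k * herm (T v) (grad a x)" if "a \<in> CHball" for a
  proof -
    have ne: "of_real s * (1 - herm (g 0) a) \<noteq> 0"
      using herm_ne_one[OF that x] s g0 by simp
    have gx: "1 - herm (g 0) x = of_real s"
      by (simp add: g0 herm_self s_def)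
    have "((\<lambda>\<zeta>. multiplier a x (g \<zeta>)) has_field_derivative
        ((- herm (T v) x * (1 - herm x a)) * (of_real s * (1 - herm (g 0) a))
         - ((1 - herm (g 0) x) * (1 - herm x a)) * (of_real s * (- herm (T v) a)))
        / ((of_real s * (1 - herm (g 0) a)) * (of_real s * (1 - herm (g 0) a)))) (at 0)"
      unfolding multiplier_def s_def[symmetric]
      by (rule DERIV_divide) (use ne in \<open>auto intro!: derivative_eq_intros der_herm\<close>)
    also have "((- herm (T v) x * (1 - herm x a)) * (of_real s * (1 - herm (g 0) a))
         - ((1 - herm (g 0) x) * (1 - herm x a)) * (of_real s * (- herm (T v) a)))
        / ((of_real s * (1 - herm (g 0) a)) * (of_real s * (1 - herm (g 0) a))) = herm (T v) (grad a x)"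
    proof -
      have "(- p * \<beta> * (S * \<beta>) - S * \<beta> * (S * - q)) / (S * \<beta> * (S * \<beta>)) = q / \<beta> - p / S"
        if "S \<noteq> 0" "\<beta> \<noteq> 0" for S \<beta> p q :: complex
        using that by (simp add: field_simps)
      then show ?thesis
        using ne unfolding gx herm_grad s_def[symmetric] unfolding g0 by (metis mult_eq_0_iff)
    qed
    finally have "(Q a has_field_derivative of_nat k * (herm (T v) (grad a x) * multiplier a x (g 0) ^ (k - 1))) (at 0)"
      unfolding Q_def by (auto intro!: derivative_eq_intros)
    moreover have "multiplier a x (g 0) = 1"
      using ne by (simp add: multiplier_def gx flip: s_def) (simp add: g0)
    ultimately show ?thesis
      using DERIV_imp_deriv by fastforce
  qed
  obtain K where K: "\<And>f \<zeta>. f holomorphic_on ball 0 R \<Longrightarrow> (\<And>z. z \<in> ball 0 R \<Longrightarrow> cmod (f z) \<le> C) \<Longrightarrow>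
    cmod \<zeta> \<le> R / 2 \<Longrightarrow>
    \<bar>cross_sum (\<lambda>w. (cmod (f w))\<^sup>2) \<zeta> - (4 * (cmod (f 0))\<^sup>2 + 4 * (cmod (deriv f 0))\<^sup>2 * (cmod \<zeta>)\<^sup>2)\<bar>
      \<le> K * cmod \<zeta> ^ 3"
    using cross_sum_norm_sq[OF R(1), of C] by blast
  define M where "M = C / (R / 2)"
  have M: "cmod (deriv (Q a) 0) \<le> M" if "a \<in> CHball" for a
  proof -
    have "cmod ((deriv ^^ 1) (Q a) 0) \<le> fact 1 * C / (R/2) ^ 1"
      by (rule Cauchy_inequality)
         (use R(1) Qbd[OF that] Qhol[OF that] in
           \<open>auto intro: holomorphic_on_subset continuous_on_subset[OF holomorphic_on_imp_continuous_on]\<close>)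
    then show ?thesis by (simp add: M_def)
  qed
  define \<omega> where "\<omega> = real k * bergman x (T v)"
  have t: "\<forall>\<^sub>F \<zeta> in at 0. (rho x (g \<zeta>) ^ k - 1) / (cmod \<zeta>)\<^sup>2 < - \<omega> + \<eta> / 8"
    using order_tendstoD(2)[OF rho_center_limit[OF dg g0 x, of k]] \<eta> unfolding \<omega>_def by simp
  then obtain r1 where r1: "r1 > 0"
    "\<And>\<zeta>. \<zeta> \<noteq> 0 \<Longrightarrow> cmod \<zeta> < r1 \<Longrightarrow> (rho x (g \<zeta>) ^ k - 1) / (cmod \<zeta>)\<^sup>2 < - \<omega> + \<eta> / 8"
    unfolding eventually_at by (auto simp: dist_norm)
  \<comment> \<open>Replacing the limit \<open>- \<omega>\<close> by \<open>b\<close> costs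
    \<open>4 * \<eta> / 8\<close>, half of the allowed error; \<open>e3\<close> keeps the mixed
    terms within the other half. \<open>e2\<close> makes the factor \<open>1 + b * r\<^sup>2\<close>
    positive, so that the bound on the mean may be multiplied by it.\<close>
  define b where "b = - \<omega> + \<eta> / 8"
  have e1: "\<forall>\<^sub>F r in at_right 0. 0 < (r::real) \<and> r < r1 \<and> r < R / 2"
    unfolding eventually_at_right[OF zero_less_one]
    by (rule exI[of _ "min r1 (R / 2)"]) (use r1(1) R(1) in auto)
  have "((\<lambda>r. 1 + b * r\<^sup>2) \<longlongrightarrow> 1 + b * 0\<^sup>2) (at_right 0)"
    by (intro tendsto_intros)
  then have e2: "\<forall>\<^sub>F r in at_right 0. 0 < 1 + b * r\<^sup>2"
    by (auto dest: order_tendstoD(1)[of _ _ _ 0])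
  have "((\<lambda>r. \<bar>K\<bar> * r + \<bar>b\<bar> * (4 * M\<^sup>2 * r\<^sup>2 + \<bar>K\<bar> * r^3)) \<longlongrightarrow> \<bar>K\<bar> * 0 + \<bar>b\<bar> * (4 * M\<^sup>2 * 0\<^sup>2 + \<bar>K\<bar> * 0^3)) (at_right 0)"
    by (intro tendsto_intros)
  then have e3: "\<forall>\<^sub>F r in at_right 0. \<bar>K\<bar> * r + \<bar>b\<bar> * (4 * M\<^sup>2 * r\<^sup>2 + \<bar>K\<bar> * r^3) < \<eta> / 2"
    using \<eta> by (auto dest: order_tendstoD(2)[of _ _ _ "\<eta> / 2"])
  show ?thesis
    using e1 e2 e3
  proof eventually_elim
    case (elim r)
    then have r: "0 < r" "r < r1" "r < R / 2" "0 < 1 + b * r\<^sup>2" by auto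
    show ?case
    proof
      fix a :: "complex^'n" assume a: "a \<in> CHball"
      define d where "d = (cmod (deriv (Q a) 0))\<^sup>2"
      have d: "0 \<le> d" "d \<le> M\<^sup>2"
        using M[OF a] by (auto simp: d_def intro!: power_mono)
      have d': "d = (real k)\<^sup>2 * (cmod (herm (T v) (grad a x)))\<^sup>2"
        by (simp add: d_def dQ[OF a] norm_mult power_mult_distrib)
      have pw: "rho a (g w) ^ k \<le> (rho a x ^ k * (1 + b * r\<^sup>2)) * (cmod (Q a w))\<^sup>2"
        if w: "cmod w = cmod (of_real r)" for w
      proof -
        have w': "cmod w = r" "w \<in> ball 0 R" "w \<noteq> 0" using w r R(1) by auto
        have "(rho x (g w) ^ k - 1) / r\<^sup>2 < b"
          using r1(2)[of w] w' r by (simp add: b_def)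
        then have "rho x (g w) ^ k \<le> 1 + b * r\<^sup>2"
          using r(1) by (simp add: pos_divide_less_eq)
        then have "(rho a x ^ k * (cmod (Q a w))\<^sup>2) * rho x (g w) ^ k \<le> (rho a x ^ k * (cmod (Q a w))\<^sup>2) * (1 + b * r\<^sup>2)"
          using rho_pos[OF a x] by (intro mult_left_mono) auto
        then show ?thesis
          unfolding rho_factor[OF a x gB[OF w'(2)]] power_mult_distrib
          by (simp add: Q_def norm_power mult_ac flip: power_mult)
      qed
      have "cross_sum (\<lambda>w. (cmod (Q a w))\<^sup>2) (of_real r) \<le> 4 + 4 * d * r\<^sup>2 + K * r ^ 3"
        using K[OF Qhol[OF a] Qbd[OF a], of "of_real r"] r by (simp add: Q0[OF a] d_def)
      also have "\<dots> \<le> 4 + 4 * d * r\<^sup>2 + \<bar>K\<bar> * r ^ 3"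
        using r(1) by (simp add: mult_right_mono)
      finally have cs: "cross_sum (\<lambda>w. (cmod (Q a w))\<^sup>2) (of_real r) \<le> 4 + 4 * d * r\<^sup>2 + \<bar>K\<bar> * r ^ 3" .
      have "cross_sum (\<lambda>w. rho a (g w) ^ k) (of_real r)
          \<le> (rho a x ^ k * (1 + b * r\<^sup>2)) * cross_sum (\<lambda>w. (cmod (Q a w))\<^sup>2) (of_real r)"
        unfolding cross_sum_cmult[symmetric] by (rule cross_sum_mono[OF pw])
      also have "\<dots> \<le> (rho a x ^ k * (1 + b * r\<^sup>2)) * (4 + 4 * d * r\<^sup>2 + \<bar>K\<bar> * r ^ 3)"
        using rho_pos[OF a x] r(4) by (intro mult_left_mono cs) auto
      also have "\<dots> = rho a x ^ k * ((1 + b * r\<^sup>2) * (4 + 4 * d * r\<^sup>2 + \<bar>K\<bar> * r ^ 3))"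
        by simp
      also have "\<dots> \<le> rho a x ^ k * (4 + 4 * r\<^sup>2 * (d - \<omega>) + \<eta> * r\<^sup>2)"
      proof (rule mult_left_mono)
        have "b * (4 * d * r\<^sup>2 + \<bar>K\<bar> * r^3) \<le> \<bar>b\<bar> * (4 * M\<^sup>2 * r\<^sup>2 + \<bar>K\<bar> * r^3)"
          using r d by (intro mult_mono) (auto intro!: mult_right_mono add_nonneg_nonneg)
        then have "\<bar>K\<bar> * r + b * (4 * d * r\<^sup>2 + \<bar>K\<bar> * r^3) \<le> \<eta> / 2"
          using elim(3) by linarith
        then have "r\<^sup>2 * (\<bar>K\<bar> * r + b * (4 * d * r\<^sup>2 + \<bar>K\<bar> * r^3)) \<le> r\<^sup>2 * (\<eta> / 2)"
          by (intro mult_left_mono) auto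
        moreover have "(1 + b * r\<^sup>2) * (4 + 4 * d * r\<^sup>2 + \<bar>K\<bar> * r ^ 3)
          = 4 + 4 * d * r\<^sup>2 + 4 * b * r\<^sup>2 + r\<^sup>2 * (\<bar>K\<bar> * r + b * (4 * d * r\<^sup>2 + \<bar>K\<bar> * r^3))"
          by (simp add: algebra_simps power2_eq_square power3_eq_cube)
        moreover have "4 * b * r\<^sup>2 = - (4 * r\<^sup>2 * \<omega>) + r\<^sup>2 * (\<eta> / 2)"
          by (simp add: b_def algebra_simps)
        moreover have "4 * r\<^sup>2 * (d - \<omega>) = 4 * d * r\<^sup>2 - 4 * r\<^sup>2 * \<omega>"
          by (simp add: algebra_simps)
        moreover have "r\<^sup>2 * (\<eta> / 2) = \<eta> * r\<^sup>2 / 2"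
          by simp
        ultimately show "(1 + b * r\<^sup>2) * (4 + 4 * d * r\<^sup>2 + \<bar>K\<bar> * r ^ 3) \<le> 4 + 4 * r\<^sup>2 * (d - \<omega>) + \<eta> * r\<^sup>2"
          by linarith
      qed (use rho_pos[OF a x] in auto)
      finally show "cross_sum (\<lambda>\<zeta>. rho a (\<psi> (\<zeta> *s v)) ^ k) (of_real r)
        \<le> rho a x ^ k * (4 + 4 * r\<^sup>2 * ((real k)\<^sup>2 * (cmod (herm (T v) (grad a x)))\<^sup>2 - real k * bergman x (T v)) + \<eta> * r\<^sup>2)"
        unfolding d' \<omega>_def g_def .
    qed
  qed
qed

section \<open>The maximum principle for orbit sums\<close>

lemma eventually_cubic_le:
  assumes "0 < \<eta>" "0 < (R::real)"
  shows "\<forall>\<^sub>F r in at_right 0. 0 < r \<and> r \<le> R \<and> K * r ^ 3 \<le> \<eta> * r\<^sup>2"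
proof -
  have "((\<lambda>r. K * r) \<longlongrightarrow> K * 0) (at_right 0)"
    by (intro tendsto_intros)
  then have "\<forall>\<^sub>F r in at_right 0. K * r < \<eta>"
    using assms(1) by (auto dest: order_tendstoD(2)[of _ _ _ \<eta>])
  moreover have "\<forall>\<^sub>F r in at_right 0. 0 < r \<and> r \<le> R"
    unfolding eventually_at_right[OF zero_less_one] by (rule exI[of _ R]) (use assms in auto)
  ultimately show ?thesis
  proof eventually_elim
    case (elim r)
    then have "K * r * r\<^sup>2 \<le> \<eta> * r\<^sup>2" by (intro mult_right_mono) auto
    then show ?case using elim by (simp add: power2_eq_square power3_eq_cube mult.assoc)
  qed
qed

lemma holomorphic_bounded_ball:
  assumes "f holomorphic_on S" "open S" "0 \<in> S"
  obtains R C where "0 < R" "f holomorphic_on ball 0 R" "\<And>z. z \<in> ball 0 R \<Longrightarrow> cmod (f z) \<le> C"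
proof -
  obtain R where R: "R > 0" "cball 0 R \<subseteq> S"
    using assms(2,3) open_contains_cball by blast
  have "continuous_on (cball 0 R) f"
    using assms(1) R(2) by (meson continuous_on_subset holomorphic_on_imp_continuous_on)
  then have "bounded (f ` cball 0 R)"
    by (intro compact_imp_bounded compact_continuous_image) auto
  then obtain C where "\<And>z. z \<in> cball 0 R \<Longrightarrow> cmod (f z) \<le> C"
    unfolding bounded_iff by blast
  moreover have "f holomorphic_on ball 0 R"
    using assms(1) R(2) ball_subset_cball by (meson holomorphic_on_subset order_trans)
  ultimately show ?thesis using R(1) by (intro that[of R C]) auto
qed

lemma cross_sum_norm_sq_eventually:
  assumes "f holomorphic_on S" "open S" "0 \<in> S" "0 < \<eta>"
  shows "\<forall>\<^sub>F r in at_right 0. cross_sum (\<lambda>w. (cmod (f w))\<^sup>2) (of_real r)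
    \<le> 4 * (cmod (f 0))\<^sup>2 + 4 * (cmod (deriv f 0))\<^sup>2 * r\<^sup>2 + \<eta> * r\<^sup>2"
proof -
  obtain R C where R: "0 < R" "f holomorphic_on ball 0 R" "\<And>z. z \<in> ball 0 R \<Longrightarrow> cmod (f z) \<le> C"
    using holomorphic_bounded_ball[OF assms(1-3)] by blast
  obtain K where K: "\<And>\<zeta>. cmod \<zeta> \<le> R / 2 \<Longrightarrow>
    \<bar>cross_sum (\<lambda>w. (cmod (f w))\<^sup>2) \<zeta> - (4 * (cmod (f 0))\<^sup>2 + 4 * (cmod (deriv f 0))\<^sup>2 * (cmod \<zeta>)\<^sup>2)\<bar>
      \<le> K * cmod \<zeta> ^ 3"
    using cross_sum_norm_sq[OF R(1), of C] R(2,3) by metis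
  have "\<forall>\<^sub>F r in at_right 0. 0 < r \<and> r \<le> R / 2 \<and> K * r ^ 3 \<le> \<eta> * r\<^sup>2"
    by (rule eventually_cubic_le) (use assms(4) R(1) in auto)
  then show ?thesis
  proof eventually_elim
    case (elim r)
    then show ?case using K[of "of_real r"] by (simp add: abs_le_iff)
  qed
qed

lemma cross_sum_Re_eventually:
  assumes "f holomorphic_on S" "open S" "0 \<in> S" "0 < \<eta>"
  shows "\<forall>\<^sub>F r in at_right 0. 4 * Re (f 0) - \<eta> * r\<^sup>2 \<le> cross_sum (\<lambda>w. Re (f w)) (of_real r)"
proof -
  obtain R C where R: "0 < R" "f holomorphic_on ball 0 R" "\<And>z. z \<in> ball 0 R \<Longrightarrow> cmod (f z) \<le> C"
    using holomorphic_bounded_ball[OF assms(1-3)] by blast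
  let ?K = "4 * (3 * C / (R/4)^3)"
  have "\<forall>\<^sub>F r in at_right 0. 0 < r \<and> r \<le> R / 2 \<and> ?K * r ^ 3 \<le> \<eta> * r\<^sup>2"
    by (rule eventually_cubic_le) (use assms(4) R(1) in auto)
  then show ?thesis
  proof eventually_elim
    case (elim r)
    then have "\<bar>cross_sum (\<lambda>w. Re (f w)) (of_real r) - 4 * Re (f 0)\<bar> \<le> ?K * r ^ 3"
      using cross_sum_Re[OF R, of "of_real r"] by simp
    with elim show ?case by (simp only: abs_le_iff) linarith
  qed
qed

lemma infsum_finite_sum:
  fixes f :: "'e \<Rightarrow> 'i \<Rightarrow> real"
  assumes "finite B" "\<And>e. e \<in> B \<Longrightarrow> f e summable_on I"
  shows summable_on_finite_sum: "(\<lambda>i. \<Sum>e\<in>B. f e i) summable_on I"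
    and "(\<Sum>\<^sub>\<infinity>i\<in>I. \<Sum>e\<in>B. f e i) = (\<Sum>e\<in>B. infsum (f e) I)"
proof -
  have "(\<lambda>i. \<Sum>e\<in>B. f e i) summable_on I \<and> (\<Sum>\<^sub>\<infinity>i\<in>I. \<Sum>e\<in>B. f e i) = (\<Sum>e\<in>B. infsum (f e) I)"
    using assms by (induction B rule: finite_induct) (auto simp: infsum_add summable_on_add)
  then show "(\<lambda>i. \<Sum>e\<in>B. f e i) summable_on I" "(\<Sum>\<^sub>\<infinity>i\<in>I. \<Sum>e\<in>B. f e i) = (\<Sum>e\<in>B. infsum (f e) I)"
    by auto
qed

section \<open>Harnack comparison and the orbit sum\<close>

definition harnack :: "complex^'n \<Rightarrow> complex^'n \<Rightarrow> real" where
  "harnack x z = (1 - (norm z)\<^sup>2) / (1 - (norm x)\<^sup>2) * (1 + norm (x - z) / (1 - norm z))\<^sup>2"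

text \<open>Passing from \<open>x\<close> to \<open>z\<close> changes \<open>1 - herm _ a\<close> by
  at most \<open>|x - z|\<close>, while its modulus at \<open>z\<close> is at least
  \<open>1 - |z|\<close>. The factor is independent of \<open>a\<close> and tends to 1 as
  \<open>z\<close> tends to \<open>x\<close>, so it transfers first convergence and then continuity
  to the whole sum.\<close>

lemma rho_harnack:
  assumes "a \<in> CHball" "x \<in> CHball" "z \<in> CHball"
  shows "rho a z \<le> rho a x * harnack x z"
proof -
  let ?p = "cmod (1 - herm x a)" and ?q = "cmod (1 - herm z a)"
  have nz: "0 < 1 - norm z" using assms(3) by (simp add: CHball_def)
  have q: "1 - norm z \<le> ?q" by (rule herm_ball_bound[OF assms(1)])
  have p0: "0 < ?p" using herm_ne_one[OF assms(1,2)] by simp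
  have "cmod (herm (x - z) a) \<le> norm (x - z) * norm a"
    by (rule herm_Cauchy_Schwarz)
  also have "\<dots> \<le> norm (x - z) * 1"
    using assms(1) unfolding CHball_def by (intro mult_left_mono) auto
  finally have d: "cmod (herm (x - z) a) \<le> norm (x - z)" by simp
  have "?p \<le> ?q + cmod (herm (x - z) a)"
    using norm_triangle_ineq4[of "1 - herm z a" "herm (x - z) a"] by (simp add: herm_diff_left)
  also have "\<dots> \<le> ?q + norm (x - z)" using d by simp
  also have "\<dots> \<le> ?q + ?q * (norm (x - z) / (1 - norm z))"
    using mult_right_mono[OF q, of "norm (x - z) / (1 - norm z)"] nz by simp
  finally have "?p / ?q \<le> 1 + norm (x - z) / (1 - norm z)"
    using q nz by (subst pos_divide_le_eq) (auto simp: algebra_simps)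
  then have pq: "(?p / ?q)\<^sup>2 \<le> (1 + norm (x - z) / (1 - norm z))\<^sup>2"
    by (intro power_mono) auto
  have "rho a z = rho a x * ((1 - (norm z)\<^sup>2) / (1 - (norm x)\<^sup>2) * (?p / ?q)\<^sup>2)"
    using p0 CHball_pos[OF assms(2)] unfolding rho_def by (simp add: power_divide)
  also have "\<dots> \<le> rho a x * harnack x z"
    unfolding harnack_def using rho_pos[OF assms(1,2)] CHball_pos[OF assms(2)] CHball_pos[OF assms(3)] pq
    by (intro mult_left_mono) auto
  finally show ?thesis .
qed

lemma harnack_pos: "x \<in> CHball \<Longrightarrow> z \<in> CHball \<Longrightarrow> 0 < harnack x z"
proof -
  assume "x \<in> CHball" "z \<in> CHball"
  then have "0 < rho z x" "0 < rho z z" "rho z z \<le> rho z x * harnack x z"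
    using rho_pos rho_harnack by blast+
  then show ?thesis by (metis less_le_trans zero_less_mult_pos)
qed

definition poincare :: "'g set \<Rightarrow> ('g \<Rightarrow> complex^'n) \<Rightarrow> nat \<Rightarrow> complex^'n \<Rightarrow> real" where
  "poincare I a k z = (\<Sum>\<^sub>\<infinity>i\<in>I. rho (a i) z ^ k)"

text \<open>The group is reduced to the family of its orbit points; convergence at the single point
  \<open>p\<close> spreads to the ball by \<open>rho_harnack\<close>.\<close>

locale orbit_sum =
  fixes I :: "'g set" and a :: "'g \<Rightarrow> complex^'n" and k :: nat and p :: "complex^'n"
  assumes in_ball: "\<And>i. i \<in> I \<Longrightarrow> a i \<in> CHball"
    and p: "p \<in> CHball"
    and summable_p: "(\<lambda>i. rho (a i) p ^ k) summable_on I"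
begin

lemma summable_rho: "z \<in> CHball \<Longrightarrow> (\<lambda>i. rho (a i) z ^ k) summable_on I"
proof (rule summable_on_comparison_test)
  assume z: "z \<in> CHball"
  show "(\<lambda>i. harnack p z ^ k * rho (a i) p ^ k) summable_on I"
    by (intro summable_on_cmult_right summable_p)
  fix i assume i: "i \<in> I"
  show "0 \<le> rho (a i) z ^ k" using rho_pos[OF in_ball[OF i] z] by simp
  show "rho (a i) z ^ k \<le> harnack p z ^ k * rho (a i) p ^ k"
    unfolding power_mult_distrib[symmetric] using rho_pos[OF in_ball[OF i] z]
    by (intro power_mono) (use rho_harnack[OF in_ball[OF i] p z] in \<open>auto simp: mult.commute\<close>)
qed

lemma poincare_harnack:
  assumes "x \<in> CHball" "z \<in> CHball"
  shows "poincare I a k z \<le> harnack x z ^ k * poincare I a k x"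
proof -
  have "poincare I a k z \<le> (\<Sum>\<^sub>\<infinity>i\<in>I. harnack x z ^ k * rho (a i) x ^ k)"
    unfolding poincare_def
  proof (rule infsum_mono)
    fix i assume i: "i \<in> I"
    show "rho (a i) z ^ k \<le> harnack x z ^ k * rho (a i) x ^ k"
      unfolding power_mult_distrib[symmetric] using rho_pos[OF in_ball[OF i] assms(2)]
      by (intro power_mono) (use rho_harnack[OF in_ball[OF i] assms] in \<open>auto simp: mult.commute\<close>)
  qed (intro summable_rho summable_on_cmult_right assms)+
  then show ?thesis
    by (simp add: infsum_cmult_right' poincare_def)
qed

lemma poincare_nonneg: "z \<in> CHball \<Longrightarrow> 0 \<le> poincare I a k z"
  unfolding poincare_def by (intro infsum_nonneg zero_le_power less_imp_le rho_pos in_ball)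

lemma continuous_poincare: "continuous_on CHball (poincare I a k)"
  unfolding continuous_on
proof
  fix x :: "complex^'n" assume x: "x \<in> CHball"
  let ?F = "at x within CHball"
  have nz: "1 - (norm x)\<^sup>2 \<noteq> 0" "1 - norm x \<noteq> 0"
    using CHball_pos[OF x] x by (auto simp: CHball_def)
  have h1: "((\<lambda>z. harnack x z) \<longlongrightarrow> (1 - (norm x)\<^sup>2) / (1 - (norm x)\<^sup>2) * (1 + norm (x - x) / (1 - norm x))\<^sup>2) ?F"
    unfolding harnack_def by (intro tendsto_intros) (use nz in auto)
  have h2: "((\<lambda>z. harnack z x) \<longlongrightarrow> (1 - (norm x)\<^sup>2) / (1 - (norm x)\<^sup>2) * (1 + norm (x - x) / (1 - norm x))\<^sup>2) ?F"
    unfolding harnack_def by (intro tendsto_intros) (use nz in auto)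
  have u: "((\<lambda>z. harnack x z ^ k * poincare I a k x) \<longlongrightarrow> 1 ^ k * poincare I a k x) ?F"
    using h1 nz by (intro tendsto_intros) auto
  have l: "((\<lambda>z. poincare I a k x / harnack z x ^ k) \<longlongrightarrow> poincare I a k x / 1 ^ k) ?F"
    using h2 nz by (intro tendsto_intros) auto
  have inB: "\<forall>\<^sub>F z in ?F. z \<in> CHball" by (simp add: eventually_at_filter)
  have "\<forall>\<^sub>F z in ?F. poincare I a k x / harnack z x ^ k \<le> poincare I a k z"
    using inB
  proof eventually_elim
    case (elim z)
    have "0 < harnack z x ^ k" using harnack_pos[OF elim x] by simp
    then show ?case
      using poincare_harnack[OF elim x] by (simp add: pos_divide_le_eq mult.commute)
  qed
  moreover have "\<forall>\<^sub>F z in ?F. poincare I a k z \<le> harnack x z ^ k * poincare I a k x"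
    using inB by eventually_elim (rule poincare_harnack[OF x])
  ultimately show "(poincare I a k \<longlongrightarrow> poincare I a k x) ?F"
    using tendsto_sandwich[of "\<lambda>z. poincare I a k x / harnack z x ^ k" "poincare I a k"] l u by simp
qed

text \<open>At a local maximum every four-point mean in a direction of \<open>E\<close> is at most
  the central value. Adding these inequalities over an orthonormal basis of the image of
  \<open>E\<close> under \<open>T\<close> gives the contradiction: \<open>Re H\<close> is harmonic,
  \<open>\<epsilon>\<close> contributes at most \<open>4 * \<epsilon>\<close> per direction up to
  small errors, and the term of \<open>i0\<close> alone contributes \<open>4 * k * \<beta>\<close>
  with \<open>\<beta> > \<epsilon>\<close>.\<close>

lemma no_local_max:
  fixes \<psi> :: "complex^'n \<Rightarrow> complex^'n"
  assumes N: "open N" "0 \<in> N" and \<psi>: "hmap N \<psi>" and x: "\<psi> 0 \<in> CHball" and \<psi>B: "\<psi> ` N \<subseteq> CHball"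
    and T: "(\<psi> has_derivative T) (at 0)" "inj T"
    and E: "subspace E" "\<And>c v. v \<in> E \<Longrightarrow> c *s v \<in> E" "2 * k \<le> dim E" and k: "0 < k"
    and H: "holo_on N H"
    and i0: "i0 \<in> I" and \<epsilon>: "0 \<le> \<epsilon>" "\<epsilon> < rho (a i0) (\<psi> 0) ^ Suc k"
    and max: "\<forall>\<^sub>F y in nhds 0. y \<in> E \<longrightarrow> - poincare I a k (\<psi> y) - \<epsilon> * (norm (\<psi> y))\<^sup>2 + Re (H y)
      \<le> - poincare I a k (\<psi> 0) - \<epsilon> * (norm (\<psi> 0))\<^sup>2 + Re (H 0)"
  shows False
proof -
  let ?P = "poincare I a k"
  define x where "x = \<psi> 0"
  have xB: "x \<in> CHball" using assms(4) by (simp add: x_def)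
  obtain T' where T': "(\<psi> has_derivative T') (at 0)" "\<And>c v. T' (c *s v) = c *s T' v"
    using \<psi> N(2) unfolding hmap_def by blast
  have Tc: "T (c *s v) = c *s T v" for c v
    using has_derivative_unique[OF T(1) T'(1)] T'(2) by simp
  have linT: "linear T" using T(1) has_derivative_linear by blast
  have "subspace (T ` E)" by (rule linear_subspace_image[OF linT E(1)])
  then obtain B where B: "finite B" "B \<subseteq> T ` E" "card B = dim (T ` E)"
    "\<And>e. e \<in> B \<Longrightarrow> bergman x e = 1" "\<And>e. e \<in> B \<Longrightarrow> norm e \<le> 1"
    "\<And>b. b \<in> CHball \<Longrightarrow> (\<Sum>e\<in>B. (cmod (herm e (grad b x)))\<^sup>2) \<le> 2 * (1 - rho b x)"
    using bergman_orthonormal[OF xB] by blast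
  define m where "m = card B"
  have m: "2 * k \<le> m"
    using E(3) B(3) dim_image_eq[OF linT, of E] T(2) by (simp add: m_def inj_on_subset)
  define \<beta> where "\<beta> = rho (a i0) x ^ Suc k"
  have be: "\<epsilon> < \<beta>" using \<epsilon> by (simp add: \<beta>_def x_def)
  \<comment> \<open>The errors of the orbit sum, of the norm and of \<open>H\<close> add up to
    \<open>\<eta> * (?P x + \<epsilon> + 1)\<close>, which this choice makes equal to
    \<open>\<beta> - \<epsilon>\<close>.\<close>
  define \<eta> where "\<eta> = (\<beta> - \<epsilon>) / (?P x + \<epsilon> + 1)"
  have P0: "0 \<le> ?P x" by (rule poincare_nonneg[OF xB])
  have \<eta>: "0 < \<eta>" using be P0 \<epsilon>(1) by (simp add: \<eta>_def add_nonneg_pos)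
  define v where "v e = (SOME v. v \<in> E \<and> T v = e)" for e
  have v: "v e \<in> E" "T (v e) = e" if "e \<in> B" for e
    using someI_ex[of "\<lambda>v. v \<in> E \<and> T v = e"] B(2) that unfolding v_def by blast+
  have lim0: "((\<lambda>\<zeta>. \<zeta> *s u) \<longlongrightarrow> 0) (at (0::complex))" for u :: "complex^'n"
    using bounded_linear.tendsto[OF bounded_linear_smult_left tendsto_ident_at, of "u" 0 UNIV] by simp
  have lineN: "open {\<zeta>. \<zeta> *s u \<in> N}" "0 \<in> {\<zeta>. \<zeta> *s u \<in> N}" for u
  proof -
    have "continuous_on UNIV (\<lambda>\<zeta>. \<zeta> *s u)"
      by (intro continuous_intros)
    then show "open {\<zeta>. \<zeta> *s u \<in> N}"
      using open_vimage[OF N(1)] by (auto simp: vimage_def)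
    show "0 \<in> {\<zeta>. \<zeta> *s u \<in> N}" using N(2) by simp
  qed
  have circ: "\<forall>\<^sub>F r in at_right 0. \<forall>\<zeta>. cmod \<zeta> = r \<longrightarrow> Q (\<zeta> *s u)" if "\<forall>\<^sub>F y in nhds 0. Q y" for Q and u :: "complex^'n"
  proof -
    have "\<forall>\<^sub>F \<zeta> in at (0::complex). Q (\<zeta> *s u)"
      using that lim0[of u] unfolding filterlim_iff by blast
    then obtain d where d: "d > 0" "\<And>\<zeta>. \<zeta> \<noteq> 0 \<Longrightarrow> cmod \<zeta> < d \<Longrightarrow> Q (\<zeta> *s u)"
      unfolding eventually_at by (auto simp: dist_norm)
    then show ?thesis
      unfolding eventually_at_right[OF zero_less_one] by (intro exI[of _ d]) auto
  qed
  \<comment> \<open>The facts needed about one direction, collected so that a single radius can be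
    chosen for the finitely many \<open>e\<close> in \<open>B\<close>.\<close>
  define good where "good e r \<longleftrightarrow>
      (\<lambda>i. rho (a i) x ^ k *
        (4 + 4 * r\<^sup>2 * ((real k)\<^sup>2 * (cmod (herm e (grad (a i) x)))\<^sup>2 - real k) + \<eta> * r\<^sup>2)) summable_on I \<and>
      cross_sum (\<lambda>\<zeta>. ?P (\<psi> (\<zeta> *s v e))) (of_real r) \<le> (\<Sum>\<^sub>\<infinity>i\<in>I. rho (a i) x ^ k *
        (4 + 4 * r\<^sup>2 * ((real k)\<^sup>2 * (cmod (herm e (grad (a i) x)))\<^sup>2 - real k) + \<eta> * r\<^sup>2))
      \<and> cross_sum (\<lambda>\<zeta>. (norm (\<psi> (\<zeta> *s v e)))\<^sup>2) (of_real r) \<le> 4 * (norm x)\<^sup>2 + 4 * r\<^sup>2 + \<eta> * r\<^sup>2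
      \<and> 4 * Re (H 0) - \<eta> * r\<^sup>2 \<le> cross_sum (\<lambda>\<zeta>. Re (H (\<zeta> *s v e))) (of_real r)
      \<and> cross_sum (\<lambda>\<zeta>. - ?P (\<psi> (\<zeta> *s v e)) - \<epsilon> * (norm (\<psi> (\<zeta> *s v e)))\<^sup>2 + Re (H (\<zeta> *s v e))) (of_real r)
         \<le> 4 * (- ?P x - \<epsilon> * (norm x)\<^sup>2 + Re (H 0))" for e and r :: real
  have sum_e: "(\<lambda>i. rho (a i) x ^ k *
      (4 + 4 * r\<^sup>2 * ((real k)\<^sup>2 * (cmod (herm e (grad (a i) x)))\<^sup>2 - real k) + \<eta> * r\<^sup>2)) summable_on I"
    if e: "e \<in> B" for e r
  proof -
    have "(\<lambda>i. (4 - 4 * r\<^sup>2 * real k + \<eta> * r\<^sup>2) * rho (a i) x ^ k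
        + 4 * r\<^sup>2 * (real k)\<^sup>2 * (rho (a i) x ^ k * (cmod (herm e (grad (a i) x)))\<^sup>2)) summable_on I"
    proof (intro summable_on_add summable_on_cmult_right summable_rho xB)
      show "(\<lambda>i. rho (a i) x ^ k * (cmod (herm e (grad (a i) x)))\<^sup>2) summable_on I"
      proof (rule summable_on_comparison_test)
        show "(\<lambda>i. rho (a i) x ^ k * 2) summable_on I"
          by (intro summable_on_cmult_left summable_rho xB)
        fix i assume i: "i \<in> I"
        have "(cmod (herm e (grad (a i) x)))\<^sup>2 \<le> (\<Sum>e\<in>B. (cmod (herm e (grad (a i) x)))\<^sup>2)"
          using e B(1) by (intro member_le_sum) auto
        also have "\<dots> \<le> 2"
          using B(6)[OF in_ball[OF i]] rho_pos[OF in_ball[OF i] xB] by simp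
        finally show "rho (a i) x ^ k * (cmod (herm e (grad (a i) x)))\<^sup>2 \<le> rho (a i) x ^ k * 2"
          using rho_pos[OF in_ball[OF i] xB] by (intro mult_left_mono) auto
        show "0 \<le> rho (a i) x ^ k * (cmod (herm e (grad (a i) x)))\<^sup>2"
          using rho_pos[OF in_ball[OF i] xB] by simp
      qed
    qed
    then show ?thesis
      by (rule summable_on_cong[THEN iffD1, rotated]) (simp add: algebra_simps)
  qed
  have ev: "\<forall>\<^sub>F r in at_right 0. good e r" if e: "e \<in> B" for e
    unfolding good_def
  proof (intro eventually_conj)
    have Nev: "\<forall>\<^sub>F r in at_right 0. \<forall>\<zeta>. cmod \<zeta> = r \<longrightarrow> \<zeta> *s v e \<in> N"
      by (rule circ) (use N in \<open>simp add: eventually_nhds_in_open\<close>)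
    show "\<forall>\<^sub>F r in at_right 0. (\<lambda>i. rho (a i) x ^ k *
        (4 + 4 * r\<^sup>2 * ((real k)\<^sup>2 * (cmod (herm e (grad (a i) x)))\<^sup>2 - real k) + \<eta> * r\<^sup>2)) summable_on I"
      by (rule always_eventually) (use sum_e[OF e] in blast)
    show "\<forall>\<^sub>F r in at_right 0. cross_sum (\<lambda>\<zeta>. ?P (\<psi> (\<zeta> *s v e))) (of_real r) \<le> (\<Sum>\<^sub>\<infinity>i\<in>I. rho (a i) x ^ k *
        (4 + 4 * r\<^sup>2 * ((real k)\<^sup>2 * (cmod (herm e (grad (a i) x)))\<^sup>2 - real k) + \<eta> * r\<^sup>2))"
      using rho_cross_sum[OF N \<psi> x_def[symmetric] xB T(1) Tc \<eta>, of "v e" k] Nev eventually_at_right_less[of 0]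
      unfolding v(2)[OF e] B(4)[OF e]
    proof eventually_elim
      case (elim r)
      have sm: "(\<lambda>i. rho (a i) (\<psi> (\<zeta> *s v e)) ^ k) summable_on I" if "cmod \<zeta> = r" for \<zeta>
        using elim(2) that \<psi>B by (intro summable_rho) auto
      have sums: "(\<lambda>i. rho (a i) (\<psi> (of_real r *s v e)) ^ k) summable_on I"
        "(\<lambda>i. rho (a i) (\<psi> ((\<i> * of_real r) *s v e)) ^ k) summable_on I"
        "(\<lambda>i. rho (a i) (\<psi> ((- of_real r) *s v e)) ^ k) summable_on I"
        "(\<lambda>i. rho (a i) (\<psi> ((- (\<i> * of_real r)) *s v e)) ^ k) summable_on I"
        using elim(3) by (intro sm; simp add: norm_mult)+
      have "cross_sum (\<lambda>\<zeta>. ?P (\<psi> (\<zeta> *s v e))) (of_real r)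
          = (\<Sum>\<^sub>\<infinity>i\<in>I. cross_sum (\<lambda>\<zeta>. rho (a i) (\<psi> (\<zeta> *s v e)) ^ k) (of_real r))"
        unfolding cross_sum_def poincare_def
        using sums by (simp add: infsum_add summable_on_add)
      also have "\<dots> \<le> (\<Sum>\<^sub>\<infinity>i\<in>I. rho (a i) x ^ k *
        (4 + 4 * r\<^sup>2 * ((real k)\<^sup>2 * (cmod (herm e (grad (a i) x)))\<^sup>2 - real k) + \<eta> * r\<^sup>2))"
      proof (rule infsum_mono)
        show "(\<lambda>i. cross_sum (\<lambda>\<zeta>. rho (a i) (\<psi> (\<zeta> *s v e)) ^ k) (of_real r)) summable_on I"
          unfolding cross_sum_def using sums by (intro summable_on_add)
        show "cross_sum (\<lambda>\<zeta>. rho (a i) (\<psi> (\<zeta> *s v e)) ^ k) (of_real r) \<le> rho (a i) x ^ k *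
          (4 + 4 * r\<^sup>2 * ((real k)\<^sup>2 * (cmod (herm e (grad (a i) x)))\<^sup>2 - real k) + \<eta> * r\<^sup>2)"
          if "i \<in> I" for i
          using elim(1) in_ball[OF that] by simp
        show "(\<lambda>i. rho (a i) x ^ k *
          (4 + 4 * r\<^sup>2 * ((real k)\<^sup>2 * (cmod (herm e (grad (a i) x)))\<^sup>2 - real k) + \<eta> * r\<^sup>2)) summable_on I"
          by (rule sum_e[OF e])
      qed
      finally show ?case .
    qed
    show "\<forall>\<^sub>F r in at_right 0. cross_sum (\<lambda>\<zeta>. (norm (\<psi> (\<zeta> *s v e)))\<^sup>2) (of_real r) \<le> 4 * (norm x)\<^sup>2 + 4 * r\<^sup>2 + \<eta> * r\<^sup>2"
    proof -
      \<comment> \<open>The norm is handled coordinate by coordinate, with the error shared equally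
        among the coordinates.\<close>
      let ?n = "real CARD('n)"
      have "\<forall>\<^sub>F r in at_right 0. cross_sum (\<lambda>\<zeta>. (cmod (\<psi> (\<zeta> *s v e) $ j))\<^sup>2) (of_real r)
          \<le> 4 * (cmod (x $ j))\<^sup>2 + 4 * (cmod (e $ j))\<^sup>2 * r\<^sup>2 + \<eta> / ?n * r\<^sup>2" for j
      proof -
        have hj: "holo_on N (\<lambda>y. \<psi> y $ j)"
          by (rule holo_compose[OF holo_on_linear[of "\<lambda>z. z $ j" UNIV] \<psi>])
             (auto simp: bounded_linear_vec_nth)
        have "((\<lambda>y. \<psi> y $ j) has_derivative (\<lambda>w. T w $ j)) (at 0)"
          by (rule bounded_linear.has_derivative[OF bounded_linear_vec_nth T(1)])
        then have "((\<lambda>\<zeta>. \<psi> (\<zeta> *s v e) $ j) has_field_derivative T (v e) $ j) (at 0)"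
          using has_field_derivative_line[of "\<lambda>y. \<psi> y $ j" "\<lambda>w. T w $ j" 0 0 "v e"] Tc by simp
        then have "deriv (\<lambda>\<zeta>. \<psi> (\<zeta> *s v e) $ j) 0 = e $ j"
          using v(2)[OF e] DERIV_imp_deriv by metis
        moreover have "0 < \<eta> / ?n" using \<eta> by simp
        ultimately show ?thesis
          using cross_sum_norm_sq_eventually[OF _ lineN, of "\<lambda>\<zeta>. \<psi> (\<zeta> *s v e) $ j" "v e" "\<eta> / ?n"]
            holo_line[OF hj, of "{\<zeta>. \<zeta> *s v e \<in> N}" 0 "v e"] by (simp add: x_def)
      qed
      then have "\<forall>\<^sub>F r in at_right 0. \<forall>j. cross_sum (\<lambda>\<zeta>. (cmod (\<psi> (\<zeta> *s v e) $ j))\<^sup>2) (of_real r)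
          \<le> 4 * (cmod (x $ j))\<^sup>2 + 4 * (cmod (e $ j))\<^sup>2 * r\<^sup>2 + \<eta> / ?n * r\<^sup>2"
        by (rule eventually_all_finite)
      then show ?thesis
      proof eventually_elim
        case (elim r)
        have nsq: "(norm w)\<^sup>2 = (\<Sum>j\<in>UNIV. (cmod (w $ j))\<^sup>2)" for w :: "complex^'n"
          by (simp add: norm_vec_def L2_set_def sum_nonneg)
        have "cross_sum (\<lambda>\<zeta>. (norm (\<psi> (\<zeta> *s v e)))\<^sup>2) (of_real r)
            = (\<Sum>j\<in>UNIV. cross_sum (\<lambda>\<zeta>. (cmod (\<psi> (\<zeta> *s v e) $ j))\<^sup>2) (of_real r))"
          unfolding nsq cross_sum_def by (simp add: sum.distrib)
        also have "\<dots> \<le> (\<Sum>j\<in>UNIV. 4 * (cmod (x $ j))\<^sup>2 + 4 * (cmod (e $ j))\<^sup>2 * r\<^sup>2 + \<eta> / ?n * r\<^sup>2)"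
          using elim by (intro sum_mono) auto
        also have "\<dots> = 4 * (norm x)\<^sup>2 + 4 * (norm e)\<^sup>2 * r\<^sup>2 + \<eta> * r\<^sup>2"
          unfolding nsq by (simp add: sum.distrib sum_distrib_left sum_distrib_right mult.assoc)
        also have "\<dots> \<le> 4 * (norm x)\<^sup>2 + 4 * r\<^sup>2 + \<eta> * r\<^sup>2"
          using B(5)[OF e] mult_right_mono[of "(norm e)\<^sup>2" 1 "r\<^sup>2"] by (simp add: power_le_one)
        finally show ?case .
      qed
    qed
    show "\<forall>\<^sub>F r in at_right 0. 4 * Re (H 0) - \<eta> * r\<^sup>2 \<le> cross_sum (\<lambda>\<zeta>. Re (H (\<zeta> *s v e))) (of_real r)"
      using cross_sum_Re_eventually[OF _ lineN \<eta>, of "\<lambda>\<zeta>. H (\<zeta> *s v e)" "v e"]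
        holo_line[OF H, of "{\<zeta>. \<zeta> *s v e \<in> N}" 0 "v e"] by simp
    show "\<forall>\<^sub>F r in at_right 0. cross_sum (\<lambda>\<zeta>. - ?P (\<psi> (\<zeta> *s v e)) - \<epsilon> * (norm (\<psi> (\<zeta> *s v e)))\<^sup>2 + Re (H (\<zeta> *s v e))) (of_real r)
         \<le> 4 * (- ?P x - \<epsilon> * (norm x)\<^sup>2 + Re (H 0))"
      using circ[OF max, of "v e"] eventually_at_right_less[of 0]
    proof eventually_elim
      case (elim r)
      show ?case
        unfolding cross_sum_const[symmetric, of _ "of_real r"] x_def
        using elim E(2)[OF v(1)[OF e]] by (intro cross_sum_mono) auto
    qed
  qed
  have "\<forall>\<^sub>F r in at_right (0::real). 0 < r" by (rule eventually_at_right_less)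
  moreover have "\<forall>\<^sub>F r in at_right 0. \<forall>e\<in>B. good e r"
    using ev by (intro eventually_ball_finite[OF B(1)]) auto
  ultimately have "\<forall>\<^sub>F r in at_right 0. 0 < r \<and> (\<forall>e\<in>B. good e r)"
    by (rule eventually_conj)
  then have "\<exists>r. 0 < r \<and> (\<forall>e\<in>B. good e r)"
    by (rule eventually_happens'[rotated]) simp
  then obtain r where elim: "0 < r" "\<forall>e\<in>B. good e r"
    by blast
  show False
  proof -
    define U where "U e = (\<Sum>\<^sub>\<infinity>i\<in>I. rho (a i) x ^ k *
        (4 + 4 * r\<^sup>2 * ((real k)\<^sup>2 * (cmod (herm e (grad (a i) x)))\<^sup>2 - real k) + \<eta> * r\<^sup>2))" for e
    define D where "D = \<epsilon> * (4 * r\<^sup>2 + \<eta> * r\<^sup>2) + \<eta> * r\<^sup>2"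
    have one: "4 * ?P x \<le> U e + D" if e: "e \<in> B" for e
    proof -
      have split: "cross_sum (\<lambda>\<zeta>. - ?P (\<psi> (\<zeta> *s v e)) - \<epsilon> * (norm (\<psi> (\<zeta> *s v e)))\<^sup>2 + Re (H (\<zeta> *s v e))) (of_real r)
        = - cross_sum (\<lambda>\<zeta>. ?P (\<psi> (\<zeta> *s v e))) (of_real r)
          - \<epsilon> * cross_sum (\<lambda>\<zeta>. (norm (\<psi> (\<zeta> *s v e)))\<^sup>2) (of_real r)
          + cross_sum (\<lambda>\<zeta>. Re (H (\<zeta> *s v e))) (of_real r)"
        unfolding cross_sum_def by (simp add: algebra_simps)
      have "\<epsilon> * cross_sum (\<lambda>\<zeta>. (norm (\<psi> (\<zeta> *s v e)))\<^sup>2) (of_real r) \<le> \<epsilon> * (4 * (norm x)\<^sup>2 + 4 * r\<^sup>2 + \<eta> * r\<^sup>2)"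
        using elim(2) e \<epsilon>(1) unfolding good_def by (intro mult_left_mono) auto
      also have "\<dots> = 4 * (\<epsilon> * (norm x)\<^sup>2) + \<epsilon> * (4 * r\<^sup>2 + \<eta> * r\<^sup>2)"
        by (simp add: algebra_simps)
      finally have n: "\<epsilon> * cross_sum (\<lambda>\<zeta>. (norm (\<psi> (\<zeta> *s v e)))\<^sup>2) (of_real r)
        \<le> 4 * (\<epsilon> * (norm x)\<^sup>2) + \<epsilon> * (4 * r\<^sup>2 + \<eta> * r\<^sup>2)" .
      note g = elim(2)[rule_format, OF e, unfolded good_def split]
      have lin: "4 * P \<le> U + (Y + z)"
        if "N \<le> 4 * X + Y" "A \<le> U" "4 * h - z \<le> R" "- A - N + R \<le> 4 * (- P - X + h)" for P U Y z N X A h R :: real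
        using that by (simp add: algebra_simps)
      show ?thesis
        unfolding U_def D_def
        by (rule lin[OF n g[THEN conjunct2, THEN conjunct1]
              g[THEN conjunct2, THEN conjunct2, THEN conjunct2, THEN conjunct1]
              g[THEN conjunct2, THEN conjunct2, THEN conjunct2, THEN conjunct2]])
    qed
    define w where "w i = rho (a i) x ^ k" for i
    have w: "0 \<le> w i" "rho (a i) x \<le> 1" "0 \<le> w i * rho (a i) x" if "i \<in> I" for i
      using rho_pos[OF in_ball[OF that] xB] rho_le_1[OF in_ball[OF that] xB] by (auto simp: w_def less_imp_le)
    have sw: "w summable_on I" unfolding w_def by (rule summable_rho[OF xB])
    have sw1: "(\<lambda>i. w i * rho (a i) x) summable_on I"
      by (rule summable_on_comparison_test[OF sw]) (use w in \<open>auto intro: mult_left_le\<close>)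
    have \<beta>_le: "\<beta> \<le> (\<Sum>\<^sub>\<infinity>i\<in>I. w i * rho (a i) x)"
      using finite_sum_le_infsum[OF sw1, of "{i0}"] i0 w by (simp add: \<beta>_def w_def mult.commute)
    have "real m * (4 * ?P x) = (\<Sum>e\<in>B. 4 * ?P x)"
      by (simp add: m_def)
    also have "\<dots> \<le> (\<Sum>e\<in>B. U e + D)"
      by (rule sum_mono[OF one])
    also have "\<dots> = (\<Sum>e\<in>B. U e) + m * D"
      by (simp add: sum.distrib m_def)
    also have "(\<Sum>e\<in>B. U e) = (\<Sum>\<^sub>\<infinity>i\<in>I. \<Sum>e\<in>B. w i *
        (4 + 4 * r\<^sup>2 * ((real k)\<^sup>2 * (cmod (herm e (grad (a i) x)))\<^sup>2 - real k) + \<eta> * r\<^sup>2))"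
      unfolding U_def w_def by (rule infsum_finite_sum(2)[symmetric, OF B(1)]) (use elim(2) in \<open>auto simp: good_def\<close>)
    also have "\<dots> \<le> (\<Sum>\<^sub>\<infinity>i\<in>I. m * (4 + \<eta> * r\<^sup>2) * w i + (- (4 * r\<^sup>2 * real k * m)) * (w i * rho (a i) x))"
    proof (rule infsum_mono)
      show "(\<lambda>i. \<Sum>e\<in>B. w i * (4 + 4 * r\<^sup>2 * ((real k)\<^sup>2 * (cmod (herm e (grad (a i) x)))\<^sup>2 - real k) + \<eta> * r\<^sup>2)) summable_on I"
        unfolding w_def by (rule summable_on_finite_sum[OF B(1)]) (use elim(2) in \<open>auto simp: good_def\<close>)
      show "(\<lambda>i. m * (4 + \<eta> * r\<^sup>2) * w i + (- (4 * r\<^sup>2 * real k * m)) * (w i * rho (a i) x)) summable_on I"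
        by (intro summable_on_add summable_on_cmult_right sw sw1)
      fix i assume i: "i \<in> I"
      define s where "s = (\<Sum>e\<in>B. (cmod (herm e (grad (a i) x)))\<^sup>2)"
      have s: "s \<le> 2 * (1 - rho (a i) x)" unfolding s_def by (rule B(6)[OF in_ball[OF i]])
      \<comment> \<open>The dimension of \<open>E\<close> enters here: \<open>2 * k <= m\<close>
        turns the coefficient \<open>2 * k\<^sup>2\<close> into \<open>k * m\<close>, the constant
        parts cancel, and only \<open>- k * m * rho\<close> remains.\<close>
      have "real k * (2 * real k) * (1 - rho (a i) x) \<le> real k * real m * (1 - rho (a i) x)"
        using m w(2)[OF i] by (intro mult_right_mono mult_left_mono) auto
      moreover have "(real k)\<^sup>2 * s \<le> (real k)\<^sup>2 * (2 * (1 - rho (a i) x))"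
        by (intro mult_left_mono s) auto
      ultimately have "(real k)\<^sup>2 * s - real k * m \<le> - (real k * m * rho (a i) x)"
        by (simp add: power2_eq_square algebra_simps)
      then have "4 * r\<^sup>2 * ((real k)\<^sup>2 * s - real k * m) \<le> 4 * r\<^sup>2 * - (real k * m * rho (a i) x)"
        by (intro mult_left_mono) auto
      then have "w i * (m * (4 + \<eta> * r\<^sup>2) + 4 * r\<^sup>2 * ((real k)\<^sup>2 * s - real k * m))
          \<le> w i * (m * (4 + \<eta> * r\<^sup>2) + 4 * r\<^sup>2 * - (real k * m * rho (a i) x))"
        by (rule mult_left_mono[OF add_left_mono w(1)[OF i]])
      moreover have "(\<Sum>e\<in>B. w i * (4 + 4 * r\<^sup>2 * ((real k)\<^sup>2 * (cmod (herm e (grad (a i) x)))\<^sup>2 - real k) + \<eta> * r\<^sup>2))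
        = w i * (m * (4 + \<eta> * r\<^sup>2) + 4 * r\<^sup>2 * ((real k)\<^sup>2 * s - real k * m))"
        unfolding s_def m_def sum_distrib_left[symmetric]
        by (simp add: sum.distrib sum_subtractf sum_distrib_left[symmetric] algebra_simps)
      ultimately show "(\<Sum>e\<in>B. w i * (4 + 4 * r\<^sup>2 * ((real k)\<^sup>2 * (cmod (herm e (grad (a i) x)))\<^sup>2 - real k) + \<eta> * r\<^sup>2))
        \<le> m * (4 + \<eta> * r\<^sup>2) * w i + (- (4 * r\<^sup>2 * real k * m)) * (w i * rho (a i) x)"
        by (simp add: algebra_simps)
    qed
    also have "\<dots> = m * (4 + \<eta> * r\<^sup>2) * ?P x + (- (4 * r\<^sup>2 * real k * m)) * (\<Sum>\<^sub>\<infinity>i\<in>I. w i * rho (a i) x)"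
      unfolding poincare_def w_def[symmetric]
      by (subst infsum_add) (intro summable_on_cmult_right sw sw1 | simp only: infsum_cmult_right')+
    also have "\<dots> \<le> m * (4 + \<eta> * r\<^sup>2) * ?P x + (- (4 * r\<^sup>2 * real k * m)) * \<beta>"
      using \<beta>_le by (intro add_left_mono mult_left_mono_neg) auto
    finally have fin: "real m * (4 * ?P x) \<le> m * (4 + \<eta> * r\<^sup>2) * ?P x + (- (4 * r\<^sup>2 * real k * m)) * \<beta> + m * D"
      by simp
    have "m * (r\<^sup>2 * (4 * real k * \<beta>)) \<le> m * (r\<^sup>2 * (4 * \<epsilon> + \<eta> * (?P x + \<epsilon> + 1)))"
      using fin unfolding D_def by (simp add: algebra_simps)
    then have "4 * real k * \<beta> \<le> 4 * \<epsilon> + \<eta> * (?P x + \<epsilon> + 1)"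
      using m k elim(1) by simp
    also have "\<eta> * (?P x + \<epsilon> + 1) = \<beta> - \<epsilon>"
      using P0 \<epsilon>(1) by (simp add: \<eta>_def)
    finally have "4 * real k * \<beta> \<le> 3 * \<epsilon> + \<beta>" by simp
    moreover have "1 * \<beta> \<le> real k * \<beta>"
      using k be \<epsilon>(1) by (intro mult_right_mono) auto
    ultimately show False using be by simp
  qed
qed

end

section \<open>Maxima on analytic sets\<close>

text \<open>The pieces are topological, not holomorphic: their invariance under isometries then only needs
  continuity, and invariance of domain still controls the dimension of anything containing them.\<close>

definition pieces :: "nat \<Rightarrow> (complex^'n) set \<Rightarrow> (complex^'n) set" where
  "pieces k V = {y. \<exists>U S (f :: complex^'n \<Rightarrow> complex^'n). subspace U \<and> dim U = 2 * k \<and>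
     openin (top_of_set U) S \<and> continuous_on S f \<and> inj_on f S \<and> f ` S \<subseteq> V \<and> y \<in> f ` S}"

lemma open_CHball: "open CHball"
  unfolding CHball_def by (auto intro: open_Collect_less continuous_intros)

lemma continuous_on_rho: "a \<in> CHball \<Longrightarrow> continuous_on CHball (rho a)"
  unfolding rho_def using herm_ne_one[of a] by (intro continuous_intros) auto

lemma hmap_minus_const: "hmap U (\<lambda>y. (y :: complex^'n) - c)"
  using hmap_translation[of U "- c"] by simp

lemma linear_dirderiv: "holo_on U f \<Longrightarrow> z \<in> U \<Longrightarrow> linear (\<lambda>v. dirderiv f v z)"
  by (rule has_derivative_linear[OF holo_has_derivative_dirderiv])

locale orbit_variety = orbit_sum I a k p
  for I :: "'g set" and a :: "'g \<Rightarrow> complex^'n" and k :: nat and p :: "complex^'n" +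
  fixes V :: "(complex^'n) set" and i0 :: 'g
  assumes V: "analytic_subset CHball V" and k: "0 < k" and i0: "i0 \<in> I"
begin

text \<open>\<open>V\<close> may have components of dimension below \<open>k\<close>, where the
  maximum principle says nothing, so they are left out. The closure makes the rest relatively closed
  in the ball and lets extrema be attained, at the price of admitting singular points.\<close>

definition top_part :: "(complex^'n) set" where "top_part = CHball \<inter> closure (pieces k V)"

text \<open>The norm is taken in the ball, not in the chart. A change of chart then merely composes
  \<open>\<psi>\<close> and \<open>H\<close> with the same map, and the height keeps its form and
  its \<open>\<epsilon>\<close>.\<close>

definition height :: "(complex^'n \<Rightarrow> complex^'n) \<Rightarrow> (complex^'n \<Rightarrow> complex) \<Rightarrow> real \<Rightarrow> complex^'n \<Rightarrow> real" where
  "height \<psi> H \<epsilon> y = - poincare I a k (\<psi> y) - \<epsilon> * (norm (\<psi> y))\<^sup>2 + Re (H y)"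

text \<open>A holomorphic chart \<open>\<psi>\<close> in which \<open>top_part\<close> lies in the complex subspace \<open>E\<close>, centred at a point where
  a perturbation of \<open>- poincare\<close> has a local maximum on \<open>top_part\<close>.\<close>

definition max_chart where
  "max_chart E \<psi> \<Phi> N W H \<epsilon> \<epsilon>0 \<longleftrightarrow> open N \<and> 0 \<in> N \<and> open W \<and> W \<subseteq> CHball \<and> homeomorphism N W \<psi> \<Phi> \<and>
     hmap N \<psi> \<and> hmap W \<Phi> \<and> subspace E \<and> (\<forall>c v. v \<in> E \<longrightarrow> c *s v \<in> E) \<and> top_part \<inter> W \<subseteq> \<psi> ` (E \<inter> N) \<and> \<psi> 0 \<in> top_part \<and>
     holo_on N H \<and> 0 \<le> \<epsilon> \<and> \<epsilon> < \<epsilon>0 \<and> (\<forall>z\<in>W. \<epsilon>0 < rho (a i0) z ^ Suc k) \<and>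
     (\<forall>\<^sub>F y in nhds 0. y \<in> E \<and> \<psi> y \<in> top_part \<longrightarrow> height \<psi> H \<epsilon> y \<le> height \<psi> H \<epsilon> 0)"

text \<open>If \<open>f\<close> vanishes on \<open>top_part\<close> but its derivative along \<open>E\<close> does not, add a small multiple of
  \<open>log |\<close>derivative\<open>|\<close> to the height: the maximum moves to a nearby point where the derivative is nonzero,
  and there \<open>{f = 0}\<close> is a smooth hypersurface of \<open>E\<close> containing \<open>top_part\<close>.\<close>

lemma max_chart_refine:
  assumes ch: "max_chart E \<psi> \<Phi> N W H \<epsilon> \<epsilon>0"
    and N': "open N'" "0 \<in> N'" "N' \<subseteq> N" and f: "holo_on N' f"
    and f0: "\<And>y. y \<in> E \<Longrightarrow> y \<in> N' \<Longrightarrow> \<psi> y \<in> top_part \<Longrightarrow> f y = 0"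
    and v: "v \<in> E" and h: "\<And>M. open M \<Longrightarrow> 0 \<in> M \<Longrightarrow> \<exists>y\<in>E \<inter> M \<inter> N'. \<psi> y \<in> top_part \<and> dirderiv f v y \<noteq> 0"
  shows "\<exists>E' \<psi>' \<Phi>' N'' W' H' \<epsilon>'. max_chart E' \<psi>' \<Phi>' N'' W' H' \<epsilon>' \<epsilon>0 \<and> dim E' < dim E"
proof -
  have ch': "open N" "0 \<in> N" "open W" "W \<subseteq> CHball" "homeomorphism N W \<psi> \<Phi>" "hmap N \<psi>" "hmap W \<Phi>" "subspace E"
    "\<And>c v. v \<in> E \<Longrightarrow> c *s v \<in> E" "top_part \<inter> W \<subseteq> \<psi> ` (E \<inter> N)" "\<psi> 0 \<in> top_part" "holo_on N H" "0 \<le> \<epsilon>" "\<epsilon> < \<epsilon>0"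
    "\<And>z. z \<in> W \<Longrightarrow> \<epsilon>0 < rho (a i0) z ^ Suc k"
    "\<forall>\<^sub>F y in nhds 0. y \<in> E \<and> \<psi> y \<in> top_part \<longrightarrow> height \<psi> H \<epsilon> y \<le> height \<psi> H \<epsilon> 0"
    using ch unfolding max_chart_def by auto
  define x where "x = \<psi> 0"
  have \<psi>W: "\<psi> y \<in> W" if "y \<in> N" for y using ch'(5) that by (auto simp: homeomorphism_def)
  have \<Phi>\<psi>: "\<Phi> (\<psi> y) = y" if "y \<in> N" for y using ch'(5) that by (auto simp: homeomorphism_def)
  have cont\<psi>: "continuous_on N \<psi>" by (rule hmap_continuous[OF ch'(6)])
  have cont_height: "continuous_on N (height \<psi> H \<epsilon>)"
    unfolding height_def using \<psi>W ch'(4)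
    by (intro continuous_intros continuous_on_compose2[OF continuous_poincare cont\<psi>] cont\<psi>
        holo_on_continuous ch'(12)) auto
  define g where "g = dirderiv f v"
  have g: "holo_on N' g" unfolding g_def by (rule holo_on_dirderiv[OF f N'(1)])
  obtain \<tau> where \<tau>: "0 < \<tau>" "cball 0 \<tau> \<subseteq> N'"
    "\<And>y. y \<in> cball 0 \<tau> \<Longrightarrow> y \<in> E \<Longrightarrow> \<psi> y \<in> top_part \<Longrightarrow> height \<psi> H \<epsilon> y \<le> height \<psi> H \<epsilon> 0"
  proof -
    have "\<forall>\<^sub>F y in nhds 0. y \<in> N' \<and> (y \<in> E \<and> \<psi> y \<in> top_part \<longrightarrow> height \<psi> H \<epsilon> y \<le> height \<psi> H \<epsilon> 0)"
      using ch'(16) N' by (auto simp: eventually_conj_iff eventually_nhds_in_open)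
    then obtain d where "d > 0" "\<And>y. dist y 0 < d \<Longrightarrow> y \<in> N' \<and> (y \<in> E \<and> \<psi> y \<in> top_part \<longrightarrow> height \<psi> H \<epsilon> y \<le> height \<psi> H \<epsilon> 0)"
      unfolding eventually_nhds_metric by blast
    then show ?thesis by (intro that[of "d/2"]) (auto simp: dist_commute)
  qed
  have cbN: "cball 0 \<tau> \<subseteq> N" using \<tau>(2) N'(3) by blast
  define A where "A = {y \<in> E \<inter> cball 0 \<tau>. \<psi> y \<in> top_part}"
  have "A = E \<inter> (cball 0 \<tau> \<inter> \<psi> -` closure (pieces k V))"
    using cbN \<psi>W ch'(4) by (auto simp: A_def top_part_def)
  moreover have "closed (cball 0 \<tau> \<inter> \<psi> -` closure (pieces k V))"
    using cbN by (intro continuous_closed_preimage continuous_on_subset[OF cont\<psi>]) auto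
  ultimately have "closed A" using closed_subspace[OF ch'(8)] by auto
  then have compA: "compact A"
    unfolding compact_eq_bounded_closed by (auto simp: A_def intro: bounded_subset[OF bounded_cball[of 0 \<tau>]])
  have A0: "0 \<in> A" using ch'(8,11) \<tau>(1) by (auto simp: A_def subspace_0)
  \<comment> \<open>Half of the remaining allowance, so that any number of refinements stays below
    the same \<open>\<epsilon>0\<close>.\<close>
  define \<epsilon>' where "\<epsilon>' = (\<epsilon>0 - \<epsilon>) / 2"
  have \<epsilon>': "0 < \<epsilon>'" "\<epsilon> + \<epsilon>' < \<epsilon>0" using ch'(14) by (auto simp: \<epsilon>'_def field_simps)
  \<comment> \<open>Subtracting \<open>|\<psi> y - x|^2\<close> makes the maximum at 0 strict, with
    a gap \<open>m\<close> on the sphere of radius \<open>\<tau>\<close>. Up to a constant and the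
    real part of a holomorphic function it is the same as subtracting
    \<open>|\<psi> y|^2\<close>.\<close>
  define \<phi> where "\<phi> y = height \<psi> H \<epsilon> y - \<epsilon>' * (norm (\<psi> y - x))\<^sup>2" for y
  have cont\<phi>: "continuous_on N \<phi>"
    unfolding \<phi>_def by (intro continuous_intros cont_height cont\<psi>)
  have \<phi>0: "\<phi> 0 = height \<psi> H \<epsilon> 0" by (simp add: \<phi>_def x_def)
  obtain \<mu> where \<mu>: "0 < \<mu>" "\<And>y. y \<in> N \<Longrightarrow> dist (\<psi> y) x < \<mu> \<Longrightarrow> norm y < \<tau>"
  proof -
    have "continuous_on W \<Phi>" using ch'(5) by (simp add: homeomorphism_def)
    then have "\<exists>d>0. \<forall>z\<in>W. dist z x < d \<longrightarrow> dist (\<Phi> z) (\<Phi> x) < \<tau>"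
      using \<psi>W[OF ch'(2)] \<tau>(1) unfolding continuous_on_iff x_def by blast
    then show ?thesis
      using \<Phi>\<psi> \<psi>W ch'(2) that unfolding x_def by (metis dist_0_norm dist_commute)
  qed
  define m where "m = \<epsilon>' * \<mu>\<^sup>2"
  have m: "0 < m" using \<epsilon>' \<mu> by (simp add: m_def)
  have \<phi>_sphere: "\<phi> y \<le> \<phi> 0 - m" if "y \<in> A" "norm y = \<tau>" for y
  proof -
    have "\<not> dist (\<psi> y) x < \<mu>" using \<mu>(2)[of y] that cbN by (auto simp: A_def)
    then have "\<mu>\<^sup>2 \<le> (norm (\<psi> y - x))\<^sup>2" using \<mu>(1) by (intro power_mono) (auto simp: dist_norm)
    then have "m \<le> \<epsilon>' * (norm (\<psi> y - x))\<^sup>2" using \<epsilon>' by (simp add: m_def)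
    moreover have "height \<psi> H \<epsilon> y \<le> \<phi> 0" unfolding \<phi>0 using that(1) \<tau>(3) by (auto simp: A_def)
    ultimately show ?thesis by (simp add: \<phi>_def)
  qed
  \<comment> \<open>The comparison point: \<open>g\<close> is nonzero there, and less than half of
    the gap \<open>m\<close> is lost.\<close>
  obtain y1 where y1: "y1 \<in> A" "g y1 \<noteq> 0" "\<phi> 0 - m / 2 < \<phi> y1"
  proof -
    have "\<exists>d>0. \<forall>y\<in>N. dist y 0 < d \<longrightarrow> dist (\<phi> y) (\<phi> 0) < m / 2"
      using cont\<phi> ch'(2) m unfolding continuous_on_iff by (meson half_gt_zero)
    then obtain d where d: "d > 0" "\<And>y. y \<in> N \<Longrightarrow> dist y 0 < d \<Longrightarrow> dist (\<phi> y) (\<phi> 0) < m / 2"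
      by blast
    have "\<exists>y\<in>E \<inter> ball 0 (min d \<tau>) \<inter> N'. \<psi> y \<in> top_part \<and> dirderiv f v y \<noteq> 0"
      by (rule h) (use d(1) \<tau>(1) in auto)
    then obtain y where y: "y \<in> E" "norm y < d" "norm y < \<tau>" "y \<in> N'" "\<psi> y \<in> top_part" "g y \<noteq> 0"
      unfolding g_def by auto
    then have "dist (\<phi> y) (\<phi> 0) < m / 2" using d(2) N'(3) by auto
    then have "\<phi> 0 - m / 2 < \<phi> y" unfolding dist_real_def by linarith
    with y show ?thesis by (intro that[of y]) (auto simp: A_def)
  qed
  obtain C where C: "0 < C" "\<And>y. y \<in> A \<Longrightarrow> cmod (g y) \<le> C"
  proof -
    have "A \<subseteq> N'" using \<tau>(2) by (auto simp: A_def)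
    then have "continuous_on A g" by (rule continuous_on_subset[OF holo_on_continuous[OF g]])
    then have "bounded (g ` A)" using compA by (intro compact_imp_bounded compact_continuous_image)
    then show ?thesis using that unfolding bounded_pos by auto
  qed
  \<comment> \<open>\<open>L\<close> is the drop of \<open>ln |g|\<close> from its bound
    \<open>ln C\<close> at \<open>y1\<close>; \<open>\<delta>\<close> is so small that the drop
    costs at most the other half of the gap.\<close>
  define L where "L = ln (C / cmod (g y1))"
  have L: "0 \<le> L" using C y1 by (simp add: L_def)
  define \<delta> where "\<delta> = m / 2 / (L + 1)"
  have \<delta>: "0 < \<delta>" "\<delta> * L \<le> m / 2"
    using m L by (auto simp: \<delta>_def field_simps)
  \<comment> \<open>The exponential of \<open>\<phi> + \<delta> * ln (|g| / C)\<close>, extended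
    continuously by 0 to the zeros of \<open>g\<close>. Its maximum avoids these zeros, and it
    avoids the sphere because the second factor is at most 1 on \<open>A\<close>.\<close>
  define Q where "Q y = exp (\<phi> y) * (cmod (g y) / C) powr \<delta>" for y
  have "continuous_on A Q"
    unfolding Q_def using C \<delta> cbN \<tau>(2)
    by (intro continuous_intros continuous_on_powr' continuous_on_subset[OF cont\<phi>]
        continuous_on_subset[OF holo_on_continuous[OF g]]) (auto simp: A_def)
  then obtain y2 where y2: "y2 \<in> A" "\<And>y. y \<in> A \<Longrightarrow> Q y \<le> Q y2"
    using continuous_attains_sup[OF compA] A0 by blast
  have "exp (\<phi> 0 - m) < Q y1"
  proof -
    have "(cmod (g y1) / C) powr \<delta> = exp (- (\<delta> * L))"
      using y1(2) C(1) by (simp add: powr_def L_def ln_div algebra_simps)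
    then have "Q y1 = exp (\<phi> y1 - \<delta> * L)"
      by (simp add: Q_def flip: exp_add)
    then show ?thesis using y1(3) \<delta>(2) by simp
  qed
  then have Qy2: "exp (\<phi> 0 - m) < Q y2" using y2(2)[OF y1(1)] by simp
  have gy2: "g y2 \<noteq> 0" using Qy2 by (auto simp: Q_def)
  have ny2: "norm y2 < \<tau>"
  proof (rule ccontr)
    assume "\<not> norm y2 < \<tau>"
    then have "\<phi> y2 \<le> \<phi> 0 - m" using y2(1) by (intro \<phi>_sphere) (auto simp: A_def)
    then have "Q y2 \<le> exp (\<phi> 0 - m) * 1"
      unfolding Q_def using C y2(1) by (intro mult_mono) (auto intro!: powr_le1 simp: \<delta>(1) less_imp_le)
    then show False using Qy2 by simp
  qed
  have e0: "y2 \<in> E" "y2 \<in> N'" "\<psi> y2 \<in> top_part" using y2(1) \<tau>(2) by (auto simp: A_def)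
  have fy2: "f y2 = 0" by (rule f0[OF e0])
  define c where "c = inverse (g y2) *s v"
  have c: "c \<in> E" "dirderiv f c y2 = 1"
    using ch'(9)[OF v] dirderiv_smult[OF f e0(2)] gy2 by (auto simp: c_def g_def)
  \<comment> \<open>On this neighbourhood of \<open>y2\<close> the quotient
    \<open>g y / g y2\<close> stays in the right half-plane, so its principal logarithm is
    holomorphic.\<close>
  define N1 where "N1 = ball 0 \<tau> \<inter> (\<lambda>y. Re (g y / g y2)) -` {0<..}"
  have N1: "open N1" "y2 \<in> N1" "N1 \<subseteq> N'" "\<And>y. y \<in> N1 \<Longrightarrow> norm y < \<tau>" "\<And>y. y \<in> N1 \<Longrightarrow> 0 < Re (g y / g y2)"
  proof -
    have "ball 0 \<tau> \<subseteq> N'" using \<tau>(2) by auto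
    then show "N1 \<subseteq> N'" by (auto simp: N1_def)
    show "open N1"
      unfolding N1_def using \<open>ball 0 \<tau> \<subseteq> N'\<close> gy2
      by (intro continuous_open_preimage continuous_intros continuous_on_subset[OF holo_on_continuous[OF g]]) auto
    show "y2 \<in> N1" using ny2 gy2 by (simp add: N1_def)
  qed (simp_all add: N1_def)
  define D where "D u w = w + (dirderiv f w (y2 + u) - dirderiv f w y2) *s c" for u w
  \<comment> \<open>This map straightens \<open>f\<close>. As \<open>c\<close> has derivative 1, the
    linear form \<open>dirderiv f _ y2\<close> takes the value \<open>f (y2 + u)\<close> at
    \<open>\<Xi> u\<close>, so zeros of \<open>f\<close> go to its kernel. The derivative at 0 is
    the identity, and \<open>E\<close> is respected because \<open>c\<close> lies in
    \<open>E\<close>.\<close>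
  define \<Xi> where "\<Xi> u = u + (f (y2 + u) - dirderiv f u y2) *s c" for u
  define U where "U = (\<lambda>u. y2 + u) -` N1"
  have U: "open U" "0 \<in> U"
    using N1(1,2) unfolding U_def by (auto intro!: open_vimage continuous_intros)
  have UN': "y2 + u \<in> N'" if "u \<in> U" for u using that N1(3) by (auto simp: U_def)
  have der\<Xi>: "(\<Xi> has_derivative D u) (at u)" if u: "u \<in> U" for u
  proof -
    have "((\<lambda>u. y2 + u) has_derivative (\<lambda>w. w)) (at u)"
      by (auto intro!: derivative_eq_intros)
    from has_derivative_compose[OF this holo_has_derivative_dirderiv[OF f UN'[OF u]]]
    have 1: "((\<lambda>u. f (y2 + u)) has_derivative (\<lambda>w. dirderiv f w (y2 + u))) (at u)" .
    have 2: "((\<lambda>u. dirderiv f u y2) has_derivative (\<lambda>w. dirderiv f w y2)) (at u)"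
      using has_derivative_bounded_linear[OF holo_has_derivative_dirderiv[OF f e0(2)]]
      by (rule bounded_linear_imp_has_derivative)
    show ?thesis
      unfolding \<Xi>_def D_def
      by (intro has_derivative_add has_derivative_ident
          bounded_linear.has_derivative[OF bounded_linear_smult_left] has_derivative_diff 1 2)
  qed
  have contD: "continuous_on U (\<lambda>u. D u w)" for w
    unfolding D_def using UN'
    by (intro continuous_intros continuous_on_compose2[OF continuous_on_dirderiv[OF f N'(1)]]) auto
  have injD: "inj (D 0)" by (simp add: D_def inj_on_def)
  have clD: "D u (b *s w) = b *s D u w" if "u \<in> U" for u b w
    unfolding D_def dirderiv_smult[OF f UN'[OF that]] dirderiv_smult[OF f e0(2)]
    by (simp add: vec_eq_iff algebra_simps)
  obtain U' V' \<gamma> where U': "open U'" "U' \<subseteq> U" "0 \<in> U'" "open V'" "homeomorphism U' V' \<Xi> \<gamma>" "hmap V' \<gamma>"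
    using hmap_local_inverse[OF U der\<Xi> contD injD clD] by metis
  have \<gamma>: "\<gamma> u \<in> U'" "\<Xi> (\<gamma> u) = u" if "u \<in> V'" for u
    using U'(5) that by (auto simp: homeomorphism_def)
  have \<Xi>: "\<Xi> w \<in> V'" "\<gamma> (\<Xi> w) = w" if "w \<in> U'" for w
    using U'(5) that by (auto simp: homeomorphism_def)
  have \<Xi>0: "\<Xi> 0 = 0"
    using linear_0[OF linear_dirderiv[OF f e0(2)]] by (simp add: \<Xi>_def fy2)
  have \<gamma>0: "\<gamma> 0 = 0" "0 \<in> V'" using \<Xi>[OF U'(3)] by (simp_all add: \<Xi>0)
  have U'N1: "y2 + w \<in> N1" if "w \<in> U'" for w using that U'(2) by (auto simp: U_def)
  have U'N: "y2 + w \<in> N" if "w \<in> U'" for w using U'N1[OF that] N1(3) N'(3) by auto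
  have \<Xi>E: "\<Xi> w \<in> E \<longleftrightarrow> w \<in> E" for w
  proof -
    have "(f (y2 + w) - dirderiv f w y2) *s c \<in> E" by (rule ch'(9)[OF c(1)])
    then show ?thesis
      using subspace_add[OF ch'(8)] subspace_diff[OF ch'(8)] unfolding \<Xi>_def
      by (metis add_diff_cancel_right')
  qed
  define E' where "E' = {e \<in> E. dirderiv f e y2 = 0}"
  have lin: "linear (\<lambda>w. dirderiv f w y2)" by (rule linear_dirderiv[OF f e0(2)])
  have subE': "subspace E'"
    unfolding E'_def using ch'(8) lin
    by (auto simp: subspace_def linear_0[OF lin] linear_add[OF lin] linear_cmul[OF lin])
  have "v \<notin> E'" using gy2 by (simp add: E'_def g_def)
  then have "E' \<subset> E" using v by (auto simp: E'_def)
  then have dimE': "dim E' < dim E"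
    using subE' ch'(8) by (intro dim_psubset) (simp add: span_eq_iff[THEN iffD2])
  define \<psi>' where "\<psi>' u = \<psi> (y2 + \<gamma> u)" for u
  define \<Phi>' where "\<Phi>' z = \<Xi> (\<Phi> z - y2)" for z
  define W' where "W' = \<psi> ` ((\<lambda>u. y2 + u) ` U')"
  have W'eq: "W' = W \<inter> \<Phi> -` ((\<lambda>u. y2 + u) ` U')"
    unfolding W'_def using U'N \<psi>W \<Phi>\<psi> ch'(5)
    by (auto simp: homeomorphism_def image_iff)
  have openW': "open W'"
    unfolding W'eq
    by (intro continuous_open_preimage open_translation U'(1) ch'(3))
       (use ch'(5) in \<open>auto simp: homeomorphism_def\<close>)
  have hmap_sh: "hmap V' (\<lambda>u. y2 + \<gamma> u)"
    by (rule hmap_compose[OF hmap_translation[of UNIV] U'(6)]) auto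
  have hmap\<psi>': "hmap V' \<psi>'"
    unfolding \<psi>'_def by (rule hmap_compose[OF ch'(6) hmap_sh]) (use U'N \<gamma> in auto)
  have \<Phi>sh: "\<Phi> z - y2 \<in> U'" if "z \<in> W'" for z
    using that by (auto simp: W'eq)
  have hmap\<Xi>: "hmap U' \<Xi>"
    unfolding hmap_def using der\<Xi> clD U'(2) by blast
  have hmap\<Phi>': "hmap W' \<Phi>'"
    unfolding \<Phi>'_def
  proof (rule hmap_compose[OF hmap\<Xi>])
    show "hmap W' (\<lambda>z. \<Phi> z - y2)"
      by (rule hmap_compose[OF hmap_minus_const[of UNIV]])
         (use W'eq in \<open>auto intro: hmap_subset[OF ch'(7)]\<close>)
  qed (use \<Phi>sh in auto)
  have homeo: "homeomorphism V' W' \<psi>' \<Phi>'"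
  proof (rule homeomorphismI)
    show "continuous_on V' \<psi>'" "continuous_on W' \<Phi>'" by (rule hmap_continuous hmap\<psi>' hmap\<Phi>')+
    show "\<psi>' ` V' \<subseteq> W'" using \<gamma> by (auto simp: \<psi>'_def W'_def)
    show "\<Phi>' ` W' \<subseteq> V'" using \<Phi>sh \<Xi> by (auto simp: \<Phi>'_def)
    show "\<Phi>' (\<psi>' u) = u" if "u \<in> V'" for u
      using that \<gamma>[OF that] \<Phi>\<psi>[OF U'N] by (simp add: \<Phi>'_def \<psi>'_def)
    show "\<psi>' (\<Phi>' z) = z" if "z \<in> W'" for z
    proof -
      have "\<psi> (\<Phi> z) = z" using that ch'(5) by (auto simp: W'eq homeomorphism_def)
      then show ?thesis using \<Xi>(2)[OF \<Phi>sh[OF that]] by (simp add: \<Phi>'_def \<psi>'_def)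
    qed
  qed
  have XW': "top_part \<inter> W' \<subseteq> \<psi>' ` (E' \<inter> V')"
  proof
    fix z assume z: "z \<in> top_part \<inter> W'"
    then obtain e where e: "e \<in> E" "e \<in> N" "z = \<psi> e" using ch'(10) W'eq by auto
    obtain w where w: "w \<in> U'" "e = y2 + w"
      using \<Phi>sh[of z] z \<Phi>\<psi>[OF e(2)] unfolding e(3)
      by (metis Int_iff add.commute diff_add_cancel)
    have wE: "w \<in> E" using subspace_diff[OF ch'(8) e(1) e0(1)] w(2) by simp
    have "f e = 0" using f0[OF e(1)] U'N1[OF w(1)] N1(3) w(2) z e(3) by auto
    then have "\<Xi> w = w + (- dirderiv f w y2) *s c" by (simp add: \<Xi>_def w(2))
    then have "dirderiv f (\<Xi> w) y2 = 0"
      by (simp only: linear_add[OF lin] dirderiv_smult[OF f e0(2)] c(2)) simp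
    then have "\<Xi> w \<in> E' \<inter> V'" using \<Xi>E wE \<Xi>(1)[OF w(1)] by (simp add: E'_def)
    moreover have "\<psi>' (\<Xi> w) = z" by (simp add: \<psi>'_def \<Xi>(2)[OF w(1)] w(2) e(3))
    ultimately show "z \<in> \<psi>' ` (E' \<inter> V')" by blast
  qed
  \<comment> \<open>The added terms are the holomorphic functions behind
    \<open>- \<epsilon>' * |\<psi> y - x|^2\<close> and \<open>\<delta> * ln |g y|\<close>; with
    them the new height is \<open>ln (Q y)\<close> up to the constant \<open>K\<close>.\<close>
  define H0 where "H0 y = (H y + of_real (2 * \<epsilon>') * herm (\<psi> y) x) + of_real \<delta> * Ln (g y / g y2)" for y
  have holoH0: "holo_on N1 H0"
    unfolding H0_def
  proof (intro holo_on_add holo_on_cmult)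
    show "holo_on N1 H" using N1(3) N'(3) by (intro holo_on_subset[OF ch'(12)]) auto
    show "holo_on N1 (\<lambda>y. herm (\<psi> y) x)"
      by (rule holo_compose[OF holo_on_herm[of UNIV]])
         (use N1(3) N'(3) in \<open>auto intro: hmap_subset[OF ch'(6)]\<close>)
    show "holo_on N1 (\<lambda>y. Ln (g y / g y2))"
    proof (rule holo_on_compose_field[OF holo_on_subset[OF g N1(3)]])
      fix y assume y: "y \<in> N1"
      have "g y / g y2 \<notin> \<real>\<^sub>\<le>\<^sub>0" using N1(5)[OF y] complex_nonpos_Reals_iff by force
      then show "((\<lambda>w. Ln (w / g y2)) has_field_derivative (inverse (g y / g y2) * (1 / g y2))) (at (g y))"
        using gy2 by (auto intro!: derivative_eq_intros)
    qed
  qed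
  have holoH': "holo_on V' (\<lambda>u. H0 (y2 + \<gamma> u))"
    by (rule holo_compose[OF holoH0 hmap_sh]) (use U'N1 \<gamma> in auto)
  define K where "K = \<epsilon>' * (norm x)\<^sup>2 + \<delta> * (ln C - ln (cmod (g y2)))"
  have hq: "height \<psi> H0 (\<epsilon> + \<epsilon>') y = ln (Q y) + K" "0 < Q y" if y: "y \<in> N1" for y
  proof -
    have gy: "g y \<noteq> 0" using N1(5)[OF y] by auto
    have lnQ: "ln (Q y) = \<phi> y + \<delta> * (ln (cmod (g y)) - ln C)"
      using gy C(1) by (simp add: Q_def ln_mult ln_powr ln_div)
    have "Re (Ln (g y / g y2)) = ln (cmod (g y)) - ln (cmod (g y2))"
      using gy gy2 by (simp add: norm_divide ln_div)
    then have ReH0: "Re (H0 y) = Re (H y) + 2 * \<epsilon>' * Re (herm (\<psi> y) x) + \<delta> * (ln (cmod (g y)) - ln (cmod (g y2)))"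
      by (simp add: H0_def)
    have n: "(norm (\<psi> y - x))\<^sup>2 = (norm (\<psi> y))\<^sup>2 - 2 * Re (herm (\<psi> y) x) + (norm x)\<^sup>2"
      using norm_diff_smult[of "\<psi> y" 1 x] by simp
    show "height \<psi> H0 (\<epsilon> + \<epsilon>') y = ln (Q y) + K"
      unfolding lnQ K_def \<phi>_def height_def ReH0 n by (simp add: algebra_simps)
    show "0 < Q y" using gy C(1) by (simp add: Q_def)
  qed
  have max': "height \<psi>' (\<lambda>u. H0 (y2 + \<gamma> u)) (\<epsilon> + \<epsilon>') u \<le> height \<psi>' (\<lambda>u. H0 (y2 + \<gamma> u)) (\<epsilon> + \<epsilon>') 0"
    if u: "u \<in> V'" "u \<in> E'" "\<psi>' u \<in> top_part" for u
  proof -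
    have in1: "y2 + \<gamma> u \<in> N1" by (rule U'N1[OF \<gamma>(1)[OF u(1)]])
    have "\<gamma> u \<in> E" using \<Xi>E[of "\<gamma> u"] \<gamma>(2)[OF u(1)] u(2) by (simp add: E'_def)
    then have "y2 + \<gamma> u \<in> A"
      using subspace_add[OF ch'(8) e0(1)] N1(4)[OF in1] u(3) by (simp add: A_def \<psi>'_def)
    then have "ln (Q (y2 + \<gamma> u)) \<le> ln (Q y2)"
      using y2(2) hq(2)[OF in1] hq(2)[OF N1(2)] by simp
    then show ?thesis
      using hq(1)[OF in1] hq(1)[OF N1(2)] by (simp add: height_def \<psi>'_def \<gamma>0)
  qed
  have "max_chart E' \<psi>' \<Phi>' V' W' (\<lambda>u. H0 (y2 + \<gamma> u)) (\<epsilon> + \<epsilon>') \<epsilon>0"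
    unfolding max_chart_def
  proof (intro conjI)
    show "W' \<subseteq> CHball" "\<forall>z\<in>W'. \<epsilon>0 < rho (a i0) z ^ Suc k"
      using ch'(4,15) by (auto simp: W'eq)
    show "\<forall>b w. w \<in> E' \<longrightarrow> b *s w \<in> E'"
      using ch'(9) dirderiv_smult[OF f e0(2)] by (simp add: E'_def)
    show "\<psi>' 0 \<in> top_part" using e0(3) by (simp add: \<psi>'_def \<gamma>0)
    show "\<forall>\<^sub>F y in nhds 0. y \<in> E' \<and> \<psi>' y \<in> top_part \<longrightarrow>
      height \<psi>' (\<lambda>u. H0 (y2 + \<gamma> u)) (\<epsilon> + \<epsilon>') y \<le> height \<psi>' (\<lambda>u. H0 (y2 + \<gamma> u)) (\<epsilon> + \<epsilon>') 0"
      by (rule eventually_mono[OF eventually_nhds_in_open[OF U'(4) \<gamma>0(2)]]) (use max' in blast)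
  qed (use U' \<gamma>0 openW' homeo hmap\<psi>' hmap\<Phi>' subE' XW' holoH' ch'(13) \<epsilon>' in auto)
  with dimE' show ?thesis by blast
qed

text \<open>Otherwise take such a function with the least order of vanishing at the centre along a line of \<open>E\<close>;
  its derivative along that line has smaller order, so it cannot vanish on \<open>top_part\<close> near the centre.\<close>

lemma max_chart_vanish:
  assumes ch: "max_chart E \<psi> \<Phi> N W H \<epsilon> \<epsilon>0"
    and min: "\<And>E' \<psi>' \<Phi>' N' W' H' \<epsilon>'. max_chart E' \<psi>' \<Phi>' N' W' H' \<epsilon>' \<epsilon>0 \<Longrightarrow> dim E \<le> dim E'"
    and N': "open N'" "0 \<in> N'" "N' \<subseteq> N" and f: "holo_on N' f"
    and f0: "\<And>y. y \<in> E \<Longrightarrow> y \<in> N' \<Longrightarrow> \<psi> y \<in> top_part \<Longrightarrow> f y = 0"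
  shows "\<forall>\<^sub>F y in nhds 0. y \<in> E \<longrightarrow> f y = 0"
proof (rule ccontr)
  assume neg: "\<not> ?thesis"
  have chE: "subspace E" "\<And>c v. v \<in> E \<Longrightarrow> c *s v \<in> E" "\<psi> 0 \<in> top_part"
    using ch unfolding max_chart_def by auto
  \<comment> \<open>The function, its neighbourhood and the line all vary, so the minimum is taken
    over germs at the centre that vanish on \<open>top_part\<close> and over all lines of
    \<open>E\<close>.\<close>
  define P where "P s \<longleftrightarrow> (\<exists>M g v. open M \<and> 0 \<in> M \<and> M \<subseteq> N \<and> holo_on M g \<and>
    (\<forall>y\<in>E \<inter> M. \<psi> y \<in> top_part \<longrightarrow> g y = 0) \<and> v \<in> E \<and> (deriv ^^ s) (\<lambda>\<zeta>. g (\<zeta> *s v)) 0 \<noteq> 0)" for s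
  have "\<exists>s. P s"
  proof -
    obtain R where R: "R > 0" "ball 0 R \<subseteq> N'" using N'(1,2) open_contains_ball by blast
    have "\<exists>e\<in>E \<inter> ball 0 R. f e \<noteq> 0"
    proof (rule ccontr)
      assume "\<not> ?thesis"
      then have "\<forall>y\<in>ball 0 R. y \<in> E \<longrightarrow> f y = 0" by blast
      then have "\<forall>\<^sub>F y in nhds 0. y \<in> E \<longrightarrow> f y = 0"
        using R(1) by (intro eventually_nhds[THEN iffD2] exI[of _ "ball 0 R"]) auto
      with neg show False by blast
    qed
    then obtain e where e: "e \<in> E" "norm e < R" "f e \<noteq> 0" by auto
    have "f 0 = 0" by (rule f0[OF _ N'(2) chE(3)]) (use chE(1) subspace_0 in blast)
    then have ne: "norm e > 0" using e(3) by auto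
    have "(\<lambda>\<zeta>. f (0 + \<zeta> *s e)) holomorphic_on ball 0 (R / norm e)"
    proof (rule holo_line[OF f])
      fix \<zeta> :: complex assume "\<zeta> \<in> ball 0 (R / norm e)"
      then have "cmod \<zeta> * norm e < R" using ne by (simp add: pos_less_divide_eq)
      then show "0 + \<zeta> *s e \<in> N'" using R(2) by (auto simp: norm_smult_vec)
    qed
    then have hol: "(\<lambda>\<zeta>. f (\<zeta> *s e)) holomorphic_on ball 0 (R / norm e)" by simp
    have "1 \<in> ball (0::complex) (R / norm e)" using e(2) ne by (simp add: pos_less_divide_eq)
    \<comment> \<open>If all derivatives at 0 vanished, so would the function on the disc, but at 1
      its value is \<open>f e\<close>.\<close>
    then have "\<exists>s. (deriv ^^ s) (\<lambda>\<zeta>. f (\<zeta> *s e)) 0 \<noteq> 0"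
      using holomorphic_fun_eq_0_on_ball[OF hol] e(3) by fastforce
    then show ?thesis unfolding P_def using N' f f0 e(1) by blast
  qed
  define s where "s = (LEAST s. P s)"
  have "P s" unfolding s_def by (rule LeastI_ex) fact
  then obtain M g v where M: "open M" "0 \<in> M" "M \<subseteq> N" "holo_on M g" "\<And>y. y \<in> E \<Longrightarrow> y \<in> M \<Longrightarrow> \<psi> y \<in> top_part \<Longrightarrow> g y = 0"
    "v \<in> E" "(deriv ^^ s) (\<lambda>\<zeta>. g (\<zeta> *s v)) 0 \<noteq> 0"
    unfolding P_def by blast
  have "g 0 = 0" by (rule M(5)[OF _ M(2) chE(3)]) (use chE(1) subspace_0 in blast)
  then have "s \<noteq> 0" using M(7) by (cases s) auto
  then obtain s' where s': "s = Suc s'" by (cases s) auto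
  have lineM: "open {\<zeta>. \<zeta> *s v \<in> M}" "0 \<in> {\<zeta>. \<zeta> *s v \<in> M}"
  proof -
    have "continuous_on UNIV (\<lambda>\<zeta>. \<zeta> *s v)" by (intro continuous_intros)
    then show "open {\<zeta>. \<zeta> *s v \<in> M}"
      using open_vimage[OF M(1)] by (auto simp: vimage_def)
  qed (use M(2) in simp)
  have dder: "deriv (\<lambda>\<zeta>. g (\<zeta> *s v)) \<zeta> = dirderiv g v (\<zeta> *s v)" if "\<zeta> *s v \<in> M" for \<zeta>
    using dirderiv_line[OF M(4), of 0 \<zeta> v] that by (auto intro: DERIV_imp_deriv)
  have hdd: "holo_on M (dirderiv g v)" by (rule holo_on_dirderiv[OF M(4,1)])
  have "(deriv ^^ s') (deriv (\<lambda>\<zeta>. g (\<zeta> *s v))) 0 = (deriv ^^ s') (\<lambda>\<zeta>. dirderiv g v (\<zeta> *s v)) 0"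
  proof (rule higher_deriv_transform_within_open[OF _ _ lineM])
    show "(\<lambda>\<zeta>. dirderiv g v (\<zeta> *s v)) holomorphic_on {\<zeta>. \<zeta> *s v \<in> M}"
      using holo_line[OF hdd, of "{\<zeta>. \<zeta> *s v \<in> M}" 0 v] by simp
    have "(\<lambda>\<zeta>. g (\<zeta> *s v)) holomorphic_on {\<zeta>. \<zeta> *s v \<in> M}"
      using holo_line[OF M(4), of "{\<zeta>. \<zeta> *s v \<in> M}" 0 v] by simp
    then show "deriv (\<lambda>\<zeta>. g (\<zeta> *s v)) holomorphic_on {\<zeta>. \<zeta> *s v \<in> M}"
      by (rule holomorphic_deriv[OF _ lineM(1)])
  qed (use dder in auto)
  then have ne: "(deriv ^^ s') (\<lambda>\<zeta>. dirderiv g v (\<zeta> *s v)) 0 \<noteq> 0"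
    using M(7) by (simp add: s' funpow_swap1)
  have nv: "\<exists>y\<in>E \<inter> M' \<inter> M. \<psi> y \<in> top_part \<and> dirderiv g v y \<noteq> 0" if M': "open M'" "0 \<in> M'" for M'
  proof (rule ccontr)
    assume no: "\<not> ?thesis"
    have "holo_on (M' \<inter> M) (dirderiv g v)" by (rule holo_on_subset[OF hdd]) auto
    then have "P s'"
      unfolding P_def using M(1,2,3,6) M' no ne
      by (intro exI[of _ "M' \<inter> M"] exI[of _ "dirderiv g v"] exI[of _ v]) auto
    then have "s \<le> s'" unfolding s_def by (rule Least_le)
    then show False by (simp add: s')
  qed
  have "\<exists>E' \<psi>' \<Phi>' N'' W' H' \<epsilon>'. max_chart E' \<psi>' \<Phi>' N'' W' H' \<epsilon>' \<epsilon>0 \<and> dim E' < dim E"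
    by (rule max_chart_refine[OF ch M(1-4) _ M(6)]) (use M(5) nv in auto)
  then show False
    using min by (meson leD)
qed

section \<open>Local equations of the variety and the exclusion of minima\<close>

lemma V_local:
  assumes "z \<in> CHball"
  obtains W F where "open W" "z \<in> W" "finite F" "\<forall>f\<in>F. holo_on W f"
    "V \<inter> W = {w \<in> W. \<forall>f\<in>F. f w = 0}"
proof -
  obtain W F where *: "open W \<and> z \<in> W \<and> W \<subseteq> CHball \<and> finite F \<and>
      (\<forall>f\<in>F. holo_on W f) \<and> V \<inter> W = {w\<in>W. \<forall>f\<in>F. f w = 0}"
    using bspec[OF conjunct2[OF V[unfolded analytic_subset_def]] assms] by (elim exE)
  show ?thesis
    by (rule that[of W F]) (simp_all add: *)
qed

lemma V_closed:
  assumes "z \<in> CHball" "z \<in> closure V"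
  shows "z \<in> V"
proof -
  obtain W F where W: "open W" "z \<in> W" "finite F" "\<forall>f\<in>F. holo_on W f"
    "V \<inter> W = {w \<in> W. \<forall>f\<in>F. f w = 0}"
    by (rule V_local[OF assms(1)])
  have "f z = 0" if f: "f \<in> F" for f
  proof (rule ccontr)
    assume "f z \<noteq> 0"
    have "open (W \<inter> f -` (- {0}))"
      by (rule continuous_open_preimage[OF holo_on_continuous[OF bspec[OF W(4) f]] W(1)]) auto
    moreover have "z \<in> W \<inter> f -` (- {0})" using W(2) \<open>f z \<noteq> 0\<close> by auto
    ultimately have "(W \<inter> f -` (- {0})) \<inter> V \<noteq> {}"
      using assms(2) open_Int_closure_eq_empty by blast
    then show False using W(5) f by blast
  qed
  then show ?thesis using W(2,5) by blast
qed

lemma pieces_subset: "pieces k V \<subseteq> V"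
  unfolding pieces_def by blast

lemma V_subset: "V \<subseteq> CHball"
  using V unfolding analytic_subset_def by blast

lemma top_part_subset: "top_part \<subseteq> V"
  unfolding top_part_def using V_closed closure_mono[OF pieces_subset] by blast

lemma pieces_subset_top_part: "pieces k V \<subseteq> top_part"
  unfolding top_part_def using pieces_subset V_subset closure_subset by blast

text \<open>In a chart of least dimension all local equations of \<open>V\<close> vanish along
  \<open>E\<close>, so \<open>\<psi>\<close> maps a ball of \<open>E\<close> into \<open>V\<close>.
  As \<open>dim E >= 2 * k\<close>, that image is filled by pieces and lies in
  \<open>top_part\<close>. The maximum relative to \<open>top_part\<close> is then a maximum on
  \<open>E\<close>, contrary to \<open>no_local_max\<close>.\<close>

theorem poincare_no_min:
  assumes x0: "x0 \<in> top_part" and min: "\<And>z. z \<in> top_part \<Longrightarrow> poincare I a k x0 \<le> poincare I a k z"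
  shows False
proof -
  have x0B: "x0 \<in> CHball" using x0 by (simp add: top_part_def)
  \<comment> \<open>One bound for all later values of \<open>\<epsilon>\<close>; the factor one half
    lets \<open>rho ^ Suc k\<close> exceed it on a whole neighbourhood of \<open>x0\<close>.\<close>
  define \<epsilon>0 where "\<epsilon>0 = rho (a i0) x0 ^ Suc k / 2"
  have r0: "0 < rho (a i0) x0" by (rule rho_pos[OF in_ball[OF i0] x0B])
  have \<epsilon>0: "0 < \<epsilon>0" "\<epsilon>0 < rho (a i0) x0 ^ Suc k" using r0 by (auto simp: \<epsilon>0_def)
  define W where "W = CHball \<inter> (\<lambda>z. rho (a i0) z ^ Suc k) -` {\<epsilon>0<..}"
  have W: "open W" "x0 \<in> W"
    using x0B \<epsilon>0 unfolding W_def
    by (auto intro!: continuous_open_preimage open_CHball continuous_intros continuous_on_rho in_ball i0)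
  \<comment> \<open>The initial chart is a translation, with \<open>E\<close> the whole space and no
    perturbation.\<close>
  have "max_chart UNIV (\<lambda>y. x0 + y) (\<lambda>z. z - x0) ((\<lambda>y. x0 + y) -` W) W (\<lambda>y. 0) 0 \<epsilon>0"
    unfolding max_chart_def
  proof (intro conjI)
    show "open ((\<lambda>y. x0 + y) -` W)" using W(1) by (auto intro!: open_vimage continuous_intros)
    show "homeomorphism ((\<lambda>y. x0 + y) -` W) W (\<lambda>y. x0 + y) (\<lambda>z. z - x0)"
      by (rule homeomorphismI) (auto intro!: continuous_intros)
    show "top_part \<inter> W \<subseteq> (\<lambda>y. x0 + y) ` (UNIV \<inter> (\<lambda>y. x0 + y) -` W)"
      by (auto intro!: image_eqI[of _ "\<lambda>y. x0 + y" "z - x0" for z])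
    show "\<forall>\<^sub>F y in nhds 0. y \<in> UNIV \<and> x0 + y \<in> top_part \<longrightarrow> height (\<lambda>y. x0 + y) (\<lambda>y. 0) 0 y \<le> height (\<lambda>y. x0 + y) (\<lambda>y. 0) 0 0"
      by (rule always_eventually) (use min in \<open>auto simp: height_def\<close>)
  qed (use W x0 \<epsilon>0 hmap_translation hmap_minus_const holo_on_const in \<open>auto simp: W_def\<close>)
  then have ex: "\<exists>d E \<psi> \<Phi> N W H \<epsilon>. max_chart E \<psi> \<Phi> N W H \<epsilon> \<epsilon>0 \<and> dim E = d" by blast
  define d where "d = (LEAST d. \<exists>E \<psi> \<Phi> N W H \<epsilon>. max_chart E \<psi> \<Phi> N W H \<epsilon> \<epsilon>0 \<and> dim E = d)"
  from LeastI_ex[OF ex, folded d_def]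
  obtain E \<psi> \<Phi> N W H \<epsilon> where ch: "max_chart E \<psi> \<Phi> N W H \<epsilon> \<epsilon>0" and dE: "dim E = d" by blast
  have least: "dim E \<le> dim E'" if "max_chart E' \<psi>' \<Phi>' N' W' H' \<epsilon>' \<epsilon>0" for E' \<psi>' \<Phi>' N' W' H' \<epsilon>'
    unfolding dE d_def by (rule Least_le) (use that in blast)
  have ch': "open N" "0 \<in> N" "open W" "W \<subseteq> CHball" "homeomorphism N W \<psi> \<Phi>" "hmap N \<psi>" "hmap W \<Phi>" "subspace E"
    "\<And>c v. v \<in> E \<Longrightarrow> c *s v \<in> E" "top_part \<inter> W \<subseteq> \<psi> ` (E \<inter> N)" "\<psi> 0 \<in> top_part" "holo_on N H" "0 \<le> \<epsilon>" "\<epsilon> < \<epsilon>0"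
    "\<And>z. z \<in> W \<Longrightarrow> \<epsilon>0 < rho (a i0) z ^ Suc k"
    "\<forall>\<^sub>F y in nhds 0. y \<in> E \<and> \<psi> y \<in> top_part \<longrightarrow> height \<psi> H \<epsilon> y \<le> height \<psi> H \<epsilon> 0"
    using ch unfolding max_chart_def by auto
  have \<psi>W: "\<psi> y \<in> W" if "y \<in> N" for y using ch'(5) that by (auto simp: homeomorphism_def)
  have \<Phi>\<psi>: "\<Phi> (\<psi> y) = y" if "y \<in> N" for y using ch'(5) that by (auto simp: homeomorphism_def)
  have cont\<psi>: "continuous_on N \<psi>" by (rule hmap_continuous[OF ch'(6)])
  have xB: "\<psi> 0 \<in> CHball" using \<psi>W[OF ch'(2)] ch'(4) by blast
  obtain W1 F where W1: "open W1" "\<psi> 0 \<in> W1" "finite F" "\<forall>f\<in>F. holo_on W1 f"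
    "V \<inter> W1 = {w \<in> W1. \<forall>f\<in>F. f w = 0}"
    by (rule V_local[OF xB])
  define N1 where "N1 = N \<inter> \<psi> -` W1"
  have N1: "open N1" "0 \<in> N1" "N1 \<subseteq> N" "\<psi> ` N1 \<subseteq> W1"
    using continuous_open_preimage[OF cont\<psi> ch'(1) W1(1)] W1(2) ch'(2) by (auto simp: N1_def)
  have "\<forall>\<^sub>F y in nhds 0. y \<in> E \<longrightarrow> f (\<psi> y) = 0" if f: "f \<in> F" for f
  proof (rule max_chart_vanish[OF ch least N1(1-3)])
    show "holo_on N1 (\<lambda>y. f (\<psi> y))"
      by (rule holo_compose[OF bspec[OF W1(4) f] hmap_subset[OF ch'(6) N1(3)] N1(4)])
    show "f (\<psi> y) = 0" if "y \<in> E" "y \<in> N1" "\<psi> y \<in> top_part" for y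
      using that N1(4) top_part_subset W1(5) f by blast
  qed
  then have "\<forall>\<^sub>F y in nhds 0. \<forall>f\<in>F. y \<in> E \<longrightarrow> f (\<psi> y) = 0"
    using W1(3) by (intro eventually_ball_finite) auto
  moreover have "\<forall>\<^sub>F y in nhds 0. y \<in> N1"
    by (rule eventually_nhds_in_open[OF N1(1,2)])
  ultimately have "\<forall>\<^sub>F y in nhds 0. y \<in> N1 \<and> (y \<in> E \<longrightarrow> \<psi> y \<in> V)"
  proof eventually_elim
    case (elim y)
    then have "y \<in> E \<longrightarrow> \<psi> y \<in> V \<inter> W1" using W1(5) N1(4) by blast
    then show ?case using elim by blast
  qed
  then obtain R where R: "R > 0" "\<And>y. norm y < R \<Longrightarrow> y \<in> N1 \<and> (y \<in> E \<longrightarrow> \<psi> y \<in> V)"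
    unfolding eventually_nhds_metric by auto
  \<comment> \<open>The centre is a limit of pieces, so some piece meets \<open>W\<close>. Its part
    inside \<open>W\<close> is carried by \<open>\<Phi>\<close> continuously and injectively into
    \<open>E\<close>, and invariance of domain compares the dimensions.\<close>
  have dimE: "2 * k \<le> dim E"
  proof -
    have "\<psi> 0 \<in> closure (pieces k V)" using ch'(11) by (simp add: top_part_def)
    then have "W \<inter> pieces k V \<noteq> {}"
      using open_Int_closure_eq_empty[OF ch'(3), of "pieces k V"] \<psi>W[OF ch'(2)] by blast
    then obtain y where y: "y \<in> W" "y \<in> pieces k V" by blast
    then obtain U S and f :: "complex^'n \<Rightarrow> complex^'n" where S: "subspace U" "dim U = 2 * k"
      "openin (top_of_set U) S" "continuous_on S f" "inj_on f S" "f ` S \<subseteq> V" "y \<in> f ` S"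
      unfolding pieces_def by blast
    define S' where "S' = S \<inter> f -` W"
    have fX: "f ` S \<subseteq> top_part"
    proof -
      have "f ` S \<subseteq> pieces k V" unfolding pieces_def using S by blast
      then show ?thesis using pieces_subset_top_part by blast
    qed
    have opS': "openin (top_of_set U) S'"
      unfolding S'_def using continuous_openin_preimage_gen[OF S(4) ch'(3)] S(3) openin_trans by blast
    have S'E: "\<exists>e\<in>E \<inter> N. f s = \<psi> e" if "s \<in> S'" for s
      using that fX ch'(10) unfolding S'_def by blast
    have "dim U \<le> dim E"
    proof (rule invariance_of_dimension_subspaces[OF opS' S(1) ch'(8)])
      show "continuous_on S' (\<lambda>s. \<Phi> (f s))"
        by (rule continuous_on_compose2[of W \<Phi>])
           (use ch'(5) S(4) in \<open>auto simp: S'_def homeomorphism_def intro: continuous_on_subset\<close>)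
      show "(\<lambda>s. \<Phi> (f s)) \<in> S' \<rightarrow> E" using S'E \<Phi>\<psi> by force
      show "inj_on (\<lambda>s. \<Phi> (f s)) S'"
      proof (rule inj_onI)
        fix s t assume st: "s \<in> S'" "t \<in> S'" "\<Phi> (f s) = \<Phi> (f t)"
        then have "f s = f t" using S'E \<Phi>\<psi> by (metis IntD2)
        then show "s = t" using st S(5) by (auto simp: S'_def inj_on_def)
      qed
      show "S' \<noteq> {}" using y(1) S(7) by (auto simp: S'_def)
    qed
    then show ?thesis using S(2) by simp
  qed
  obtain U where U: "subspace U" "U \<subseteq> E" "dim U = 2 * k"
    using choose_subspace_of_subspace[OF dimE] ch'(8) by (metis span_eq_iff)
  \<comment> \<open>\<open>dim E\<close> may exceed \<open>2 * k\<close>; the piece through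
    \<open>\<psi> e\<close> is the image of the slice of \<open>E\<close> through \<open>e\<close>
    parallel to \<open>U\<close>.\<close>
  have inX: "\<psi> e \<in> top_part" if e: "e \<in> E" "norm e < R" for e
  proof -
    define S where "S = U \<inter> {u. norm (e + u) < R}"
    have "openin (top_of_set U) S"
      unfolding S_def by (intro openin_open_Int open_Collect_less continuous_intros)
    moreover have "continuous_on S (\<lambda>u. \<psi> (e + u))"
      by (rule continuous_on_compose2[OF cont\<psi>])
         (use R(2) N1(3) in \<open>auto simp: S_def intro!: continuous_intros\<close>)
    moreover have "inj_on (\<lambda>u. \<psi> (e + u)) S"
    proof (rule inj_onI)
      fix u w assume "u \<in> S" "w \<in> S" "\<psi> (e + u) = \<psi> (e + w)"
      moreover have "e + u \<in> N" "e + w \<in> N" using calculation R(2) N1(3) by (auto simp: S_def)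
      ultimately show "u = w" using \<Phi>\<psi> by (metis add_left_cancel)
    qed
    moreover have "(\<lambda>u. \<psi> (e + u)) ` S \<subseteq> V"
    proof
      fix z assume "z \<in> (\<lambda>u. \<psi> (e + u)) ` S"
      then obtain u where u: "u \<in> U" "norm (e + u) < R" "z = \<psi> (e + u)" by (auto simp: S_def)
      then have "e + u \<in> E" using U(2) e(1) subspace_add[OF ch'(8)] by blast
      then show "z \<in> V" using R(2) u by blast
    qed
    moreover have "\<psi> e \<in> (\<lambda>u. \<psi> (e + u)) ` S"
      using subspace_0[OF U(1)] e(2) by (auto simp: S_def intro!: image_eqI[of _ _ 0])
    ultimately have "\<psi> e \<in> pieces k V" unfolding pieces_def using U(1,3) by blast
    then show ?thesis using pieces_subset_top_part by blast
  qed
  obtain T where T: "(\<psi> has_derivative T) (at 0)" using ch'(2,6) unfolding hmap_def by blast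
  have "inj T"
  proof -
    obtain D where D: "(\<Phi> has_derivative D) (at (\<psi> 0))"
      using ch'(7) \<psi>W[OF ch'(2)] unfolding hmap_def by blast
    have "((\<lambda>y. \<Phi> (\<psi> y)) has_derivative (\<lambda>w. D (T w))) (at 0)"
      by (rule has_derivative_compose[OF T D])
    then have "((\<lambda>y. y) has_derivative (\<lambda>w. D (T w))) (at 0)"
      by (rule has_derivative_transform_within_open[OF _ ch'(1,2)]) (use \<Phi>\<psi> in auto)
    then have "(\<lambda>w. D (T w)) = (\<lambda>w. w)"
      using has_derivative_unique has_derivative_ident by blast
    then show ?thesis by (metis injI)
  qed
  show False
  proof (rule no_local_max[OF ch'(1,2,6) xB _ T \<open>inj T\<close> ch'(8,9) dimE k ch'(12) i0 ch'(13)])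
    show "\<psi> ` N \<subseteq> CHball" using \<psi>W ch'(4) by blast
    show "\<epsilon> < rho (a i0) (\<psi> 0) ^ Suc k" using ch'(14) ch'(15)[OF \<psi>W[OF ch'(2)]] by simp
    have "\<forall>\<^sub>F y in nhds 0. y \<in> ball 0 R" by (rule eventually_nhds_in_open) (use R(1) in auto)
    with ch'(16) show "\<forall>\<^sub>F y in nhds 0. y \<in> E \<longrightarrow> - poincare I a k (\<psi> y) - \<epsilon> * (norm (\<psi> y))\<^sup>2 + Re (H y)
      \<le> - poincare I a k (\<psi> 0) - \<epsilon> * (norm (\<psi> 0))\<^sup>2 + Re (H 0)"
      by eventually_elim (use inX in \<open>auto simp: height_def\<close>)
  qed
qed

end

section \<open>Manifold points, isometries and the quotient\<close>

text \<open>An implicit function argument: the equations are completed to local coordinates by the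
  orthogonal projection onto their common tangent space \<open>E\<close>, and the inverse coordinate
  map, restricted to a \<open>2 * k\<close>-dimensional subspace of \<open>E\<close>, parametrises a
  part of \<open>V\<close>.\<close>

lemma manifold_point_pieces:
  fixes V :: "(complex^'n) set"
  assumes "manifold_point V k z"
  shows "z \<in> pieces k V"
proof -
  note mp = assms[unfolded manifold_point_def]
  note zV = mp[THEN conjunct1] and kn = mp[THEN conjunct2, THEN conjunct1]
  obtain W and f :: "nat \<Rightarrow> complex^'n \<Rightarrow> complex" and a where h: "open W \<and> z \<in> W \<and>
        (\<forall>j<CARD('n) - k. \<forall>w\<in>W. ((f j) has_derivative (\<lambda>v. \<Sum>i\<in>UNIV. a j w $ i * v $ i)) (at w)) \<and>
        (\<forall>w\<in>W. \<forall>c::nat \<Rightarrow> complex. (\<Sum>j<CARD('n) - k. c j *s a j w) = 0 \<longrightarrow> (\<forall>j<CARD('n) - k. c j = 0)) \<and>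
        V \<inter> W = {w\<in>W. \<forall>j<CARD('n) - k. f j w = (0::complex)}"
    using mp[THEN conjunct2, THEN conjunct2] by (elim exE)
  note W = h[THEN conjunct1] h[THEN conjunct2, THEN conjunct1]
  note der = h[THEN conjunct2, THEN conjunct2, THEN conjunct1, rule_format]
  note indep = h[THEN conjunct2, THEN conjunct2, THEN conjunct2, THEN conjunct1, rule_format]
  note VW = h[THEN conjunct2, THEN conjunct2, THEN conjunct2, THEN conjunct2]
  define m where "m = CARD('n) - k"
  \<comment> \<open>Conjugated, so that the differential of \<open>f j\<close> at \<open>z\<close>
    becomes \<open>herm _ (\<beta> j)\<close>.\<close>
  define \<beta> :: "nat \<Rightarrow> complex^'n" where "\<beta> j = (\<chi> i. cnj (a j z $ i))" for j
  have herm\<beta>: "(\<Sum>i\<in>UNIV. a j z $ i * v $ i) = herm v (\<beta> j)" for j v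
    by (simp add: herm_def \<beta>_def mult.commute)
  have indep\<beta>: "c j = 0" if "(\<Sum>j<m. c j *s \<beta> j) = 0" "j < m" for c j
  proof -
    have "(\<Sum>j<m. cnj (c j) *s a j z) = 0"
    proof (rule vec_eq_iff[THEN iffD2], rule allI)
      fix i
      have "(\<Sum>j<m. c j * cnj (a j z $ i)) = 0"
        using arg_cong[OF that(1), of "\<lambda>u. u $ i"] by (simp add: \<beta>_def)
      then have "cnj (\<Sum>j<m. c j * cnj (a j z $ i)) = 0" by simp
      then show "(\<Sum>j<m. cnj (c j) *s a j z) $ i = 0 $ i" by simp
    qed
    then have "cnj (c j) = 0" using indep[OF W(2), of "\<lambda>j. cnj (c j)"] that(2) by (simp add: m_def)
    then show ?thesis by simp
  qed
  \<comment> \<open>A real spanning set of the complex span of the \<open>\<beta> j\<close>. Real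
    orthogonality to \<open>\<beta> j\<close> and to \<open>\<i> *s \<beta> j\<close> amounts to
    \<open>herm v (\<beta> j) = 0\<close>, so the real dimension formula applies to
    \<open>E\<close>.\<close>
  define B where "B = (\<Union>j<m. {\<beta> j, \<i> *s \<beta> j})"
  define E where "E = {v. \<forall>x\<in>span B. orthogonal x v}"
  have E_iff: "v \<in> E \<longleftrightarrow> (\<forall>j<m. herm v (\<beta> j) = 0)" for v
  proof
    assume "v \<in> E"
    show "\<forall>j<m. herm v (\<beta> j) = 0"
    proof (intro allI impI)
      fix j assume "j < m"
      then have "\<beta> j \<in> span B" "\<i> *s \<beta> j \<in> span B" by (auto simp: B_def intro!: span_base)
      then have "(cmod (herm v (\<beta> j)))\<^sup>2 = 0"
        using \<open>v \<in> E\<close> unfolding cmod_herm_sq E_def by (auto simp: orthogonal_def inner_commute)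
      then show "herm v (\<beta> j) = 0" by simp
    qed
  next
    assume R: "\<forall>j<m. herm v (\<beta> j) = 0"
    have "orthogonal v x" if xB: "x \<in> B" for x
    proof -
      obtain j where j: "j < m" "x = \<beta> j \<or> x = \<i> *s \<beta> j" using xB by (auto simp: B_def)
      have "(inner v (\<beta> j))\<^sup>2 + (inner v (\<i> *s \<beta> j))\<^sup>2 = 0"
        using R j(1) by (simp flip: cmod_herm_sq)
      then show ?thesis using j(2) by (auto simp: orthogonal_def add_nonneg_eq_0_iff)
    qed
    then show "v \<in> E"
      unfolding E_def using orthogonal_to_span orthogonal_commute by blast
  qed
  have subE: "subspace E"
    unfolding E_def by (auto simp: subspace_def orthogonal_def inner_right_distrib)
  have dimE: "2 * k \<le> dim E"
  proof -
    have "card B \<le> (\<Sum>j<m. card {\<beta> j, \<i> *s \<beta> j})"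
      unfolding B_def by (rule card_UN_le) simp
    also have "\<dots> \<le> (\<Sum>j<m. 2)" by (intro sum_mono) (simp add: card_insert_if)
    finally have "card B \<le> 2 * m" by simp
    moreover have "finite B" by (simp add: B_def)
    ultimately have "dim (span B) \<le> 2 * m" using dim_le_card'[of B] by (simp add: dim_span)
    moreover have "dim E + dim (span B) = 2 * CARD('n)"
      using dim_subspace_orthogonal_to_vectors[of "span B" UNIV] by (simp add: E_def)
    ultimately show ?thesis using kn by (simp add: m_def)
  qed
  obtain Bs where Bs: "Bs \<subseteq> E" "pairwise orthogonal Bs" "\<And>x. x \<in> Bs \<Longrightarrow> norm x = 1"
    "independent Bs" "span Bs = E"
    using orthonormal_basis_subspace[OF subE] by metis
  have finBs: "finite Bs" using Bs(4) independent_imp_finite by blast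
  define \<pi> where "\<pi> v = (\<Sum>b\<in>Bs. inner v b *\<^sub>R b)" for v
  have \<pi>E: "\<pi> v \<in> E" for v
    unfolding \<pi>_def using Bs(1) subE by (intro subspace_sum) (auto intro: subspace_scale)
  have \<pi>_id: "\<pi> v = v" if "v \<in> E" for v
    unfolding \<pi>_def using that Bs(5) by (intro orthonormal_basis_expand[OF Bs(2,3) _ finBs]) auto
  have bl\<pi>: "bounded_linear \<pi>"
    unfolding \<pi>_def
    by (intro bounded_linear_sum bounded_linear_scaleR_const bounded_linear_inner_left)
  \<comment> \<open>Such a \<open>u\<close> is orthogonal to itself. This separates the two summands
    of \<open>F\<close> and of its derivative.\<close>
  have perp: "u = 0" if "u \<in> E" "u = (\<Sum>j<m. c j *s \<beta> j)" for u c
  proof -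
    have "herm u u = (\<Sum>j<m. cnj (c j) * herm u (\<beta> j))"
      by (subst (2) that(2)) (simp add: herm_def sum_distrib_left sum.swap[of _ UNIV] mult_ac)
    also have "\<dots> = 0" using that(1) E_iff by simp
    finally show ?thesis by (simp add: herm_self)
  qed
  define F where "F w = \<pi> (w - z) + (\<Sum>j<m. f j w *s \<beta> j)" for w
  define D where "D w v = \<pi> v + (\<Sum>j<m. dirderiv (f j) v w *s \<beta> j)" for w v
  have holo: "holo_on W (f j)" if "j < m" for j
    unfolding holo_on_def using der[of j] that by (auto simp: m_def)
  have derF: "(F has_derivative D w) (at w)" if "w \<in> W" for w
    unfolding F_def D_def
    by (intro has_derivative_add has_derivative_sum bounded_linear.has_derivative[OF bounded_linear_smult_left]
        bounded_linear.has_derivative[OF bl\<pi>] holo_has_derivative_dirderiv[OF holo _]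
        has_derivative_diff[OF has_derivative_ident has_derivative_const, simplified]) (use that in auto)
  have contD: "continuous_on W (\<lambda>w. D w v)" for v
    unfolding D_def by (intro continuous_intros continuous_on_dirderiv[OF holo W(1)]) auto
  have dirderiv_herm: "dirderiv (f j) v z = herm v (\<beta> j)" if "j < m" for j v
  proof -
    have "(f j has_derivative (\<lambda>v. herm v (\<beta> j))) (at z)"
      using der[OF _ W(2), of j] that unfolding herm\<beta> m_def by blast
    then show ?thesis by (rule dirderiv_unique[OF _ herm_smult_left])
  qed
  have "inj (D z)"
  proof (rule linear_injective_0[THEN iffD2])
    show "linear (D z)" using derF[OF W(2)] has_derivative_linear by blast
    show "\<forall>v. D z v = 0 \<longrightarrow> v = 0"
    proof (intro allI impI)
      fix v assume "D z v = 0"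
      then have "\<pi> v = - (\<Sum>j<m. dirderiv (f j) v z *s \<beta> j)"
        unfolding D_def by (rule eq_neg_iff_add_eq_0[THEN iffD2])
      also have "\<dots> = (\<Sum>j<m. (- herm v (\<beta> j)) *s \<beta> j)"
        by (simp add: dirderiv_herm vec_eq_iff flip: sum_negf)
      finally have *: "\<pi> v = (\<Sum>j<m. (- herm v (\<beta> j)) *s \<beta> j)" .
      then have "\<pi> v = 0" by (rule perp[OF \<pi>E])
      then have "- herm v (\<beta> j) = 0" if "j < m" for j
        using indep\<beta>[of "\<lambda>j. - herm v (\<beta> j)" j] * that by simp
      then have "v \<in> E" using E_iff by simp
      then show "v = 0" using \<pi>_id \<open>\<pi> v = 0\<close> by simp
    qed
  qed
  then obtain U' V' g where U': "open U'" "U' \<subseteq> W" "z \<in> U'" "open V'" "homeomorphism U' V' F g"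
    using local_inverse[OF W derF contD] by metis
  have g: "g y \<in> U'" "F (g y) = y" if "y \<in> V'" for y
    using U'(5) that by (auto simp: homeomorphism_def)
  obtain U where U: "subspace U" "U \<subseteq> E" "dim U = 2 * k"
    using choose_subspace_of_subspace[OF dimE] subE by (metis span_eq_iff)
  have "f j z = 0" if "j < m" for j using zV W(2) VW that by (auto simp: m_def)
  then have Fz: "F z = 0" by (simp add: F_def \<pi>_def)
  have gV: "g y \<in> V" if y: "y \<in> U" "y \<in> V'" for y
  proof -
    have "(\<Sum>j<m. f j (g y) *s \<beta> j) = y - \<pi> (g y - z)"
      using g(2)[OF y(2)] by (simp add: F_def algebra_simps)
    then have in_E: "(\<Sum>j<m. f j (g y) *s \<beta> j) \<in> E"
      using y(1) U(2) \<pi>E subspace_diff[OF subE] by auto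
    have "(\<Sum>j<m. f j (g y) *s \<beta> j) = 0" by (rule perp[OF in_E refl])
    then have "\<forall>j<m. f j (g y) = 0" using indep\<beta>[of "\<lambda>j. f j (g y)"] by simp
    moreover have "g y \<in> W" using g(1)[OF y(2)] U'(2) by blast
    ultimately show ?thesis using VW unfolding m_def by blast
  qed
  have "openin (top_of_set U) (U \<inter> V')" using U'(4) by (simp add: openin_open_Int)
  moreover have "continuous_on (U \<inter> V') g"
    using U'(5) by (auto simp: homeomorphism_def intro: continuous_on_subset)
  moreover have "inj_on g (U \<inter> V')" using g(2) by (metis IntD2 inj_onI)
  moreover have "g ` (U \<inter> V') \<subseteq> V" using gV by blast
  moreover have "z \<in> g ` (U \<inter> V')"
  proof -
    have "0 \<in> V'" "g 0 = z" using U'(3,5) Fz by (auto simp: homeomorphism_def)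
    then show ?thesis using subspace_0[OF U(1)] by (auto intro!: image_eqI[of _ _ 0])
  qed
  ultimately show ?thesis unfolding pieces_def using U(1,3) by blast
qed

section \<open>Isometries and the passage to the quotient\<close>

lemma ch_isom_rho:
  assumes g: "ch_isom g" and "z \<in> CHball" "w \<in> CHball"
  shows "rho (g w) (g z) = rho w z"
proof -
  have "g z \<in> CHball" "g w \<in> CHball" "chdist (g z) (g w) = chdist z w"
    using assms unfolding ch_isom_def by (auto dest: bij_betwE)
  then show ?thesis using assms(2,3) by (simp add: rho_eq_chdist)
qed

lemma dist_le_rho:
  assumes "x \<in> CHball" "z \<in> CHball"
  shows "(dist z x)\<^sup>2 \<le> 4 / (1 - (norm x)\<^sup>2) * (1 - rho x z)"
proof -
  have x: "0 < 1 - (norm x)\<^sup>2" by (rule CHball_pos[OF assms(1)])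
  have "norm z * norm x \<le> 1"
    using assms unfolding CHball_def by (intro mult_le_one) auto
  then have "cmod (1 - herm z x) \<le> 2"
    using norm_triangle_ineq4[of 1 "herm z x"] herm_Cauchy_Schwarz[of z x] by simp
  then have "(cmod (1 - herm z x))\<^sup>2 \<le> 2\<^sup>2" by (intro power_mono) auto
  moreover have "0 < (cmod (1 - herm z x))\<^sup>2" using herm_ne_one[OF assms] by simp
  ultimately have "(1 - (norm x)\<^sup>2) * (norm (z - x))\<^sup>2 / 4
      \<le> ((1 - (norm x)\<^sup>2) * (norm (z - x))\<^sup>2 + (cmod (herm (z - x) x))\<^sup>2) / (cmod (1 - herm z x))\<^sup>2"
    using x by (intro frac_le) auto
  also have "\<dots> = 1 - rho x z" by (rule one_minus_rho[OF assms, symmetric])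
  finally show ?thesis using x by (simp add: dist_norm field_simps)
qed

text \<open>\<open>ch_isom\<close> speaks of \<open>chdist\<close> only. The Euclidean distance of
  the images is controlled by \<open>1 - rho\<close>, which isometries preserve and which tends to 0
  by continuity of \<open>rho x\<close>.\<close>

lemma ch_isom_continuous:
  fixes g :: "complex^'n \<Rightarrow> complex^'n"
  assumes g: "ch_isom g"
  shows "continuous_on CHball g"
  unfolding continuous_on
proof
  fix x :: "complex^'n" assume x: "x \<in> CHball"
  have gB: "g z \<in> CHball" if "z \<in> CHball" for z
    using g that unfolding ch_isom_def by (auto dest: bij_betwE)
  let ?c = "4 / (1 - (norm (g x))\<^sup>2)"
  have "((\<lambda>z. ?c * (1 - rho x z)) \<longlongrightarrow> ?c * (1 - rho x x)) (at x within CHball)"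
    using continuous_on_rho[OF x] x by (intro tendsto_intros) (auto simp: continuous_on)
  then have "((\<lambda>z. ?c * (1 - rho x z)) \<longlongrightarrow> 0) (at x within CHball)"
    by (simp add: rho_self[OF x])
  then have "((\<lambda>z. (dist (g z) (g x))\<^sup>2) \<longlongrightarrow> 0) (at x within CHball)"
  proof (rule tendsto_sandwich[rotated 3])
    have "\<forall>\<^sub>F z in at x within CHball. z \<in> CHball" by (simp add: eventually_at_filter)
    then show "\<forall>\<^sub>F z in at x within CHball. (dist (g z) (g x))\<^sup>2 \<le> ?c * (1 - rho x z)"
      by eventually_elim (use dist_le_rho[OF gB[OF x] gB] ch_isom_rho[OF g _ x] in metis)
  qed auto
  then have "((\<lambda>z. sqrt ((dist (g z) (g x))\<^sup>2)) \<longlongrightarrow> sqrt 0) (at x within CHball)"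
    by (rule tendsto_real_sqrt)
  then show "(g \<longlongrightarrow> g x) (at x within CHball)"
    by (subst tendsto_dist_iff) simp
qed

text \<open>Composition with a continuous injection preserves the topological definition, so
  antiholomorphic isometries are covered too.\<close>

lemma pieces_isom:
  fixes g :: "complex^'n \<Rightarrow> complex^'n"
  assumes "ch_isom g" "V \<subseteq> CHball" "g ` V \<subseteq> V" "y \<in> pieces k V"
  shows "g y \<in> pieces k V"
proof -
  obtain U S and f :: "complex^'n \<Rightarrow> complex^'n" where S: "subspace U" "dim U = 2 * k"
      "openin (top_of_set U) S" "continuous_on S f" "inj_on f S" "f ` S \<subseteq> V" "y \<in> f ` S"
    using assms(4) unfolding pieces_def by blast
  have "continuous_on S (g \<circ> f)"
    using ch_isom_continuous[OF assms(1)] S(6) assms(2)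
    by (intro continuous_on_compose S(4)) (auto intro: continuous_on_subset)
  moreover have "inj_on g (f ` S)"
    using assms(1,2) S(6) unfolding ch_isom_def by (meson bij_betw_imp_inj_on inj_on_subset order_trans)
  then have "inj_on (g \<circ> f) S" by (rule comp_inj_on[OF S(5)])
  moreover have "(g \<circ> f) ` S \<subseteq> V" "g y \<in> (g \<circ> f) ` S" using S(6,7) assms(3) by auto
  ultimately show ?thesis unfolding pieces_def using S(1-3) by blast
qed

text \<open>Every orbit in \<open>top_part\<close> meets \<open>K\<close> and the orbit sum is
  invariant, so its minimum over the compact set \<open>top_part \<inter> K\<close> is a minimum
  over all of \<open>top_part\<close>, which \<open>poincare_no_min\<close> excludes.\<close>

theorem theorem1p5:
  fixes G :: "(complex^'n \<Rightarrow> complex^'n) set" and p :: "complex^'n" and k :: nat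
  assumes "isom_subgroup G" and "discrete_isom_group G" and "torsion_free G"
    and "p \<in> CHball"
    and "0 < k" and "k \<le> CARD('n)"
    and "crit_exp G p < ereal (2 * real k)"
  shows "\<not> (\<exists>V. compact_subvariety_quot G k V)"
proof
  assume "\<exists>V. compact_subvariety_quot G k V"
  then obtain V K where VK: "analytic_subset CHball V" "analytic_dim V k" "\<And>g. g \<in> G \<Longrightarrow> g ` V \<subseteq> V"
    and K: "compact K" "K \<subseteq> CHball" "V \<subseteq> (\<Union>g\<in>G. g ` K)"
    unfolding compact_subvariety_quot_def by blast
  have isom: "ch_isom g" if "g \<in> G" for g using assms(1) that by (simp add: isom_subgroup_def)
  have gB: "g z \<in> CHball" if "g \<in> G" "z \<in> CHball" for g z
    using isom[OF that(1)] that(2) unfolding ch_isom_def by (auto dest: bij_betwE)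
  have inv: "\<exists>h\<in>G. g \<circ> h = id \<and> h \<circ> g = id" if "g \<in> G" for g
    using assms(1) that by (simp add: isom_subgroup_def)
  have comp: "g \<circ> h \<in> G" if "g \<in> G" "h \<in> G" for g h
    using assms(1) that by (simp add: isom_subgroup_def)
  have "orbit_sum G (\<lambda>g. g p) k p"
  proof
    show "g p \<in> CHball" if "g \<in> G" for g by (rule gB[OF that assms(4)])
    \<comment> \<open>The infimum lies below \<open>2 * k\<close>, hence so does some exponent of
      convergence; as distances are nonnegative, the larger exponent \<open>2 * k\<close> converges
      as well.\<close>
    obtain s where s: "s < 2 * real k" "(\<lambda>g. exp (- s * chdist p (g p))) summable_on G"
      using assms(7) unfolding crit_exp_def Inf_less_iff by auto
    show "(\<lambda>g. rho (g p) p ^ k) summable_on G"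
    proof (rule summable_on_comparison_test)
      show "(\<lambda>g. 4 ^ k * exp (- s * chdist p (g p))) summable_on G"
        by (rule summable_on_cmult_right[OF s(2)])
      fix g assume g: "g \<in> G"
      have gp: "g p \<in> CHball" by (rule gB[OF g assms(4)])
      show "0 \<le> rho (g p) p ^ k" using rho_pos[OF gp assms(4)] by simp
      have "rho (g p) p ^ k \<le> 4 ^ k * exp (- (2 * real k) * chdist p (g p))"
        by (rule rho_power_le[OF assms(4) gp])
      also have "\<dots> \<le> 4 ^ k * exp (- s * chdist p (g p))"
        using s(1) cosh_chdist(2)[OF assms(4) gp] by (intro mult_left_mono) (auto intro: mult_right_mono)
      finally show "rho (g p) p ^ k \<le> 4 ^ k * exp (- s * chdist p (g p))" .
    qed
  qed (rule assms(4))
  \<comment> \<open>The identity serves as the distinguished index, whose orbit point is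
    \<open>p\<close> itself.\<close>
  then interpret orbit_variety G "\<lambda>g. g p" k p V id
    using VK(1) assms(1,5) by (intro orbit_variety.intro orbit_variety_axioms.intro) (auto simp: isom_subgroup_def)
  let ?P = "poincare G (\<lambda>g. g p) k"
  have P_inv: "?P (h z) = ?P z" if h: "h \<in> G" and z: "z \<in> CHball" for h z
  proof -
    obtain h' where h': "h' \<in> G" "h \<circ> h' = id" "h' \<circ> h = id" using inv[OF h] by blast
    \<comment> \<open>Left translation by \<open>h\<close> permutes the group, and
      \<open>rho\<close> is unchanged when \<open>h\<close> is applied to both arguments.\<close>
    have bij: "bij_betw (\<lambda>g. h \<circ> g) G G"
    proof (rule bij_betw_byWitness[where f' = "\<lambda>g. h' \<circ> g"])
      show "\<forall>g\<in>G. h' \<circ> (h \<circ> g) = g" "\<forall>g\<in>G. h \<circ> (h' \<circ> g) = g"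
        using h'(2,3) by (simp_all flip: comp_assoc)
    qed (use comp h h'(1) in auto)
    have "?P (h z) = (\<Sum>\<^sub>\<infinity>g\<in>G. rho ((h \<circ> g) p) (h z) ^ k)"
      unfolding poincare_def by (rule infsum_reindex_bij_betw[OF bij, symmetric])
    also have "\<dots> = ?P z"
      unfolding poincare_def by (rule infsum_cong) (simp add: ch_isom_rho[OF isom[OF h] z] gB assms(4))
    finally show ?thesis .
  qed
  have top_part_inv: "h z \<in> top_part" if h: "h \<in> G" and z: "z \<in> top_part" for h z
  proof -
    have zB: "z \<in> CHball" using z by (simp add: top_part_def)
    have "h z \<in> closure (pieces k V)"
      unfolding closure_iff_nhds_not_empty
    proof (intro allI impI)
      fix A T assume "T \<subseteq> A" "open T" "h z \<in> T"
      have "open (CHball \<inter> h -` T)"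
        by (rule continuous_open_preimage[OF ch_isom_continuous[OF isom[OF h]] open_CHball \<open>open T\<close>])
      moreover have "z \<in> CHball \<inter> h -` T" using zB \<open>h z \<in> T\<close> by simp
      ultimately have "(CHball \<inter> h -` T) \<inter> pieces k V \<noteq> {}"
        using z open_Int_closure_eq_empty unfolding top_part_def by blast
      then obtain y where "y \<in> pieces k V" "h y \<in> T" by blast
      then show "pieces k V \<inter> A \<noteq> {}"
        using pieces_isom[OF isom[OF h] V_subset VK(3)[OF h]] \<open>T \<subseteq> A\<close> by blast
    qed
    then show ?thesis using gB[OF h zB] by (simp add: top_part_def)
  qed
  have recur: "\<exists>h\<in>G. h z \<in> top_part \<inter> K" if z: "z \<in> top_part" for z
  proof -
    obtain g y where g: "g \<in> G" "y \<in> K" "z = g y" using z top_part_subset K(3) by blast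
    obtain h where h: "h \<in> G" "h \<circ> g = id" using inv[OF g(1)] by blast
    then have "h z = y" using g(3) by (simp add: pointfree_idE)
    then show ?thesis using top_part_inv[OF h(1) z] g(2) h(1) by auto
  qed
  have "compact (top_part \<inter> K)"
  proof -
    have "top_part \<inter> K = K \<inter> closure (pieces k V)" using K(2) by (auto simp: top_part_def)
    then show ?thesis using K(1) by (simp add: compact_Int_closed)
  qed
  \<comment> \<open>\<open>analytic_dim\<close> provides a manifold point of dimension exactly
    \<open>k\<close>, which lies in a piece; some group element moves it into
    \<open>K\<close>.\<close>
  moreover have "top_part \<inter> K \<noteq> {}"
    using VK(2) manifold_point_pieces pieces_subset_top_part recur unfolding analytic_dim_def by blast
  moreover have "continuous_on (top_part \<inter> K) ?P"
    by (rule continuous_on_subset[OF continuous_poincare]) (auto simp: top_part_def)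
  ultimately obtain x0 where x0: "x0 \<in> top_part \<inter> K" "\<And>z. z \<in> top_part \<inter> K \<Longrightarrow> ?P x0 \<le> ?P z"
    using continuous_attains_inf by metis
  show False
  proof (rule poincare_no_min)
    show "x0 \<in> top_part" using x0(1) by simp
    fix z assume z: "z \<in> top_part"
    obtain h where h: "h \<in> G" "h z \<in> top_part \<inter> K" using recur[OF z] by blast
    have "?P x0 \<le> ?P (h z)" by (rule x0(2)[OF h(2)])
    also have "\<dots> = ?P z" using P_inv[OF h(1)] z by (simp add: top_part_def)
    finally show "?P x0 \<le> ?P z" .
  qed
qed

end
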